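(* Let $N\ge 3$ be an integer, $\alpha\in\mathbb{R}$, and $0<\lambda\le\lambda^*=\left(\frac{N-2}{2}\right)^2$. Put $\lambda_N=\frac{N-2}{2}-\sqrt{\left(\frac{N-2}{2}\right)^2-\lambda}$ (so $\lambda_N>0$). For $\delta\in(0,\pi)$ and $p>1$, consider on the unit sphere $\mathbb{S}^N$ the problem $$(\mathcal P)\qquad \begin{cases}\partial_t u-\Delta_{\mathbb{S}^N}u-\dfrac{\lambda}{\sin^2 d(o,x)}\,u\ge(\sin d(o,x))^{\alpha}|u|^p+f(x) & \text{in }(0,\infty)\times\Omega_\delta,\\ u\ge 0 & \text{on }(0,\infty)\times\Gamma_\delta.\end{cases}$$ (i) There exists $a_\lambda\in[0,\pi)$ such that, for every $\delta\in(a_\lambda,\pi)$, the following nonexistence results hold. (a) If $p>\max\left\{1,\,1+\frac{\alpha+2}{\lambda_N}\right\}$, then $(\mathcal P)$ admits no weak solution for any function $f\in L^1_{\mathrm{loc}}(\overline{\Omega_\delta}^{\,\pi})$ with $f\ge 0$ and $f\not\equiv 0$. (b) Assume that either $\alpha>-2$ and $0<\lambda<\lambda^*$, or $-2<\alpha<\frac{N-6}{2}$ and $\lambda=\lambda^*$. If $p=1+\frac{\alpha+2}{\lambda_N}$, then $(\mathcal P)$ admits no weak solution for any function $f\in L^1_{\mathrm{loc}}(\overline{\Omega_\delta}^{\,\pi})$ with $f\ge 0$ and $f\not\equiv 0$. (ii) Assume that $\alpha>-2$ and $1<p<1+\frac{\alpha+2}{\lambda_N}$. Then there exists $b\in[0,\pi)$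 such that, for every $\delta\in(b,\pi)$, problem $(\mathcal P)$ admits classical solutions $u\in C^\infty((0,\infty)\times\Omega_\delta)\cap C(Q)$ for some function $f\in C(\overline{\Omega_\delta}^{\,\pi})$ with $f>0$.
   Context: $\mathbb{S}^N$ is the unit sphere in $\mathbb{R}^{N+1}$ with its standard Riemannian metric, geodesic distance $d$, Riemannian measure $d\mu$ and Laplace--Beltrami operator $\Delta_{\mathbb{S}^N}$. A point $o\in\mathbb{S}^N$ is fixed. For $\delta\in(0,\pi)$: $\Omega_\delta=\{x\in\mathbb{S}^N:\delta<d(o,x)<\pi\}$, $\overline{\Omega_\delta}^{\,\pi}=\{x\in\mathbb{S}^N:\delta\le d(o,x)<\pi\}$, $\Gamma_\delta=\{x\in\mathbb{S}^N:d(o,x)=\delta\}$, $Q=(0,\infty)\times\overline{\Omega_\delta}^{\,\pi}$, $\Sigma=(0,\infty)\times\Gamma_\delta$. $L^1_{\mathrm{loc}}(\overline{\Omega_\delta}^{\,\pi})$ and $L^p_{\mathrm{loc}}(Q)$ mean integrability (of the function, resp. of its $p$-th power) on compact subsets of $\overline{\Omega_\delta}^{\,\pi}$, resp. $Q$ (such compact sets may touch $\Gamma_\delta$, resp. $\Sigma$). $\nu$ is the outward unit normal to $\Gamma_\delta$ with respect to $\Omega_\delta$ (i.e. $\nu=-\partial_r$, $r=d(o,x)$), and $\partial_\nu\xi=\langle\nabla_{\mathbb{S}^N}\xi,\nu\rangle$. $C_c^{1,2}(Q)$ is the space of functions compactly supported in $Q$, of class $C^1$ in $t$ and $C^2$ in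 $x$. The class of admissible test functions is $$\mathcal{X}=\{\xi\in C_c^{1,2}(Q):\ \xi\ge0,\ \xi=0\text{ on }\Sigma,\ \partial_\nu\xi\le0\text{ on }\Sigma\}.$$ Weak solution of $(\mathcal P)$: a function $u\in L^p_{\mathrm{loc}}(Q)$ (real valued, no sign condition) such that for every $\xi\in\mathcal{X}$, $$\int_Q(\sin d(o,x))^\alpha|u|^p\xi\,d\mu\,dt+\int_Q f(x)\,\xi\,d\mu\,dt\le-\int_Q u\,\partial_t\xi\,d\mu\,dt-\int_Q u\left(\Delta_{\mathbb{S}^N}\xi+\frac{\lambda}{\sin^2 d(o,x)}\xi\right)d\mu\,dt.$$ Classical solution of $(\mathcal P)$: a function $u$ of the stated regularity satisfying both inequalities in $(\mathcal P)$ pointwise. *)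

theory Defs
  imports "HOL-Analysis.Analysis"
begin

section \<open>The unit sphere of a Euclidean space as a Riemannian manifold\<close>

text \<open>
  The sphere \<open>S^N\<close> is \<open>sphere 0 1\<close> in a Euclidean space of dimension \<open>N + 1\<close>, with the induced
  metric.  Tangent vectors at \<open>x\<close> are the ambient vectors orthogonal to \<open>x\<close>.
\<close>

definition geo_dist :: "'a::euclidean_space \<Rightarrow> 'a \<Rightarrow> real" where
  "geo_dist x y = arccos (x \<bullet> y)"

text \<open>
  In polar coordinates \<open>y = r x\<close> Lebesgue measure is \<open>r^N dr d\<mu>(x)\<close>, so the Riemannian measure of
  \<open>A\<close> is \<open>N + 1\<close> times the volume of the cone over \<open>A\<close> in the unit ball.  It is taken as a
  measure on the ambient Borel sets that is concentrated on the sphere.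
\<close>

definition sphere_measure :: "'a::euclidean_space measure" where
  "sphere_measure =
     scale_measure (of_nat DIM('a)) (distr (restrict_space lborel (cball 0 1)) borel sgn)"

lemma space_sphere_measure [simp]: "space sphere_measure = UNIV"
  by (simp add: sphere_measure_def space_scale_measure)

lemma sets_sphere_measure [simp, measurable_cong]: "sets sphere_measure = sets borel"
  by (simp add: sphere_measure_def)

lemma emeasure_sphere_measure:
  fixes A :: "'a::euclidean_space set"
  assumes "A \<in> sets borel"
  shows "emeasure sphere_measure A =
           of_nat DIM('a) * emeasure lborel {y \<in> cball 0 1. y /\<^sub>R norm y \<in> A}"
proof -
  have m: "sgn \<in> measurable (restrict_space lborel (cball 0 1)) (borel :: 'a measure)"
    by (rule measurable_restrict_space1) simp
  have eq: "sgn -` A \<inter> cball 0 1 = {y \<in> cball 0 1. y /\<^sub>R norm y \<in> A}"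
    by (auto simp: sgn_div_norm)
  have "sgn -` A \<inter> cball 0 1 \<in> sets (borel :: 'a measure)"
    using measurable_sets_borel[OF borel_measurable_sgn assms] by auto
  then have "emeasure (restrict_space lborel (cball 0 1)) (sgn -` A \<inter> cball 0 1) =
      emeasure lborel (sgn -` A \<inter> cball 0 1)"
    by (intro emeasure_restrict_space) auto
  then show ?thesis
    using assms
    unfolding eq[symmetric]
    by (simp add: sphere_measure_def emeasure_distr[OF m] space_restrict_space)
qed

lemma emeasure_sphere_measure_UNIV:
  "emeasure (sphere_measure :: 'a::euclidean_space measure) UNIV =
     of_nat DIM('a) * ennreal (unit_ball_vol DIM('a))"
proof -
  have "{y \<in> cball (0 :: 'a) 1. y /\<^sub>R norm y \<in> UNIV} = cball 0 1"
    by auto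
  then show ?thesis
    by (subst emeasure_sphere_measure) (auto simp: emeasure_cball)
qed

text \<open>
  The differential at \<open>x\<close> of a map on a subset \<open>S\<close> of the sphere.  A derivative within \<open>S\<close> is only
  determined on the tangent space at \<open>x\<close>; it is extended by \<open>0\<close> to the normal line.  At a smooth
  boundary point belonging to \<open>S\<close> this is the one-sided differential, still unique because the
  directions pointing into \<open>S\<close> span the tangent space.
\<close>

definition has_sph_derivative ::
    "('a::euclidean_space \<Rightarrow> 'b::real_normed_vector) \<Rightarrow> ('a \<Rightarrow> 'b) \<Rightarrow> 'a set \<Rightarrow> 'a \<Rightarrow> bool" where
  "has_sph_derivative g D S x \<longleftrightarrow> (g has_derivative D) (at x within S) \<and> D x = 0"

definition sph_differentiable ::
    "('a::euclidean_space \<Rightarrow> 'b::real_normed_vector) \<Rightarrow> 'a set \<Rightarrow> 'a \<Rightarrow> bool" where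
  "sph_differentiable g S x \<longleftrightarrow> (\<exists>D. has_sph_derivative g D S x)"

definition sph_derivative ::
    "('a::euclidean_space \<Rightarrow> 'b::real_normed_vector) \<Rightarrow> 'a set \<Rightarrow> 'a \<Rightarrow> 'a \<Rightarrow> 'b" where
  "sph_derivative g S x = (SOME D. has_sph_derivative g D S x)"

definition sph_grad :: "'a::euclidean_space set \<Rightarrow> ('a \<Rightarrow> real) \<Rightarrow> 'a \<Rightarrow> 'a" where
  "sph_grad S g x = (\<Sum>b\<in>Basis. sph_derivative g S x b *\<^sub>R b)"

text \<open>
  The covariant derivative of a tangent field is the tangential part of its ambient derivative, so
  its trace over the tangent space is the sum below (the normal direction contributes \<open>0\<close>).
\<close>

definition sph_div :: "'a::euclidean_space set \<Rightarrow> ('a \<Rightarrow> 'a) \<Rightarrow> 'a \<Rightarrow> real" where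
  "sph_div S X x = (\<Sum>b\<in>Basis. sph_derivative X S x b \<bullet> b)"

definition laplace_beltrami :: "'a::euclidean_space set \<Rightarrow> ('a \<Rightarrow> real) \<Rightarrow> 'a \<Rightarrow> real" where
  "laplace_beltrami S g x = sph_div S (sph_grad S g) x"


section \<open>Smooth functions\<close>

primrec Ck_on :: "nat \<Rightarrow> 'b::euclidean_space set \<Rightarrow> ('b \<Rightarrow> real) \<Rightarrow> bool" where
  "Ck_on 0 U g \<longleftrightarrow> continuous_on U g"
| "Ck_on (Suc k) U g \<longleftrightarrow>
     (\<forall>x\<in>U. g differentiable (at x)) \<and>
     (\<forall>b\<in>Basis. Ck_on k U (\<lambda>x. frechet_derivative g (at x) b))"

text \<open>
  Smoothness on a subset \<open>M\<close> of a Euclidean space, in particular on an embedded submanifold, by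
  local extension to open subsets of the ambient space.
\<close>

definition smooth_on_subset :: "'b::euclidean_space set \<Rightarrow> ('b \<Rightarrow> real) \<Rightarrow> bool" where
  "smooth_on_subset M g \<longleftrightarrow>
     (\<forall>z\<in>M. \<exists>U h. open U \<and> z \<in> U \<and> (\<forall>k. Ck_on k U h) \<and> (\<forall>y\<in>U \<inter> M. h y = g y))"


section \<open>The domains\<close>

definition Omega :: "'a::euclidean_space \<Rightarrow> real \<Rightarrow> 'a set" where
  "Omega pole \<delta> = {x \<in> sphere 0 1. \<delta> < geo_dist pole x \<and> geo_dist pole x < pi}"

definition Omega_bar :: "'a::euclidean_space \<Rightarrow> real \<Rightarrow> 'a set" where
  "Omega_bar pole \<delta> = {x \<in> sphere 0 1. \<delta> \<le> geo_dist pole x \<and> geo_dist pole x < pi}"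

definition Gamma_bd :: "'a::euclidean_space \<Rightarrow> real \<Rightarrow> 'a set" where
  "Gamma_bd pole \<delta> = {x \<in> sphere 0 1. geo_dist pole x = \<delta>}"

definition Q_dom :: "'a::euclidean_space \<Rightarrow> real \<Rightarrow> (real \<times> 'a) set" where
  "Q_dom pole \<delta> = {0<..} \<times> Omega_bar pole \<delta>"

definition Sigma_bd :: "'a::euclidean_space \<Rightarrow> real \<Rightarrow> (real \<times> 'a) set" where
  "Sigma_bd pole \<delta> = {0<..} \<times> Gamma_bd pole \<delta>"

abbreviation Q_measure :: "(real \<times> 'a::euclidean_space) measure" where
  "Q_measure \<equiv> lborel \<Otimes>\<^sub>M sphere_measure"

text \<open>
  Membership in \<open>L^q_loc(S)\<close> for a Borel representative; the compact subsets of \<open>S\<close> may contain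
  boundary points that belong to \<open>S\<close>.
\<close>

definition Lp_loc :: "'b::topological_space measure \<Rightarrow> real \<Rightarrow> 'b set \<Rightarrow> ('b \<Rightarrow> real) \<Rightarrow> bool" where
  "Lp_loc M q S g \<longleftrightarrow>
     set_borel_measurable M S g \<and>
     (\<forall>K. compact K \<and> K \<subseteq> S \<longrightarrow> set_integrable M K (\<lambda>z. \<bar>g z\<bar> powr q))"


section \<open>Test functions\<close>

text \<open>The outward unit normal \<open>- \<partial>\<^sub>r\<close>, where \<open>\<partial>\<^sub>r\<close> is the gradient of \<open>r = d(o,\<cdot>)\<close>.\<close>

definition outer_normal :: "'a::euclidean_space \<Rightarrow> 'a \<Rightarrow> 'a" where
  "outer_normal pole x = - sph_grad (sphere 0 1) (geo_dist pole) x"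

definition normal_derivative ::
    "'a::euclidean_space \<Rightarrow> real \<Rightarrow> ('a \<Rightarrow> real) \<Rightarrow> 'a \<Rightarrow> real" where
  "normal_derivative pole \<delta> g x = sph_grad (Omega_bar pole \<delta>) g x \<bullet> outer_normal pole x"

definition C12_on :: "'a::euclidean_space set \<Rightarrow> (real \<Rightarrow> 'a \<Rightarrow> real) \<Rightarrow> bool" where
  "C12_on S \<xi> \<longleftrightarrow>
     continuous_on ({0<..} \<times> S) (\<lambda>(t, x). \<xi> t x) \<and>
     (\<forall>t>0. \<forall>x\<in>S. (\<lambda>s. \<xi> s x) differentiable (at t)) \<and>
     continuous_on ({0<..} \<times> S) (\<lambda>(t, x). deriv (\<lambda>s. \<xi> s x) t) \<and>
     (\<forall>t>0. \<forall>x\<in>S. sph_differentiable (\<xi> t) S x) \<and>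
     continuous_on ({0<..} \<times> S) (\<lambda>(t, x). sph_grad S (\<xi> t) x) \<and>
     (\<forall>t>0. \<forall>x\<in>S. sph_differentiable (sph_grad S (\<xi> t)) S x) \<and>
     (\<forall>h. continuous_on ({0<..} \<times> S) (\<lambda>(t, x). sph_derivative (sph_grad S (\<xi> t)) S x h))"

definition test_function :: "'a::euclidean_space \<Rightarrow> real \<Rightarrow> (real \<Rightarrow> 'a \<Rightarrow> real) \<Rightarrow> bool" where
  "test_function pole \<delta> \<xi> \<longleftrightarrow>
     C12_on (Omega_bar pole \<delta>) \<xi> \<and>
     (\<exists>K. compact K \<and> K \<subseteq> Q_dom pole \<delta> \<and> (\<forall>(t, x)\<in>Q_dom pole \<delta> - K. \<xi> t x = 0)) \<and>
     (\<forall>(t, x)\<in>Q_dom pole \<delta>. \<xi> t x \<ge> 0) \<and>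
     (\<forall>(t, x)\<in>Sigma_bd pole \<delta>. \<xi> t x = 0) \<and>
     (\<forall>(t, x)\<in>Sigma_bd pole \<delta>. normal_derivative pole \<delta> (\<xi> t) x \<le> 0)"


section \<open>Weak and classical solutions\<close>

text \<open>
  All four integrands below are integrable over \<open>Q\<close> when \<open>u \<in> L^p_loc\<close>, \<open>f \<in> L^1_loc\<close> and \<open>\<xi>\<close> is a
  test function, so the convention for non-integrable functions plays no role.
\<close>

definition weak_solution ::
    "'a::euclidean_space \<Rightarrow> real \<Rightarrow> real \<Rightarrow> real \<Rightarrow> real \<Rightarrow> ('a \<Rightarrow> real) \<Rightarrow> (real \<Rightarrow> 'a \<Rightarrow> real) \<Rightarrow> bool"
  where
  "weak_solution pole \<delta> lam \<alpha> p f u \<longleftrightarrow>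
     Lp_loc Q_measure p (Q_dom pole \<delta>) (\<lambda>(t, x). u t x) \<and>
     (\<forall>\<xi>. test_function pole \<delta> \<xi> \<longrightarrow>
        set_lebesgue_integral Q_measure (Q_dom pole \<delta>)
          (\<lambda>(t, x). sin (geo_dist pole x) powr \<alpha> * \<bar>u t x\<bar> powr p * \<xi> t x)
        + set_lebesgue_integral Q_measure (Q_dom pole \<delta>) (\<lambda>(t, x). f x * \<xi> t x)
        \<le> - set_lebesgue_integral Q_measure (Q_dom pole \<delta>)
              (\<lambda>(t, x). u t x * deriv (\<lambda>s. \<xi> s x) t)
           - set_lebesgue_integral Q_measure (Q_dom pole \<delta>)
              (\<lambda>(t, x). u t x * (laplace_beltrami (Omega_bar pole \<delta>) (\<xi> t) x
                                 + lam / (sin (geo_dist pole x))\<^sup>2 * \<xi> t x)))"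

definition classical_solution ::
    "'a::euclidean_space \<Rightarrow> real \<Rightarrow> real \<Rightarrow> real \<Rightarrow> real \<Rightarrow> ('a \<Rightarrow> real) \<Rightarrow> (real \<Rightarrow> 'a \<Rightarrow> real) \<Rightarrow> bool"
  where
  "classical_solution pole \<delta> lam \<alpha> p f u \<longleftrightarrow>
     smooth_on_subset ({0<..} \<times> Omega pole \<delta>) (\<lambda>(t, x). u t x) \<and>
     continuous_on (Q_dom pole \<delta>) (\<lambda>(t, x). u t x) \<and>
     (\<forall>t>0. \<forall>x\<in>Omega pole \<delta>.
        deriv (\<lambda>s. u s x) t - laplace_beltrami (Omega pole \<delta>) (u t) x
          - lam / (sin (geo_dist pole x))\<^sup>2 * u t x
        \<ge> sin (geo_dist pole x) powr \<alpha> * \<bar>u t x\<bar> powr p + f x) \<and>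
     (\<forall>(t, x)\<in>Sigma_bd pole \<delta>. u t x \<ge> 0)"

text \<open>
  Elements of \<open>L^1_loc\<close> are classes modulo null sets: \<open>f \<ge> 0\<close> and \<open>f \<noteq> 0\<close> are meant almost
  everywhere.
\<close>

definition admissible_source :: "'a::euclidean_space \<Rightarrow> real \<Rightarrow> ('a \<Rightarrow> real) \<Rightarrow> bool" where
  "admissible_source pole \<delta> f \<longleftrightarrow>
     Lp_loc sphere_measure 1 (Omega_bar pole \<delta>) f \<and>
     (AE x in sphere_measure. x \<in> Omega_bar pole \<delta> \<longrightarrow> f x \<ge> 0) \<and>
     \<not> (AE x in sphere_measure. x \<in> Omega_bar pole \<delta> \<longrightarrow> f x = 0)"

definition lambda_star :: "nat \<Rightarrow> real" where
  "lambda_star N = ((real N - 2) / 2)\<^sup>2"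

definition lambda_exp :: "nat \<Rightarrow> real \<Rightarrow> real" where
  "lambda_exp N lam = (real N - 2) / 2 - sqrt (((real N - 2) / 2)\<^sup>2 - lam)"

end

theory Submission
  imports Defs "HOL-Complex_Analysis.Complex_Analysis" "HOL-Real_Asymp.Real_Asymp"
begin

text \<open>
  In the coordinate \<open>\<tau> = artanh (- cos d)\<close> the stationary equation for zonal functions reads
  \<open>g'' - (N - 2) tanh \<tau> g' + \<lambda> g = 0\<close>, with solutions growing like \<open>e\<^bsup>s\<tau>\<^esup>\<close>
  and \<open>e\<^bsup>(N-2-s)\<tau>\<^esup>\<close> (times \<open>\<tau>\<close> if \<open>\<lambda> = \<lambda>\<^sup>*\<close>), where \<open>s = \<lambda>\<^sub>N\<close>.

  For nonexistence, let \<open>H\<close> be the dominant solution that vanishes on \<open>\<Gamma>\<^sub>\<delta>\<close>, and test with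
  \<open>E(t/T) H(\<tau>) \<eta>(\<tau>/R)\<close>.  As \<open>H\<close> is an exact solution, only derivatives of the cutoffs survive, and
  these are absorbed by Young's inequality.  Letting \<open>T \<rightarrow> \<infinity>\<close> and then \<open>R \<rightarrow> \<infinity>\<close> gives
  \<open>\<integral> f H = 0\<close>; the cutoff in \<open>\<tau>/R\<close> is logarithmic in the distance to the antipode, which is what
  makes the critical exponent accessible.

  For existence, \<open>e\<^bsup>s\<tau>\<^esup> \<surd>\<tau>\<close> is a stationary strict supersolution near the antipode, and the
  nonlinear term is of lower order below the critical exponent.
\<close>

section \<open>Zonal functions on the sphere\<close>

text \<open>\<open>u\<close> has no sign, so a one-sided inequality for the test function would be
  useless: \<open>H\<close> has to solve the stationary equation exactly, and what the cutoffs leave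
  over is paired with |u|.

  The exponents balance as follows. With q = p/(p-1), Young's inequality turns the weight into
  cosh^(\<alpha>/(p-1)) and the factor cosh^2 of the Laplacian into cosh^(2q). Against H of order
  e^((N-2-s)\<tau>) and a measure of order e^(-N\<tau>) per unit layer, the total exponent is
  (\<alpha>+2)/(p-1) - s, which for p > 1 is nonpositive exactly if p >= 1 + (\<alpha>+2)/s. At
  equality only powers of R remain: R^(-q) from the cutoff, R from the length of the slab, and one
  more R for the double root, where H carries a factor \<tau>. That last case needs q > 2, i.e. p <
  2, which is the condition \<alpha> < (N-6)/2.

  The time term is T^(-q) times a constant depending on R in an uncontrolled way, hence the order of
  the limits. The thresholds for \<delta> arise because the solutions of the radial equation and the
  supersolution are controlled only for large \<tau>.\<close>

lemma sphere_path_has_vector_derivative: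
  fixes x v :: "'a::euclidean_space"
  assumes "norm x = 1" and "x \<bullet> v = 0"
  shows "((\<lambda>s. sgn (x + s *\<^sub>R v)) has_vector_derivative v) (at 0)"
proof -
  have n: "norm (x + s *\<^sub>R v) = sqrt (1 + s\<^sup>2 * (v \<bullet> v))" for s
  proof -
    have "x \<bullet> x = 1" using assms(1) by (simp add: dot_square_norm)
    then have "(x + s *\<^sub>R v) \<bullet> (x + s *\<^sub>R v) = 1 + s\<^sup>2 * (v \<bullet> v)"
      using assms(2) by (simp add: inner_add_left inner_add_right inner_commute power2_eq_square)
    then show ?thesis by (simp add: norm_eq_sqrt_inner)
  qed
  have e: "(\<lambda>s. sgn (x + s *\<^sub>R v)) = (\<lambda>s. inverse (sqrt (1 + s\<^sup>2 * (v \<bullet> v))) *\<^sub>R (x + s *\<^sub>R v))"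
    by (simp add: sgn_div_norm n)
  have a: "((\<lambda>s. inverse (sqrt (1 + s\<^sup>2 * (v \<bullet> v)))) has_real_derivative 0) (at 0)"
    by (auto intro!: derivative_eq_intros)
  have b: "((\<lambda>s. x + s *\<^sub>R v) has_vector_derivative v) (at 0)"
    by (auto intro!: derivative_eq_intros)
  show ?thesis
    using has_vector_derivative_scaleR[OF a b] unfolding e by simp
qed

text \<open>Makes the choice in \<open>sph_derivative\<close> harmless, also at boundary points.
  Only velocities with \<open>v \<bullet> pole < 0\<close> are known to point into \<open>S\<close>.
  Paths on the sphere determine the differential on this open half of the tangent space, which spans
  it, and \<open>D x = 0\<close> settles the normal line.\<close>

lemma has_sph_derivative_unique:
  fixes x pole :: "'a::euclidean_space" and g :: "'a \<Rightarrow> 'b::real_normed_vector"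
  assumes x: "norm x = 1" and pole: "norm pole = 1" and z: "-1 < x \<bullet> pole" "x \<bullet> pole < 1"
    and S: "{y \<in> sphere 0 1. -1 < y \<bullet> pole \<and> y \<bullet> pole < x \<bullet> pole} \<subseteq> S"
    and D1: "has_sph_derivative g D S x" and D2: "has_sph_derivative g D' S x"
  shows "D = D'"
proof -
  have lin: "linear D" "linear D'"
    using D1 D2 unfolding has_sph_derivative_def by (auto intro: has_derivative_linear)
  have tangent: "D v = D' v" if v: "x \<bullet> v = 0" "v \<bullet> pole < 0" for v
  proof -
    let ?\<gamma> = "\<lambda>s. sgn (x + s *\<^sub>R v)"
    note \<gamma>' = sphere_path_has_vector_derivative[OF x v(1)]
    have \<gamma>0: "?\<gamma> 0 = x" using x by (simp add: sgn_div_norm)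
    have der: "((\<lambda>s. ?\<gamma> s \<bullet> pole) has_real_derivative v \<bullet> pole) (at 0)"
      using bounded_linear.has_vector_derivative[OF bounded_linear_inner_left \<gamma>']
      by (simp add: has_real_derivative_iff_has_vector_derivative)
    obtain d where d: "d > 0" "\<And>h. 0 < h \<Longrightarrow> h < d \<Longrightarrow> ?\<gamma> h \<bullet> pole < x \<bullet> pole"
      using has_real_derivative_neg_dec_right[of _ _ 0 UNIV, OF der v(2)] \<gamma>0 by auto
    have "isCont (\<lambda>s. ?\<gamma> s \<bullet> pole) 0" using der by (rule DERIV_isCont)
    then have "((\<lambda>s. ?\<gamma> s \<bullet> pole) \<longlongrightarrow> x \<bullet> pole) (at 0)"
      using \<gamma>0 by (simp add: isCont_def)
    then have "\<forall>\<^sub>F s in at 0. -1 < ?\<gamma> s \<bullet> pole"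
      by (rule order_tendstoD(1)[OF _ z(1)])
    then obtain d2 where d2: "d2 > 0" "\<And>s. s \<noteq> 0 \<Longrightarrow> dist s 0 < d2 \<Longrightarrow> -1 < ?\<gamma> s \<bullet> pole"
      unfolding eventually_at by auto
    define A where "A = {0<..<min d d2}"
    have "x + s *\<^sub>R v \<noteq> 0" for s
    proof
      assume "x + s *\<^sub>R v = 0"
      then have "x \<bullet> (x + s *\<^sub>R v) = 0" by simp
      then show False using v(1) x by (simp add: inner_add_right dot_square_norm)
    qed
    then have "?\<gamma> s \<in> sphere 0 1" for s by (simp add: norm_sgn)
    then have im: "?\<gamma> ` A \<subseteq> S"
      using d d2 S unfolding A_def by auto
    have bot: "at 0 within A \<noteq> bot"
      using d(1) d2(1) unfolding A_def by (simp add: at_within_eq_bot_iff)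
    have \<gamma>A: "(?\<gamma> has_derivative (\<lambda>s. s *\<^sub>R v)) (at 0 within A)"
      using \<gamma>' unfolding has_vector_derivative_def by (rule has_derivative_at_withinI)
    have comp: "((\<lambda>s. g (?\<gamma> s)) has_vector_derivative F v) (at 0 within A)"
      if F: "has_sph_derivative g F S x" for F
    proof -
      have "(g has_derivative F) (at (?\<gamma> 0) within ?\<gamma> ` A)"
        using F im unfolding has_sph_derivative_def \<gamma>0 by (blast intro: has_derivative_subset)
      from has_derivative_in_compose[OF \<gamma>A this]
      have "((\<lambda>s. g (?\<gamma> s)) has_derivative (\<lambda>s. F (s *\<^sub>R v))) (at 0 within A)" .
      moreover have "linear F" using F unfolding has_sph_derivative_def by (auto intro: has_derivative_linear)
      ultimately show ?thesis
        unfolding has_vector_derivative_def by (simp add: linear_cmul)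
    qed
    show ?thesis
      by (rule vector_derivative_unique_within[OF bot comp[OF D1] comp[OF D2]])
  qed
  \<comment> \<open>\<open>v0\<close> points straight away from the pole. A large multiple of it
    moves any tangent vector into the half space where \<open>tangent\<close> applies, and linearity
    removes it again.\<close>
  define v0 where "v0 = (x \<bullet> pole) *\<^sub>R x - pole"
  have xx: "x \<bullet> x = 1" and pp: "pole \<bullet> pole = 1"
    using x pole by (simp_all add: dot_square_norm)
  have v0: "x \<bullet> v0 = 0" "v0 \<bullet> pole < 0"
  proof -
    show "x \<bullet> v0 = 0" using xx by (simp add: v0_def inner_diff_right)
    have "v0 \<bullet> pole = (x \<bullet> pole)\<^sup>2 - 1"
      by (simp add: v0_def inner_diff_left pp power2_eq_square)
    also have "\<dots> < 0" using z by (simp add: abs_square_less_1)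
    finally show "v0 \<bullet> pole < 0" .
  qed
  show ?thesis
  proof
    fix h
    define h' where "h' = h - (x \<bullet> h) *\<^sub>R x"
    define c where "c = (\<bar>h' \<bullet> pole\<bar> + 1) / (- (v0 \<bullet> pole))"
    have c: "c * (v0 \<bullet> pole) = - (\<bar>h' \<bullet> pole\<bar> + 1)"
      using v0(2) by (simp add: c_def field_simps)
    have "D (h' + c *\<^sub>R v0) = D' (h' + c *\<^sub>R v0)"
    proof (rule tangent)
      show "x \<bullet> (h' + c *\<^sub>R v0) = 0"
        using v0 xx by (simp add: h'_def inner_add_right inner_diff_right)
      show "(h' + c *\<^sub>R v0) \<bullet> pole < 0"
        using c by (simp add: inner_add_left)
    qed
    moreover have "D v0 = D' v0" using v0 by (rule tangent)
    ultimately have "D h' = D' h'"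
      using lin by (simp add: linear_add linear_cmul)
    moreover have "D x = 0" "D' x = 0" using D1 D2 unfolding has_sph_derivative_def by auto
    ultimately show "D h = D' h"
      unfolding h'_def using lin by (simp add: linear_diff linear_cmul)
  qed
qed

text \<open>Within a subset of the sphere an ambient derivative may be altered along the normal
  line; this yields the representative that \<open>has_sph_derivative\<close> asks for.\<close>

lemma has_derivative_tangential:
  fixes x :: "'a::euclidean_space" and g :: "'a \<Rightarrow> 'b::real_normed_vector"
  assumes D: "(g has_derivative D) (at x within S)" and S: "S \<subseteq> sphere 0 1" and x: "x \<in> S"
  shows "has_sph_derivative g (\<lambda>h. D (h - (x \<bullet> h) *\<^sub>R x)) S x"
proof -
  have xx: "x \<bullet> x = 1" using x S by (auto simp: dot_square_norm)
  \<comment> \<open>On the sphere \<open>x \<bullet> y = 1 - |y - x|\<^sup>2 / 2\<close>, so the radial direction is invisible to first order.\<close>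
  have "((\<lambda>y. x \<bullet> y + ((y - x) \<bullet> (y - x)) / 2) has_derivative (\<lambda>h. x \<bullet> h)) (at x within S)"
    by (auto intro!: derivative_eq_intros simp: inner_commute)
  then have c: "((\<lambda>y. 1) has_derivative (\<lambda>h. x \<bullet> h)) (at x within S)"
  proof (rule has_derivative_transform[OF x, rotated])
    fix y assume "y \<in> S"
    then have "y \<bullet> y = 1" using S by (auto simp: dot_square_norm)
    then show "1 = x \<bullet> y + ((y - x) \<bullet> (y - x)) / 2"
      by (simp add: inner_diff_left inner_diff_right xx inner_commute diff_divide_distrib)
  qed
  have lin: "linear D" using D by (rule has_derivative_linear)
  have "((\<lambda>y. g y - (1::real) *\<^sub>R D x) has_derivative (\<lambda>h. D h - (x \<bullet> h) *\<^sub>R D x)) (at x within S)"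
    by (rule has_derivative_diff[OF D bounded_linear.has_derivative[OF bounded_linear_scaleR_left c]])
  from has_derivative_add[OF this has_derivative_const[of "D x"]]
  have "(g has_derivative (\<lambda>h. D h - (x \<bullet> h) *\<^sub>R D x)) (at x within S)" by simp
  then show ?thesis
    using lin xx unfolding has_sph_derivative_def by (simp add: linear_diff linear_cmul linear_0)
qed

text \<open>
  The coordinate \<open>\<tau> = artanh (- cos d)\<close> sends the antipode of the pole to \<open>\<infinity>\<close>.  In it
  \<open>sin d = 1 / cosh \<tau>\<close>, and \<open>\<Delta> g(\<tau>) = cosh\<^sup>2 \<tau> (g'' - (N - 2) tanh \<tau> g')\<close>.
\<close>

definition lat :: "'a::euclidean_space \<Rightarrow> 'a \<Rightarrow> real" where
  "lat pole x = artanh (- (x \<bullet> pole))"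

lemma tanh_artanh:
  fixes y :: real
  assumes "-1 < y" "y < 1"
  shows "tanh (artanh y) = y"
proof -
  have "exp (- 2 * artanh y) = inverse ((1 + y) / (1 - y))"
    using assms by (simp add: artanh_def exp_minus)
  then have e: "exp (- 2 * artanh y) = (1 - y) / (1 + y)" by simp
  show ?thesis
    unfolding tanh_real_altdef e using assms by (simp add: field_simps)
qed

lemma tanh_lat: "-1 < x \<bullet> pole \<Longrightarrow> x \<bullet> pole < 1 \<Longrightarrow> tanh (lat pole x) = - (x \<bullet> pole)"
  by (simp add: lat_def tanh_artanh)

lemma tanh_square_cosh: "(tanh (t::real))\<^sup>2 = 1 - 1 / (cosh t)\<^sup>2"
proof -
  have "(sinh t)\<^sup>2 = (cosh t)\<^sup>2 - 1" using cosh_square_eq[of t] by simp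
  then show ?thesis by (simp add: tanh_def power_divide diff_divide_distrib)
qed

lemma cosh_lat:
  assumes "-1 < x \<bullet> pole" "x \<bullet> pole < 1"
  shows "1 - (x \<bullet> pole)\<^sup>2 = 1 / (cosh (lat pole x))\<^sup>2"
  using tanh_square_cosh[of "lat pole x"] tanh_lat[OF assms] by simp

lemma sin_geo_dist:
  assumes "-1 < x \<bullet> pole" "x \<bullet> pole < 1"
  shows "sin (geo_dist pole x) = 1 / cosh (lat pole x)"
proof -
  have "sin (geo_dist pole x) = sqrt (1 - (x \<bullet> pole)\<^sup>2)"
    using assms by (simp add: geo_dist_def sin_arccos inner_commute)
  also have "\<dots> = 1 / cosh (lat pole x)"
    unfolding cosh_lat[OF assms] by (simp add: real_sqrt_divide)
  finally show ?thesis .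
qed

text \<open>Common frame for \<open>Omega\<close> and \<open>Omega_bar\<close>: with each point,
  \<open>S\<close> contains everything between its parallel and the antipode. This is still true at
  a boundary parallel, so one calculus serves both the interior equation and the one-sided
  derivatives of test functions.\<close>

locale cap_domain =
  fixes pole :: "'a::euclidean_space" and S :: "'a set"
  assumes pole: "norm pole = 1"
    and S_sphere: "S \<subseteq> sphere 0 1"
    and S_inner: "x \<in> S \<Longrightarrow> -1 < x \<bullet> pole" "x \<in> S \<Longrightarrow> x \<bullet> pole < 1"
    and S_below: "x \<in> S \<Longrightarrow> {y \<in> sphere 0 1. -1 < y \<bullet> pole \<and> y \<bullet> pole < x \<bullet> pole} \<subseteq> S"
begin

lemma sph_derivative_eq:
  assumes "x \<in> S" "has_sph_derivative g D S x"
  shows "sph_derivative g S x = D"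
proof -
  have "has_sph_derivative g (sph_derivative g S x) S x"
    unfolding sph_derivative_def by (rule someI[of _ D]) (rule assms(2))
  then show ?thesis
    using has_sph_derivative_unique[of x pole S g] assms S_inner S_below S_sphere pole by auto
qed

text \<open>\<open>pole - (x \<bullet> pole) *\<^sub>R x\<close> is the tangential part of the pole,
  i.e. the gradient of the height \<open>y \<bullet> pole\<close>.\<close>

lemma has_sph_derivative_zonal:
  assumes x: "x \<in> S" and G: "(G has_real_derivative G') (at (x \<bullet> pole))"
  shows "has_sph_derivative (\<lambda>y. G (y \<bullet> pole)) (\<lambda>h. G' * (h \<bullet> (pole - (x \<bullet> pole) *\<^sub>R x))) S x"
proof -
  have "((\<lambda>y. y \<bullet> pole) has_derivative (\<lambda>h. h \<bullet> pole)) (at x within S)"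
    by (auto intro!: derivative_eq_intros)
  from DERIV_compose_FDERIV[OF G this]
  have "((\<lambda>y. G (y \<bullet> pole)) has_derivative (\<lambda>h. (h \<bullet> pole) * G')) (at x within S)" .
  from has_derivative_tangential[OF this S_sphere x] show ?thesis
    by (simp add: inner_diff_left inner_diff_right inner_commute algebra_simps)
qed

lemma sph_grad_zonal:
  assumes x: "x \<in> S" and G: "(G has_real_derivative G') (at (x \<bullet> pole))"
  shows "sph_grad S (\<lambda>y. G (y \<bullet> pole)) x = G' *\<^sub>R (pole - (x \<bullet> pole) *\<^sub>R x)"
  using euclidean_representation[of "G' *\<^sub>R (pole - (x \<bullet> pole) *\<^sub>R x)"]
  unfolding sph_grad_def sph_derivative_eq[OF x has_sph_derivative_zonal[OF assms]]
  by (simp add: inner_commute)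

lemma has_sph_derivative_zonal_field:
  assumes x: "x \<in> S" and A: "(A has_real_derivative A') (at (x \<bullet> pole))"
  defines "w \<equiv> pole - (x \<bullet> pole) *\<^sub>R x"
  shows "has_sph_derivative (\<lambda>y. A (y \<bullet> pole) *\<^sub>R (pole - (y \<bullet> pole) *\<^sub>R y))
           (\<lambda>h. (A' * (h \<bullet> w)) *\<^sub>R w
              - A (x \<bullet> pole) *\<^sub>R ((h \<bullet> w) *\<^sub>R x + (x \<bullet> pole) *\<^sub>R (h - (x \<bullet> h) *\<^sub>R x))) S x"
proof -
  have "((\<lambda>y. y \<bullet> pole) has_derivative (\<lambda>h. h \<bullet> pole)) (at x within S)"
    by (auto intro!: derivative_eq_intros)
  note 1 = DERIV_compose_FDERIV[OF A this]
  have 2: "((\<lambda>y. pole - (y \<bullet> pole) *\<^sub>R y) has_derivative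
     (\<lambda>h. - ((x \<bullet> pole) *\<^sub>R h + (h \<bullet> pole) *\<^sub>R x))) (at x within S)"
    by (auto intro!: derivative_eq_intros simp: fun_eq_iff)
  have "((\<lambda>y. A (y \<bullet> pole) *\<^sub>R (pole - (y \<bullet> pole) *\<^sub>R y)) has_derivative
     (\<lambda>h. A (x \<bullet> pole) *\<^sub>R (- ((x \<bullet> pole) *\<^sub>R h + (h \<bullet> pole) *\<^sub>R x)) + ((h \<bullet> pole) * A') *\<^sub>R w)) (at x within S)"
    unfolding w_def by (rule has_derivative_scaleR[OF 1 2])
  from has_derivative_tangential[OF this S_sphere x]
  show ?thesis
    by (simp add: w_def inner_diff_left inner_diff_right inner_commute algebra_simps)
qed

text \<open>For \<open>A\<close> the derivative of G this is the classical Laplacian of a function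
  of the height z, (1 - z^2) G'' - N z G'. The ingredients are |w|^2 = 1 - z^2, the orthogonality of
  \<open>w\<close> and \<open>x\<close>, and the trace \<open>DIM('a) - 1\<close> = N of the
  projection onto the tangent space.\<close>

lemma tangential_trace:
  fixes A A' :: real
  assumes x: "x \<in> S"
  defines "w \<equiv> pole - (x \<bullet> pole) *\<^sub>R x"
  shows "(\<Sum>b\<in>Basis. ((A' * (b \<bullet> w)) *\<^sub>R w
              - A *\<^sub>R ((b \<bullet> w) *\<^sub>R x + (x \<bullet> pole) *\<^sub>R (b - (x \<bullet> b) *\<^sub>R x))) \<bullet> b)
      = A' * (1 - (x \<bullet> pole)\<^sup>2) - A * (real DIM('a) - 1) * (x \<bullet> pole)"
proof -
  have xx: "x \<bullet> x = 1" and pp: "pole \<bullet> pole = 1"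
    using x S_sphere pole by (auto simp: dot_square_norm)
  have wx: "w \<bullet> x = 0" by (simp add: w_def inner_diff_left inner_diff_right xx inner_commute)
  have ww: "w \<bullet> w = 1 - (x \<bullet> pole)\<^sup>2"
    by (simp add: w_def inner_diff_left inner_diff_right xx pp inner_commute power2_eq_square)
  have "(\<Sum>b\<in>Basis. ((A' * (b \<bullet> w)) *\<^sub>R w
              - A *\<^sub>R ((b \<bullet> w) *\<^sub>R x + (x \<bullet> pole) *\<^sub>R (b - (x \<bullet> b) *\<^sub>R x))) \<bullet> b)
      = (\<Sum>b\<in>Basis. A' * ((w \<bullet> b) * (w \<bullet> b)) - A * ((w \<bullet> b) * (x \<bullet> b))
            - A * (x \<bullet> pole) * (1 - (x \<bullet> b) * (x \<bullet> b)))"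
    by (rule sum.cong)
      (simp_all add: inner_diff_left inner_add_left inner_commute algebra_simps)
  also have "\<dots> = A' * (w \<bullet> w) - A * (w \<bullet> x) - A * (x \<bullet> pole) * (real DIM('a) - x \<bullet> x)"
    by (simp add: sum_subtractf sum_distrib_left[symmetric] euclidean_inner[symmetric])
  finally show ?thesis
    by (simp add: wx ww xx algebra_simps)
qed

section \<open>Gradient and Laplacian in the coordinate \<tau>\<close>

lemma deriv_comp_lat:
  assumes z: "-1 < z" "z < 1" and g: "(g has_real_derivative g') (at (artanh (- z)))"
  shows "((\<lambda>z. g (artanh (- z))) has_real_derivative - (g' / (1 - z\<^sup>2))) (at z)"
proof -
  have "((\<lambda>z. artanh (- z)) has_real_derivative - (1 / (1 - z\<^sup>2))) (at z)"
    using DERIV_chain2[OF artanh_real_has_field_derivative[of "- z"] DERIV_minus[OF DERIV_ident]] z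
    by simp
  from DERIV_chain2[OF g this] show ?thesis by simp
qed

lemma
  assumes x: "x \<in> S" and g: "(g has_real_derivative g') (at (lat pole x))"
  shows sph_differentiable_lat: "sph_differentiable (\<lambda>y. g (lat pole y)) S x"
    and sph_grad_lat: "sph_grad S (\<lambda>y. g (lat pole y)) x =
      - (g' * (cosh (lat pole x))\<^sup>2) *\<^sub>R (pole - (x \<bullet> pole) *\<^sub>R x)"
proof -
  note z = S_inner[OF x]
  have "((\<lambda>z. g (artanh (- z))) has_real_derivative - (g' * (cosh (lat pole x))\<^sup>2)) (at (x \<bullet> pole))"
    using deriv_comp_lat[OF z, of g g'] g cosh_lat[OF z] by (simp add: lat_def)
  note 1 = this
  show "sph_differentiable (\<lambda>y. g (lat pole y)) S x"
    using has_sph_derivative_zonal[OF x 1] unfolding sph_differentiable_def lat_def by blast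
  show "sph_grad S (\<lambda>y. g (lat pole y)) x =
      - (g' * (cosh (lat pole x))\<^sup>2) *\<^sub>R (pole - (x \<bullet> pole) *\<^sub>R x)"
    using sph_grad_zonal[OF x 1] unfolding lat_def .
qed

text \<open>Substitutes z = - tanh \<tau>, so d/dz = - cosh^2 \<tau> d/d\<tau>, into (1 - z^2) G'' -
  N z G'. Differentiating the factor cosh^2 produces 2 tanh \<tau>, which lowers the coefficient N
  to N - 2 = \<open>DIM('a) - 3\<close>. The differential of the gradient is recorded too, since
  \<open>C12_on\<close> demands its continuity.\<close>

lemma
  assumes g: "\<And>x. x \<in> S \<Longrightarrow> (g has_real_derivative g' (lat pole x)) (at (lat pole x))"
    and g': "\<And>x. x \<in> S \<Longrightarrow> (g' has_real_derivative g'' (lat pole x)) (at (lat pole x))"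
    and x: "x \<in> S"
  defines "F \<equiv> sph_grad S (\<lambda>y. g (lat pole y))" and "\<tau> \<equiv> lat pole x"
    and "w \<equiv> pole - (x \<bullet> pole) *\<^sub>R x"
  shows sph_differentiable_grad_lat: "sph_differentiable F S x"
    and sph_derivative_grad_lat: "sph_derivative F S x =
          (\<lambda>h. ((cosh \<tau>)^4 * (g'' \<tau> + 2 * tanh \<tau> * g' \<tau>) * (h \<bullet> w)) *\<^sub>R w
              - (- (g' \<tau> * (cosh \<tau>)\<^sup>2)) *\<^sub>R ((h \<bullet> w) *\<^sub>R x + (x \<bullet> pole) *\<^sub>R (h - (x \<bullet> h) *\<^sub>R x)))"
    and laplace_beltrami_lat: "laplace_beltrami S (\<lambda>y. g (lat pole y)) x =
          (cosh \<tau>)\<^sup>2 * (g'' \<tau> - (real DIM('a) - 3) * tanh \<tau> * g' \<tau>)"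
proof -
  note z = S_inner[OF x]
  define A where "A = (\<lambda>z. - (g' (artanh (- z)) / (1 - z\<^sup>2)))"
  have Ax: "A (y \<bullet> pole) = - (g' (lat pole y) * (cosh (lat pole y))\<^sup>2)" if "y \<in> S" for y
    using cosh_lat[OF S_inner[OF that]] by (simp add: A_def lat_def)
  have F: "F y = A (y \<bullet> pole) *\<^sub>R (pole - (y \<bullet> pole) *\<^sub>R y)" if "y \<in> S" for y
    unfolding F_def using sph_grad_lat[OF that g[OF that]] Ax[OF that] by simp
  have nz: "1 - (x \<bullet> pole)\<^sup>2 \<noteq> 0" using cosh_lat[OF z] by simp
  have "((\<lambda>z. g' (artanh (- z))) has_real_derivative - (g'' \<tau> / (1 - (x \<bullet> pole)\<^sup>2))) (at (x \<bullet> pole))"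
    using deriv_comp_lat[OF z, of g' "g'' \<tau>"] g'[OF x] by (simp add: lat_def \<tau>_def)
  then have "(A has_real_derivative
     - ((- (g'' \<tau> / (1 - (x \<bullet> pole)\<^sup>2)) * (1 - (x \<bullet> pole)\<^sup>2) + g' \<tau> * (2 * (x \<bullet> pole)))
        / (1 - (x \<bullet> pole)\<^sup>2)\<^sup>2)) (at (x \<bullet> pole))"
    unfolding A_def using nz
    by (auto intro!: derivative_eq_intros simp: power2_eq_square lat_def \<tau>_def)
  also have "- ((- (g'' \<tau> / (1 - (x \<bullet> pole)\<^sup>2)) * (1 - (x \<bullet> pole)\<^sup>2) + g' \<tau> * (2 * (x \<bullet> pole)))
        / (1 - (x \<bullet> pole)\<^sup>2)\<^sup>2) = (cosh \<tau>)^4 * (g'' \<tau> + 2 * tanh \<tau> * g' \<tau>)"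
    using nz unfolding cosh_lat[OF z] tanh_lat[OF z] \<tau>_def
    by (simp add: field_simps flip: power_add)
  finally have dA: "(A has_real_derivative (cosh \<tau>)^4 * (g'' \<tau> + 2 * tanh \<tau> * g' \<tau>)) (at (x \<bullet> pole))" .
  let ?D = "\<lambda>h. ((cosh \<tau>)^4 * (g'' \<tau> + 2 * tanh \<tau> * g' \<tau>) * (h \<bullet> w)) *\<^sub>R w
              - (- (g' \<tau> * (cosh \<tau>)\<^sup>2)) *\<^sub>R ((h \<bullet> w) *\<^sub>R x + (x \<bullet> pole) *\<^sub>R (h - (x \<bullet> h) *\<^sub>R x))"
  have D: "has_sph_derivative F ?D S x"
    using has_sph_derivative_zonal_field[OF x dA] has_derivative_transform[OF x, of F, OF F]
    unfolding has_sph_derivative_def w_def Ax[OF x] \<tau>_def by blast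
  then show "sph_differentiable F S x" unfolding sph_differentiable_def by blast
  show *: "sph_derivative F S x = ?D" by (rule sph_derivative_eq[OF x D])
  have "laplace_beltrami S (\<lambda>y. g (lat pole y)) x = (\<Sum>b\<in>Basis. ?D b \<bullet> b)"
    unfolding laplace_beltrami_def sph_div_def using * unfolding F_def by (simp only:)
  also have "\<dots> = (cosh \<tau>)^4 * (g'' \<tau> + 2 * tanh \<tau> * g' \<tau>) * (1 - (x \<bullet> pole)\<^sup>2)
      - (- (g' \<tau> * (cosh \<tau>)\<^sup>2)) * (real DIM('a) - 1) * (x \<bullet> pole)"
    unfolding w_def by (rule tangential_trace[OF x])
  also have "\<dots> = (cosh \<tau>)\<^sup>2 * (g'' \<tau> - (real DIM('a) - 3) * tanh \<tau> * g' \<tau>)"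
    unfolding cosh_lat[OF z] tanh_lat[OF z] \<tau>_def
    by (simp add: power4_eq_xxxx power2_eq_square algebra_simps)
  finally show "laplace_beltrami S (\<lambda>y. g (lat pole y)) x =
          (cosh \<tau>)\<^sup>2 * (g'' \<tau> - (real DIM('a) - 3) * tanh \<tau> * g' \<tau>)" .
qed

end

lemma (in cap_domain) continuous_on_lat: "continuous_on S (lat pole)"
  unfolding lat_def using S_inner
  by (intro continuous_on_compose2[OF continuous_on_artanh[OF order.refl]] continuous_intros) auto

lemma inverse_cosh_powr: "(1 / cosh t) powr a = cosh t powr (- a)" for t a :: real
  using cosh_real_pos[of t] by (simp add: powr_def ln_div)

lemma cap_domain_caps:
  assumes "norm pole = 1" "0 < \<delta>" "\<delta> < pi"
  shows cap_domain_Omega: "cap_domain pole (Omega pole \<delta>)"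
    and cap_domain_Omega_bar: "cap_domain pole (Omega_bar pole \<delta>)"
proof -
  have le1: "\<bar>x \<bullet> pole\<bar> \<le> 1" if "norm x = 1" for x
    using Cauchy_Schwarz_ineq2[of x pole] that assms(1) by simp
  have pi: "geo_dist pole x < pi \<longleftrightarrow> -1 < x \<bullet> pole" if "norm x = 1" for x
    using le1[OF that] arccos_less_mono[of "x \<bullet> pole" "-1"] by (simp add: geo_dist_def inner_commute)
  have pos: "x \<bullet> pole < 1" if "norm x = 1" "0 < geo_dist pole x" for x
    using le1[OF that(1)] that(2) by (cases "x \<bullet> pole = 1") (auto simp: geo_dist_def inner_commute)
  have mono: "geo_dist pole x < geo_dist pole y" if "norm x = 1" "norm y = 1" "y \<bullet> pole < x \<bullet> pole" for x y
    using le1[OF that(1)] le1[OF that(2)] that(3) arccos_less_mono[of "x \<bullet> pole" "y \<bullet> pole"]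
    by (simp add: geo_dist_def inner_commute)
  show "cap_domain pole (Omega pole \<delta>)"
    using assms pi pos mono unfolding Omega_def by unfold_locales force+
  show "cap_domain pole (Omega_bar pole \<delta>)"
    using assms pi pos mono unfolding Omega_bar_def by unfold_locales force+
qed


section \<open>The radial equation\<close>

text \<open>Frobenius' method at the antipode. With q = e^(-2t), \<phi> = e^(st) P(q) and tanh t =
  (1 - q)/(1 + q), the radial equation times 1 + q becomes the stated identity. The exponents s - 2k
  move away from the second root m - s >= s, so there is no resonance, even for a double
  root.\<close>

lemma power_series_solution:
  fixes s m lam :: real
  assumes root: "s\<^sup>2 - m * s + lam = 0" and s: "0 \<le> s" "2 * s \<le> m" and lam: "0 \<le> lam"
  obtains P P1 P2 :: "real \<Rightarrow> real" and r :: real where "r > 0"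
    and "\<And>q. \<bar>q\<bar> < r \<Longrightarrow> (P has_real_derivative P1 q) (at q)"
    and "\<And>q. \<bar>q\<bar> < r \<Longrightarrow> (P1 has_real_derivative P2 q) (at q)"
    and "\<And>q. \<bar>q\<bar> < r \<Longrightarrow> (1 + q) * ((s\<^sup>2 + lam) * P q + (4 - 4 * s) * q * P1 q + 4 * q\<^sup>2 * P2 q)
            = m * (1 - q) * (s * P q - 2 * q * P1 q)"
    and "P 0 = 1"
proof -
  \<comment> \<open>\<open>c k\<close> is the exponent of the k-th term e^((s-2k)t).
    \<open>A k\<close> is the indicial polynomial at this exponent and \<open>B k\<close> the same
    with m replaced by - m; comparing coefficients gives A(k+1) a(k+1) = - B(k) a(k).\<close>
  define c :: "nat \<Rightarrow> real" where "c k = s - 2 * real k" for k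
  define A :: "nat \<Rightarrow> real" where "A k = (c k)\<^sup>2 + lam - m * c k" for k
  define B :: "nat \<Rightarrow> real" where "B k = (c k)\<^sup>2 + lam + m * c k" for k
  define a :: "nat \<Rightarrow> real" where "a = rec_nat 1 (\<lambda>k ak. - ak * B k / A (Suc k))"
  have a0: "a 0 = 1" and aSuc: "a (Suc k) = - a k * B k / A (Suc k)" for k
    by (simp_all add: a_def)
  have Aeq: "A k = 2 * real k * (2 * real k + m - 2 * s)" for k
  proof -
    have "A k = 2 * real k * (2 * real k + m - 2 * s) + (s\<^sup>2 - m * s + lam)"
      by (simp add: A_def c_def power2_eq_square algebra_simps)
    then show ?thesis using root by simp
  qed
  have Alow: "A (Suc k) \<ge> 4 * (real k + 1)\<^sup>2" for k
  proof -
    have "2 * (real k + 1) * (2 * (real k + 1)) \<le> 2 * (real k + 1) * (2 * (real k + 1) + m - 2 * s)"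
      by (rule mult_left_mono) (use s in auto)
    then show ?thesis unfolding Aeq by (simp add: power2_eq_square algebra_simps)
  qed
  have Apos: "A (Suc k) > 0" for k
    by (rule less_le_trans[OF _ Alow]) simp
  \<comment> \<open>\<open>A (Suc k)\<close> and the bound for \<open>B k\<close> both grow like
    (k+1)^2, and \<open>M\<close> bounds the quotient. Hence \<open>a k\<close> grows at most
    geometrically and the series converge for |q| < 1/M.\<close>
  define M where "M = ((s + 2)\<^sup>2 + lam + m * (s + 2)) / 4"
  have M: "M > 0" using s lam by (simp add: M_def add_pos_nonneg)
  have Bup: "\<bar>B k\<bar> \<le> 4 * M * (real k + 1)\<^sup>2" for k
  proof -
    have c: "\<bar>c k\<bar> \<le> (s + 2) * (real k + 1)"
    proof -
      have "\<bar>c k\<bar> \<le> s + 2 * real k" using s by (simp add: c_def abs_le_iff)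
      also have "\<dots> \<le> (s + 2) * (real k + 1)" using s by (simp add: algebra_simps)
      finally show ?thesis .
    qed
    have k1: "real k + 1 \<le> (real k + 1)\<^sup>2" by (simp add: power2_eq_square algebra_simps)
    have "\<bar>B k\<bar> \<le> \<bar>c k\<bar>\<^sup>2 + lam + m * \<bar>c k\<bar>"
    proof -
      have "\<bar>m * c k\<bar> = m * \<bar>c k\<bar>" using s by (simp add: abs_mult)
      moreover have "\<bar>(c k)\<^sup>2 + lam + m * c k\<bar> \<le> (c k)\<^sup>2 + lam + \<bar>m * c k\<bar>"
        using lam by (intro abs_triangle_ineq[THEN order_trans]) simp
      ultimately show ?thesis by (simp add: B_def)
    qed
    also have "\<dots> \<le> ((s + 2) * (real k + 1))\<^sup>2 + lam * (real k + 1)\<^sup>2 + m * ((s + 2) * (real k + 1)\<^sup>2)"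
    proof (intro add_mono)
      show "\<bar>c k\<bar>\<^sup>2 \<le> ((s + 2) * (real k + 1))\<^sup>2" by (rule power_mono[OF c]) simp
      show "lam \<le> lam * (real k + 1)\<^sup>2"
        using lam by (simp add: mult_le_cancel_left1)
      have "\<bar>c k\<bar> \<le> (s + 2) * (real k + 1)\<^sup>2"
        using c k1 s mult_left_mono[OF k1, of "s + 2"] by linarith
      then show "m * \<bar>c k\<bar> \<le> m * ((s + 2) * (real k + 1)\<^sup>2)"
        by (rule mult_left_mono) (use s in linarith)
    qed
    also have "\<dots> = 4 * M * (real k + 1)\<^sup>2"
    proof -
      have "4 * M = (s + 2)\<^sup>2 + lam + m * (s + 2)" by (simp add: M_def)
      then show ?thesis
        by (simp only: power_mult_distrib) (simp only: ring_distribs mult.assoc)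
    qed
    finally show ?thesis .
  qed
  have abound: "\<bar>a k\<bar> \<le> M ^ k" for k
  proof (induction k)
    case (Suc k)
    have "\<bar>B k\<bar> / A (Suc k) \<le> (4 * M * (real k + 1)\<^sup>2) / (4 * (real k + 1)\<^sup>2)"
      using Bup[of k] Alow[of k] by (intro frac_le) auto
    also have "\<dots> = M" by (simp add: add_pos_nonneg)
    finally have "\<bar>a k\<bar> * (\<bar>B k\<bar> / A (Suc k)) \<le> M ^ k * M"
      using Suc M Apos[of k] by (intro mult_mono) auto
    then show ?case using Apos[of k] by (simp add: aSuc abs_mult mult.commute)
  qed (simp add: a0)
  define r where "r = 1 / M"
  have r: "r > 0" using M by (simp add: r_def)
  have sm: "summable (\<lambda>n. a n * q ^ n)" if "norm q < r" for q
  proof (rule summable_comparison_test')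
    show "summable (\<lambda>n. (M * \<bar>q\<bar>) ^ n)"
      using that M by (intro summable_geometric) (simp add: r_def field_simps)
    show "norm (a n * q ^ n) \<le> (M * \<bar>q\<bar>) ^ n" for n
      using abound[of n] by (simp add: abs_mult power_abs power_mult_distrib mult_right_mono)
  qed
  have sm1: "summable (\<lambda>n. diffs a n * q ^ n)" if "norm q < r" for q
    using termdiff_converges[OF that sm] .
  have sm2: "summable (\<lambda>n. diffs (diffs a) n * q ^ n)" if "norm q < r" for q
    using termdiff_converges[OF that sm1] .
  define P where "P q = (\<Sum>n. a n * q ^ n)" for q
  define P1 where "P1 q = (\<Sum>n. diffs a n * q ^ n)" for q
  define P2 where "P2 q = (\<Sum>n. diffs (diffs a) n * q ^ n)" for q
  show ?thesis
  proof (rule that[OF r])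
    fix q :: real assume q: "\<bar>q\<bar> < r"
    then have q': "norm q < r" by simp
    show "(P has_real_derivative P1 q) (at q)"
      unfolding P_def P1_def by (rule termdiffs_strong'[OF sm q'])
    show "(P1 has_real_derivative P2 q) (at q)"
      unfolding P1_def P2_def by (rule termdiffs_strong'[OF sm1 q'])
    have S0: "(\<lambda>n. a n * q ^ n) sums P q" unfolding P_def using sm[OF q'] by (rule summable_sums)
    have "(\<lambda>n. q * (diffs a n * q ^ n)) sums (q * P1 q)"
      unfolding P1_def using sm1[OF q'] by (intro sums_mult summable_sums)
    then have "(\<lambda>n. real (Suc n) * a (Suc n) * q ^ Suc n) sums (q * P1 q)"
      by (simp add: diffs_def algebra_simps)
    then have S1: "(\<lambda>n. real n * a n * q ^ n) sums (q * P1 q)"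
      using sums_Suc[of "\<lambda>n. real n * a n * q ^ n"] by simp
    have "(\<lambda>n. q\<^sup>2 * (diffs (diffs a) n * q ^ n)) sums (q\<^sup>2 * P2 q)"
      unfolding P2_def using sm2[OF q'] by (intro sums_mult summable_sums)
    then have "(\<lambda>n. real (Suc (Suc n)) * (real (Suc (Suc n)) - 1) * a (Suc (Suc n)) * q ^ Suc (Suc n)) sums (q\<^sup>2 * P2 q)"
      by (simp add: diffs_def algebra_simps power2_eq_square)
    then have "(\<lambda>n. real (Suc n) * (real (Suc n) - 1) * a (Suc n) * q ^ Suc n) sums (q\<^sup>2 * P2 q)"
      using sums_Suc[of "\<lambda>n. real (Suc n) * (real (Suc n) - 1) * a (Suc n) * q ^ Suc n"] by simp
    then have S2: "(\<lambda>n. real n * (real n - 1) * a n * q ^ n) sums (q\<^sup>2 * P2 q)"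
      using sums_Suc[of "\<lambda>n. real n * (real n - 1) * a n * q ^ n"] by simp
    \<comment> \<open>Up to the factor e^(st), \<open>X\<close> is \<phi>'' + \<lambda> \<phi> and
      \<open>Y\<close> is m \<phi>'. Their difference and sum have the coefficients A(n) a(n) and
      B(n) a(n), so the recurrence says X - Y = - q (X + Y).\<close>
    define X where "X = (s\<^sup>2 + lam) * P q + (4 - 4 * s) * (q * P1 q) + 4 * (q\<^sup>2 * P2 q)"
    define Y where "Y = m * (s * P q - 2 * (q * P1 q))"
    have "(\<lambda>n. (s\<^sup>2 + lam) * (a n * q ^ n) + (4 - 4 * s) * (real n * a n * q ^ n)
         + 4 * (real n * (real n - 1) * a n * q ^ n)) sums X"
      unfolding X_def by (intro sums_add sums_mult S0 S1 S2)
    moreover have "(s\<^sup>2 + lam) * (a n * q ^ n) + (4 - 4 * s) * (real n * a n * q ^ n)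
         + 4 * (real n * (real n - 1) * a n * q ^ n) = ((c n)\<^sup>2 + lam) * (a n * q ^ n)" for n
      by (simp add: c_def power2_eq_square algebra_simps)
    ultimately have SX: "(\<lambda>n. ((c n)\<^sup>2 + lam) * (a n * q ^ n)) sums X" by simp
    have "(\<lambda>n. m * (s * (a n * q ^ n) - 2 * (real n * a n * q ^ n))) sums Y"
      unfolding Y_def by (intro sums_diff sums_mult S0 S1)
    moreover have "m * (s * (a n * q ^ n) - 2 * (real n * a n * q ^ n)) = m * c n * (a n * q ^ n)" for n
      by (simp add: c_def algebra_simps)
    ultimately have SY: "(\<lambda>n. m * c n * (a n * q ^ n)) sums Y" by simp
    have SA: "(\<lambda>n. A n * (a n * q ^ n)) sums (X - Y)"
      using sums_diff[OF SX SY] by (simp add: A_def algebra_simps)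
    have SB: "(\<lambda>n. q * (B n * (a n * q ^ n))) sums (q * (X + Y))"
      using sums_mult[OF sums_add[OF SX SY], of q] by (simp add: B_def algebra_simps)
    have "A 0 = 0" by (simp add: Aeq)
    have "A (Suc n) * (a (Suc n) * q ^ Suc n) = - (q * (B n * (a n * q ^ n)))" for n
      using Apos[of n] by (simp add: aSuc)
    then have "(\<lambda>n. A (Suc n) * (a (Suc n) * q ^ Suc n)) sums (- (q * (X + Y)))"
      using sums_minus[OF SB] by simp
    then have "(\<lambda>n. A n * (a n * q ^ n)) sums (- (q * (X + Y)))"
      using sums_Suc[of "\<lambda>n. A n * (a n * q ^ n)"] \<open>A 0 = 0\<close> by simp
    then have "X - Y = - (q * (X + Y))" using SA by (rule sums_unique2[symmetric])
    then have "(1 + q) * X = (1 - q) * Y" by (simp add: algebra_simps)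
    then show "(1 + q) * ((s\<^sup>2 + lam) * P q + (4 - 4 * s) * q * P1 q + 4 * q\<^sup>2 * P2 q)
            = m * (1 - q) * (s * P q - 2 * q * P1 q)"
      unfolding X_def Y_def by (simp only: mult.assoc) (simp only: mult.left_commute[of m])
  next
    have "P 0 = a 0" unfolding P_def by (rule powser_zero)
    then show "P 0 = 1" by (simp add: a0)
  qed
qed

text \<open>As q = e^(-2t) tends to 0, P tends to 1 and s P - 2 q P' to s, so the bounds with 1/2, 2
  and s + 1 hold for large t. The resulting \<open>\<tau>1\<close> comes from s, m and \<lambda>
  alone and becomes the threshold for \<delta>.\<close>

lemma recessive_solution:
  fixes s m lam :: real
  assumes root: "s\<^sup>2 - m * s + lam = 0" and s: "0 \<le> s" "2 * s \<le> m" and lam: "0 \<le> lam"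
  obtains \<phi> \<phi>1 \<phi>2 :: "real \<Rightarrow> real" and \<tau>1 :: real where "\<tau>1 > 0"
    and "\<And>t. t > \<tau>1 \<Longrightarrow> (\<phi> has_real_derivative \<phi>1 t) (at t)"
    and "\<And>t. t > \<tau>1 \<Longrightarrow> (\<phi>1 has_real_derivative \<phi>2 t) (at t)"
    and "\<And>t. t > \<tau>1 \<Longrightarrow> \<phi>2 t = m * tanh t * \<phi>1 t - lam * \<phi> t"
    and "\<And>t. t > \<tau>1 \<Longrightarrow> exp (s * t) / 2 \<le> \<phi> t"
    and "\<And>t. t > \<tau>1 \<Longrightarrow> \<phi> t \<le> 2 * exp (s * t)"
    and "\<And>t. t > \<tau>1 \<Longrightarrow> \<bar>\<phi>1 t\<bar> \<le> (s + 1) * exp (s * t)"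
proof -
  obtain P P1 P2 r where r: "(r::real) > 0"
    and P: "\<And>q. \<bar>q\<bar> < r \<Longrightarrow> (P has_real_derivative P1 q) (at q)"
    and P1: "\<And>q. \<bar>q\<bar> < r \<Longrightarrow> (P1 has_real_derivative P2 q) (at q)"
    and eq: "\<And>q. \<bar>q\<bar> < r \<Longrightarrow> (1 + q) * ((s\<^sup>2 + lam) * P q + (4 - 4 * s) * q * P1 q + 4 * q\<^sup>2 * P2 q)
            = m * (1 - q) * (s * P q - 2 * q * P1 q)"
    and P0: "P 0 = 1"
    by (rule power_series_solution[OF assms]) (rule that)
  have "isCont P 0" "isCont (\<lambda>q. s * P q - 2 * q * P1 q) 0"
    using DERIV_isCont[OF P[of 0]] DERIV_isCont[OF P1[of 0]] r by auto
  then have "(P \<longlongrightarrow> 1) (at 0)" "((\<lambda>q. s * P q - 2 * q * P1 q) \<longlongrightarrow> s) (at 0)"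
    unfolding isCont_def using P0 by auto
  then have "\<forall>\<^sub>F q in at 0. dist (P q) 1 < 1/2" "\<forall>\<^sub>F q in at 0. dist (s * P q - 2 * q * P1 q) s < 1"
    by (auto dest: tendstoD[where e = "1/2"] tendstoD[where e = 1])
  then have "\<forall>\<^sub>F q in at 0. dist (P q) 1 < 1/2 \<and> dist (s * P q - 2 * q * P1 q) s < 1"
    by (rule eventually_conj)
  then obtain d where d: "d > 0"
    "\<And>q. q \<noteq> 0 \<Longrightarrow> \<bar>q\<bar> < d \<Longrightarrow> \<bar>P q - 1\<bar> < 1/2 \<and> \<bar>s * P q - 2 * q * P1 q - s\<bar> < 1"
    unfolding eventually_at by (auto simp: dist_real_def)
  define \<epsilon> where "\<epsilon> = min r d"
  \<comment> \<open>Beyond this value e^(-2t) < \<epsilon>; the maximum with 1 keeps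
    \<open>\<tau>1\<close> positive.\<close>
  define \<tau>1 where "\<tau>1 = max 1 (- ln \<epsilon> / 2)"
  have q: "\<bar>exp (- 2 * t)\<bar> < r" "\<bar>exp (- 2 * t)\<bar> < d" if "t > \<tau>1" for t
  proof -
    have "- 2 * t < ln \<epsilon>" using that unfolding \<tau>1_def by auto
    moreover have "\<epsilon> > 0" using r d by (simp add: \<epsilon>_def)
    ultimately have "exp (- 2 * t) < \<epsilon>" by (metis exp_less_mono exp_ln)
    then show "\<bar>exp (- 2 * t)\<bar> < r" "\<bar>exp (- 2 * t)\<bar> < d" by (auto simp: \<epsilon>_def)
  qed
  define Q where "Q t = exp (- 2 * t)" for t :: real
  define \<phi> where "\<phi> t = exp (s * t) * P (Q t)" for t
  define \<phi>1 where "\<phi>1 t = exp (s * t) * (s * P (Q t) - 2 * Q t * P1 (Q t))" for t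
  define \<phi>2 where "\<phi>2 t = exp (s * t) * (s\<^sup>2 * P (Q t) + (4 - 4 * s) * Q t * P1 (Q t) + 4 * (Q t)\<^sup>2 * P2 (Q t))" for t
  have dQ: "(Q has_real_derivative - 2 * Q t) (at t)" for t
    unfolding Q_def by (auto intro!: derivative_eq_intros)
  show ?thesis
  proof (rule that)
    show "\<tau>1 > 0" by (simp add: \<tau>1_def)
    fix t assume t: "t > \<tau>1"
    have Qt: "\<bar>Q t\<bar> < r" "\<bar>Q t\<bar> < d" "Q t > 0" using q[OF t] by (auto simp: Q_def)
    have dP: "((\<lambda>t. P (Q t)) has_real_derivative P1 (Q t) * (- 2 * Q t)) (at t)"
      using DERIV_chain2[OF P[OF Qt(1)] dQ] .
    have dP1: "((\<lambda>t. P1 (Q t)) has_real_derivative P2 (Q t) * (- 2 * Q t)) (at t)"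
      using DERIV_chain2[OF P1[OF Qt(1)] dQ] .
    show "(\<phi> has_real_derivative \<phi>1 t) (at t)"
      unfolding \<phi>_def \<phi>1_def by (auto intro!: derivative_eq_intros dP simp: algebra_simps)
    show "(\<phi>1 has_real_derivative \<phi>2 t) (at t)"
      unfolding \<phi>1_def \<phi>2_def
      by (auto intro!: derivative_eq_intros dP dP1 dQ simp: algebra_simps power2_eq_square)
    have "tanh t * (1 + Q t) = 1 - Q t"
      using Qt(3) unfolding tanh_real_altdef Q_def[symmetric] by simp
    then have T: "m * tanh t * (s * P (Q t) - 2 * Q t * P1 (Q t)) * (1 + Q t)
        = m * (1 - Q t) * (s * P (Q t) - 2 * Q t * P1 (Q t))"
    proof -
      have "m * a * z * b = m * (a * b) * z" for a b z :: real by simp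
      then show ?thesis using \<open>tanh t * (1 + Q t) = 1 - Q t\<close> by metis
    qed
    have "(1 + Q t) * ((s\<^sup>2 + lam) * P (Q t) + (4 - 4 * s) * Q t * P1 (Q t) + 4 * (Q t)\<^sup>2 * P2 (Q t))
       = (1 + Q t) * (m * tanh t * (s * P (Q t) - 2 * Q t * P1 (Q t)))"
      using eq[OF Qt(1)] T by (metis mult.commute)
    then have "(s\<^sup>2 + lam) * P (Q t) + (4 - 4 * s) * Q t * P1 (Q t) + 4 * (Q t)\<^sup>2 * P2 (Q t)
       = m * tanh t * (s * P (Q t) - 2 * Q t * P1 (Q t))"
      using Qt(3) by (subst (asm) mult_left_cancel) auto
    then have "exp (s * t) * (s\<^sup>2 * P (Q t) + (4 - 4 * s) * Q t * P1 (Q t) + 4 * (Q t)\<^sup>2 * P2 (Q t))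
       = exp (s * t) * (m * tanh t * (s * P (Q t) - 2 * Q t * P1 (Q t)) - lam * P (Q t))"
      by (simp add: distrib_right)
    then show "\<phi>2 t = m * tanh t * \<phi>1 t - lam * \<phi> t"
      unfolding \<phi>_def \<phi>1_def \<phi>2_def by (simp add: algebra_simps)
    have b: "\<bar>P (Q t) - 1\<bar> < 1/2" "\<bar>s * P (Q t) - 2 * Q t * P1 (Q t) - s\<bar> < 1"
      using d(2)[of "Q t"] Qt by auto
    show "exp (s * t) / 2 \<le> \<phi> t" "\<phi> t \<le> 2 * exp (s * t)"
      using mult_left_mono[of "1/2" "P (Q t)" "exp (s * t)"] mult_left_mono[of "P (Q t)" 2 "exp (s * t)"]
        abs_less_iff[THEN iffD1, OF b(1)]
      unfolding \<phi>_def by auto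
    have "\<bar>s * P (Q t) - 2 * Q t * P1 (Q t)\<bar> \<le> s + 1" using b(2) s by linarith
    then show "\<bar>\<phi>1 t\<bar> \<le> (s + 1) * exp (s * t)"
      unfolding \<phi>1_def by (simp add: abs_mult mult.commute)
  qed
qed

lemma cosh_bounds:
  assumes "0 \<le> (t::real)"
  shows "exp t / 2 \<le> cosh t" and "cosh t \<le> exp t"
  using assms by (auto simp: cosh_def)

text \<open>Reduction of order: if \<open>\<phi>\<close> solves the equation and \<open>I' = cosh\<^sup>m / \<phi>\<^sup>2\<close>, then so does \<open>\<phi> I\<close>.\<close>

lemma dominant_solution:
  fixes s lam \<tau>0 \<tau>1 :: real and m :: nat
  assumes s: "0 \<le> s" "2 * s \<le> real m"
    and \<tau>: "0 < \<tau>1" "\<tau>1 < \<tau>0"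
    and d: "\<And>t. t > \<tau>1 \<Longrightarrow> (\<phi> has_real_derivative \<phi>1 t) (at t)"
      "\<And>t. t > \<tau>1 \<Longrightarrow> (\<phi>1 has_real_derivative \<phi>2 t) (at t)"
    and ode: "\<And>t. t > \<tau>1 \<Longrightarrow> \<phi>2 t = real m * tanh t * \<phi>1 t - lam * \<phi> t"
    and low: "\<And>t. t > \<tau>1 \<Longrightarrow> exp (s * t) / 2 \<le> \<phi> t"
    and up: "\<And>t. t > \<tau>1 \<Longrightarrow> \<phi> t \<le> 2 * exp (s * t)"
    and up1: "\<And>t. t > \<tau>1 \<Longrightarrow> \<bar>\<phi>1 t\<bar> \<le> (s + 1) * exp (s * t)"
  obtains H H1 H2 :: "real \<Rightarrow> real" and C :: real where "C > 0"
    and "\<And>t. t > \<tau>1 \<Longrightarrow> (H has_real_derivative H1 t) (at t)"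
    and "\<And>t. t > \<tau>1 \<Longrightarrow> (H1 has_real_derivative H2 t) (at t)"
    and "\<And>t. t > \<tau>1 \<Longrightarrow> H2 t = real m * tanh t * H1 t - lam * H t"
    and "\<And>t. t > \<tau>1 \<Longrightarrow> isCont H2 t"
    and "H \<tau>0 = 0"
    and "\<And>t. t > \<tau>0 \<Longrightarrow> H t > 0"
    and "\<And>t. t > \<tau>0 \<Longrightarrow> H t \<le> C * exp ((real m - s) * t) * (if real m = 2 * s then t else 1)"
    and "\<And>t. t \<ge> \<tau>0 + 1 \<Longrightarrow> \<bar>H1 t\<bar> \<le> C * H t"
proof -
  define k where "k t = cosh t ^ m / (\<phi> t)\<^sup>2" for t
  \<comment> \<open>The growth exponent of \<open>k\<close>. It vanishes exactly for the double root
    m = 2s, where the primitive \<open>I\<close> is bounded by a multiple of t instead of an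
    exponential; this is the source of the factor t.\<close>
  define e where "e = real m - 2 * s"
  have e: "e \<ge> 0" using s by (simp add: e_def)
  have \<phi>pos: "\<phi> t > 0" if "t > \<tau>1" for t
    by (rule less_le_trans[OF _ low[OF that]]) simp
  have kcont: "isCont k t" if "t > \<tau>1" for t
    unfolding k_def using \<phi>pos[OF that] DERIV_isCont[OF d(1)[OF that]]
    by (intro continuous_intros) auto
  have "\<exists>J. \<forall>t. ereal \<tau>1 < ereal t \<longrightarrow> ereal t < \<infinity> \<longrightarrow> (J has_vector_derivative k t) (at t)"
    by (rule einterval_antiderivative) (auto intro: kcont)
  then obtain J where J: "\<And>t. t > \<tau>1 \<Longrightarrow> (J has_real_derivative k t) (at t)"
    by (auto simp: has_real_derivative_iff_has_vector_derivative)
  \<comment> \<open>Normalized to vanish at \<open>\<tau>0\<close>, but defined on both sides of it,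
    so that \<open>H\<close> has two-sided derivatives at the boundary value.\<close>
  define I where "I t = J t - J \<tau>0" for t
  have dI: "(I has_real_derivative k t) (at t)" if "t > \<tau>1" for t
    unfolding I_def using J[OF that] by (auto intro!: derivative_eq_intros)
  have kpos: "k t > 0" if "t > \<tau>1" for t
    using \<phi>pos[OF that] by (simp add: k_def)
  have expm: "exp t ^ m = exp (real m * t)" for t :: real
    by (simp add: exp_of_nat_mult)
  have kup: "k t \<le> 4 * exp (e * t)" if "t > \<tau>1" for t
  proof -
    have "cosh t ^ m \<le> exp t ^ m" using cosh_bounds(2)[of t] that \<tau> by (intro power_mono) auto
    moreover have "(exp (s * t) / 2)\<^sup>2 \<le> (\<phi> t)\<^sup>2" using low[OF that] by (intro power_mono) auto
    ultimately have "k t \<le> exp t ^ m / (exp (s * t) / 2)\<^sup>2"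
      unfolding k_def by (intro frac_le) auto
    also have "\<dots> = 4 * exp (e * t)"
      by (simp add: expm power2_eq_square e_def left_diff_distrib exp_diff exp_add[symmetric] mult.assoc)
    finally show ?thesis .
  qed
  have klow: "k t \<ge> (1/2) ^ m / 4 * exp (e * t)" if "t > \<tau>1" for t
  proof -
    have "(exp t / 2) ^ m \<le> cosh t ^ m" using cosh_bounds(1)[of t] that \<tau> by (intro power_mono) auto
    moreover have "(\<phi> t)\<^sup>2 \<le> (2 * exp (s * t))\<^sup>2" using up[OF that] \<phi>pos[OF that] by (intro power_mono) auto
    ultimately have "k t \<ge> (exp t / 2) ^ m / (2 * exp (s * t))\<^sup>2"
      unfolding k_def using \<phi>pos[OF that] by (intro frac_le) auto
    also have "(exp t / 2) ^ m / (2 * exp (s * t))\<^sup>2 = (1/2) ^ m / 4 * exp (e * t)"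
      by (simp add: expm power_divide power2_eq_square e_def left_diff_distrib exp_diff exp_add[symmetric] mult.assoc)
    finally show ?thesis .
  qed
  have I0: "I \<tau>0 = 0" by (simp add: I_def)
  have Ipos: "I t > 0" if "t > \<tau>0" for t
    using DERIV_pos_imp_increasing[of \<tau>0 t I] that dI kpos \<tau> I0
    by (metis less_le_trans order.strict_trans)
  \<comment> \<open>Chosen so that \<open>K * w\<close> has derivative 4 e^(et) in both cases, the
    bound of \<open>kup\<close>.\<close>
  define K where "K = (if e = 0 then 4 else 4 / e)"
  have K: "K > 0" using e by (simp add: K_def)
  define w where "w t = exp (e * t) * (if e = 0 then t else 1)" for t
  have Iup: "I t \<le> K * w t" if "t > \<tau>0" for t
  proof -
    have dw: "((\<lambda>t. K * w t) has_real_derivative 4 * exp (e * t)) (at t)" for t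
      unfolding K_def w_def by (auto intro!: derivative_eq_intros)
    define g where "g = (\<lambda>t. I t - K * w t)"
    have "g t \<le> g \<tau>0"
    proof (rule DERIV_nonpos_imp_nonincreasing[OF less_imp_le[OF that]])
      fix x assume "\<tau>0 \<le> x" "x \<le> t"
      then have "x > \<tau>1" using \<tau> by simp
      then show "\<exists>y. (g has_real_derivative y) (at x) \<and> y \<le> 0"
        unfolding g_def using DERIV_diff[OF dI dw] kup by (metis diff_le_0_iff_le)
    qed
    also have "\<dots> \<le> 0" using I0 K \<tau> by (simp add: w_def g_def)
    finally show ?thesis by (simp add: g_def)
  qed
  \<comment> \<open>The mean value theorem on [t - 1, t] bounds \<open>I t\<close> below by a value
    of \<open>k\<close> there; e^(-e) is the loss over unit length. Stepping back by 1 is why the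
    bound for \<open>H1\<close> starts at \<open>\<tau>0 + 1\<close>.\<close>
  define c where "c = (1/2) ^ m / 4 * exp (- e)"
  have c: "c > 0" by (simp add: c_def)
  have Ilow: "I t \<ge> c * exp (e * t)" if "t \<ge> \<tau>0 + 1" for t
  proof -
    have "\<exists>z. t - 1 < z \<and> z < t \<and> I t - I (t - 1) = (t - (t - 1)) * k z"
      using that \<tau> by (intro MVT2) (auto intro: dI)
    then obtain z where z: "t - 1 < z" "z < t" "I t - I (t - 1) = k z" by auto
    have "I (t - 1) \<ge> 0"
      using Ipos[of "t - 1"] I0 that by (cases "t - 1 = \<tau>0") auto
    then have "I t \<ge> k z" using z by simp
    moreover have "k z \<ge> (1/2) ^ m / 4 * exp (e * z)" using z that \<tau> by (intro klow) simp
    moreover have "exp (e * z) \<ge> exp (- e + e * t)"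
      using mult_left_mono[of "t - 1" z e] z e unfolding exp_le_cancel_iff by (simp add: algebra_simps)
    then have "(1/2) ^ m / 4 * exp (- e + e * t) \<le> (1/2) ^ m / 4 * exp (e * z)"
      by (rule mult_left_mono) simp
    then have "(1/2) ^ m / 4 * exp (e * z) \<ge> c * exp (e * t)"
      by (simp only: c_def exp_add mult.assoc)
    ultimately show ?thesis by linarith
  qed
  define H where "H t = \<phi> t * I t" for t
  define H1 where "H1 t = \<phi>1 t * I t + cosh t ^ m / \<phi> t" for t
  define H2 where "H2 t = real m * tanh t * H1 t - lam * H t" for t
  define C where "C = max (2 * K) (2 * (s + 1) + 4 / c)"
  have C: "C > 0" using K by (simp add: C_def)
  have dH: "(H has_real_derivative H1 t) (at t)" if "t > \<tau>1" for t
  proof -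
    have "\<phi> t * k t = cosh t ^ m / \<phi> t"
      using \<phi>pos[OF that] by (simp add: k_def power2_eq_square)
    then show ?thesis
      using DERIV_mult[OF d(1)[OF that] dI[OF that]] unfolding H_def H1_def
      by (simp add: mult.commute)
  qed
  \<comment> \<open>cosh^m is the Wronskian of the equation and satisfies y' = m tanh t y. In the
    derivative of \<open>H1\<close> the two terms with \<open>\<phi>1 t * cosh t ^ m\<close> cancel,
    and what remains is the equation for \<open>H\<close>.\<close>
  have dH1: "(H1 has_real_derivative H2 t) (at t)" if "t > \<tau>1" for t
  proof -
    have "((\<lambda>t. cosh t ^ m) has_real_derivative real m * tanh t * cosh t ^ m) (at t)"
    proof -
      have "((\<lambda>t. cosh t ^ m) has_real_derivative real m * cosh t ^ (m - 1) * sinh t) (at t)"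
        by (auto intro!: derivative_eq_intros)
      moreover have "real m * cosh t ^ (m - 1) * sinh t = real m * tanh t * cosh t ^ m"
        by (cases m) (simp_all add: tanh_def)
      ultimately show ?thesis by (rule DERIV_cong)
    qed
    note dc = this
    have "(H1 has_real_derivative (\<phi>2 t * I t + \<phi>1 t * k t) +
        (real m * tanh t * cosh t ^ m * \<phi> t - cosh t ^ m * \<phi>1 t) / (\<phi> t * \<phi> t)) (at t)"
      unfolding H1_def
      using DERIV_add[OF DERIV_mult'[OF d(2)[OF that] dI[OF that]]
         DERIV_divide[OF dc d(1)[OF that]]] \<phi>pos[OF that]
      by (simp add: algebra_simps)
    moreover have "(\<phi>2 t * I t + \<phi>1 t * k t) +
        (real m * tanh t * cosh t ^ m * \<phi> t - cosh t ^ m * \<phi>1 t) / (\<phi> t * \<phi> t) = H2 t"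
      using \<phi>pos[OF that] unfolding H2_def H1_def H_def ode[OF that] k_def
      by (simp add: diff_divide_distrib power2_eq_square algebra_simps)
    ultimately show ?thesis by (rule DERIV_cong)
  qed
  show ?thesis
  proof (rule that[OF C dH dH1])
    show "H2 t = real m * tanh t * H1 t - lam * H t" if "t > \<tau>1" for t by (rule H2_def)
    show "isCont H2 t" if "t > \<tau>1" for t
      unfolding H2_def using DERIV_isCont[OF dH[OF that]] DERIV_isCont[OF dH1[OF that]]
      by (intro continuous_intros) auto
    show "H \<tau>0 = 0" by (simp add: H_def I0)
    show "H t > 0" if "t > \<tau>0" for t
      using Ipos[OF that] \<phi>pos[of t] that \<tau> by (simp add: H_def)
    show "H t \<le> C * exp ((real m - s) * t) * (if real m = 2 * s then t else 1)" if "t > \<tau>0" for t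
    proof -
      have "H t \<le> (2 * exp (s * t)) * (K * w t)"
        unfolding H_def using up[of t] Iup[OF that] Ipos[OF that] that \<tau>
        by (intro mult_mono) auto
      also have "\<dots> = 2 * K * (exp ((real m - s) * t) * (if real m = 2 * s then t else 1))"
        by (simp add: w_def e_def exp_add[symmetric] algebra_simps)
      also have "\<dots> \<le> C * (exp ((real m - s) * t) * (if real m = 2 * s then t else 1))"
        using that \<tau> by (intro mult_right_mono) (auto simp: C_def)
      finally show ?thesis by (simp add: mult.assoc)
    qed
    show "\<bar>H1 t\<bar> \<le> C * H t" if "t \<ge> \<tau>0 + 1" for t
    proof -
      have t: "t > \<tau>1" "t > \<tau>0" "t > 0" using that \<tau> by auto
      have "exp (s * t) * I t \<le> 2 * H t"
        unfolding H_def using low[OF t(1)] Ipos[OF t(2)] mult_right_mono[of "exp (s * t) / 2" "\<phi> t" "I t"]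
        by simp
      have "\<bar>\<phi>1 t * I t\<bar> \<le> (s + 1) * exp (s * t) * I t"
        using up1[OF t(1)] Ipos[OF t(2)] by (simp add: abs_mult mult_right_mono)
      also have "\<dots> = (s + 1) * (exp (s * t) * I t)" by (rule mult.assoc)
      also have "\<dots> \<le> (s + 1) * (2 * H t)"
        using \<open>exp (s * t) * I t \<le> 2 * H t\<close> s by (intro mult_left_mono) auto
      also have "\<dots> = 2 * (s + 1) * H t" by simp
      finally have 1: "\<bar>\<phi>1 t * I t\<bar> \<le> 2 * (s + 1) * H t" .
      \<comment> \<open>This summand of \<open>H1\<close> has size at most e^((m-s)t) = e^(st)
        e^(et), up to a constant; the lower bounds for \<phi> and \<open>I\<close> turn it into a
        multiple of \<open>H t\<close>.\<close>
      have "cosh t ^ m / \<phi> t \<le> exp t ^ m / (exp (s * t) / 2)"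
        using cosh_bounds(2)[of t] low[OF t(1)] t by (intro frac_le power_mono) auto
      also have "\<dots> = 2 / c * (exp (s * t) * (c * exp (e * t)))"
      proof -
        have "real m * t - s * t = s * t + e * t" by (simp add: e_def algebra_simps)
        then have "exp (real m * t) / exp (s * t) = exp (s * t) * exp (e * t)"
          by (simp only: exp_diff[symmetric] exp_add[symmetric])
        then have "exp t ^ m / exp (s * t) = exp (s * t) * exp (e * t)" by (simp only: expm)
        then have "2 * (exp t ^ m / exp (s * t)) = 2 * (exp (s * t) * exp (e * t))" by (simp only:)
        then show ?thesis using c by (simp add: mult.commute)
      qed
      also have "\<dots> \<le> 2 / c * (exp (s * t) * I t)"
        using Ilow[OF that] c by (intro mult_left_mono) auto
      also have "\<dots> \<le> 4 / c * H t"
        using mult_left_mono[OF \<open>exp (s * t) * I t \<le> 2 * H t\<close>, of "2 / c"] c by simp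
      finally have 2: "cosh t ^ m / \<phi> t \<le> 4 / c * H t" .
      have "\<bar>H1 t\<bar> \<le> \<bar>\<phi>1 t * I t\<bar> + cosh t ^ m / \<phi> t"
        unfolding H1_def using \<phi>pos[OF t(1)] by (intro abs_triangle_ineq[THEN order_trans]) simp
      also have "\<dots> \<le> (2 * (s + 1) + 4 / c) * H t"
        using 1 2 by (simp add: distrib_right)
      also have "\<dots> \<le> C * H t"
        unfolding C_def H_def using \<phi>pos[OF t(1)] Ipos[OF t(2)] by (intro mult_right_mono) auto
      finally show ?thesis .
    qed
  qed
qed


section \<open>Measure of spherical caps and slabs\<close>

lemma finite_measure_sphere_measure: "finite_measure (sphere_measure :: 'a::euclidean_space measure)"
proof
  show "emeasure (sphere_measure :: 'a measure) (space sphere_measure) \<noteq> \<infinity>"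
    by (simp add: emeasure_sphere_measure_UNIV ennreal_mult_eq_top_iff)
qed

text \<open>The cone over the cap is covered by balls of radius \<open>2 / cosh t\<close> centred on its axis.\<close>

lemma sphere_measure_cap_le:
  fixes pole :: "'a::euclidean_space"
  assumes pole: "norm pole = 1" and t: "0 \<le> t"
  shows "emeasure sphere_measure {x. norm x = 1 \<and> x \<bullet> pole \<le> - tanh t}
     \<le> ennreal (real DIM('a) * (2 * unit_ball_vol DIM('a) * 2 ^ DIM('a) * (2 * exp (- t)) ^ (DIM('a) - 1)))"
    (is "emeasure _ ?A \<le> _")
proof -
  let ?d = "DIM('a)"
  \<comment> \<open>The sine of the angular radius of the cap, hence a bound for the distance of the
    cone from its axis.\<close>
  define \<rho> where "\<rho> = 1 / cosh t"
  have \<rho>: "0 < \<rho>" "\<rho> \<le> 1" using cosh_real_ge_1[of t] by (auto simp: \<rho>_def)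
  have \<rho>exp: "\<rho> \<le> 2 * exp (- t)"
  proof -
    have "exp t \<le> 2 * cosh t" by (simp add: cosh_def)
    then have "1 / cosh t \<le> 2 / exp t" by (simp add: field_simps)
    then show ?thesis by (simp add: \<rho>_def exp_minus field_simps)
  qed
  \<comment> \<open>The axis segment has length 1, so about 1/\<rho> centres at spacing \<rho>
    suffice; the distance to the axis and the distance along it to a centre are both at most \<rho>.
    The total volume is of order (1/\<rho>) \<rho>^d = \<rho>^(d-1), which for d = N + 1 gives the
    decay e^(-Nt).\<close>
  define n where "n = nat \<lfloor>1 / \<rho>\<rfloor>"
  have n: "real n \<le> 1 / \<rho>" using \<rho> by (simp add: n_def)
  have pp: "pole \<bullet> pole = 1" using pole by (simp add: dot_square_norm)
  let ?B = "\<lambda>j. cball (- (real j * \<rho>) *\<^sub>R pole) (2 * \<rho>)"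
  have cover: "{y \<in> cball 0 1. y /\<^sub>R norm y \<in> ?A} \<subseteq> (\<Union>j\<in>{..n}. ?B j)"
  proof
    fix y assume "y \<in> {y \<in> cball 0 1. y /\<^sub>R norm y \<in> ?A}"
    then have y: "norm y \<le> 1" and x: "norm (y /\<^sub>R norm y) = 1" "(y /\<^sub>R norm y) \<bullet> pole \<le> - tanh t" by auto
    define x where "x = y /\<^sub>R norm y"
    define r where "r = norm y"
    define z where "z = x \<bullet> pole"
    have "norm y \<noteq> 0" using x(1) by auto
    then have r: "0 \<le> r" "r \<le> 1" "y = r *\<^sub>R x" using y by (auto simp: r_def x_def)
    have xx: "x \<bullet> x = 1" using x by (simp add: x_def dot_square_norm)
    have z: "z \<le> - tanh t" "-1 \<le> z"
      using x Cauchy_Schwarz_ineq2[of x pole] pole by (auto simp: z_def x_def)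
    have tt: "0 \<le> tanh t" using t by simp
    have z0: "z \<le> 0" using z tt by linarith
    have "(tanh t)\<^sup>2 \<le> z\<^sup>2" using power_mono[of "tanh t" "- z" 2] z tt by simp
    then have "1 - z\<^sup>2 \<le> \<rho>\<^sup>2" using tanh_square_cosh[of t] by (simp add: \<rho>_def power_divide)
    moreover have "(norm (x - z *\<^sub>R pole))\<^sup>2 = 1 - z\<^sup>2"
      unfolding power2_norm_eq_inner
      by (simp add: inner_diff_left inner_diff_right xx pp z_def inner_commute power2_eq_square)
    ultimately have "norm (x - z *\<^sub>R pole) \<le> \<rho>" using \<rho> by (metis power2_le_imp_le less_imp_le)
    then have 1: "norm (r *\<^sub>R x - (r * z) *\<^sub>R pole) \<le> \<rho>"
    proof -
      have "norm (r *\<^sub>R x - (r * z) *\<^sub>R pole) = r * norm (x - z *\<^sub>R pole)"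
        using r(1) by (simp add: scaleR_diff_right[symmetric] flip: scaleR_scaleR)
      also have "\<dots> \<le> 1 * \<rho>" using \<open>norm (x - z *\<^sub>R pole) \<le> \<rho>\<close> r by (intro mult_mono) auto
      finally show ?thesis by simp
    qed
    define q where "q = (- r * z) / \<rho>"
    have "r * (- z) \<le> 1 * 1" using r z z0 by (intro mult_mono) auto
    then have "- r * z \<le> 1" by simp
    moreover have "0 \<le> - r * z" using r z0 by (simp add: mult_nonneg_nonpos)
    ultimately have q: "0 \<le> q" "q \<le> 1 / \<rho>"
      unfolding q_def using divide_nonneg_pos[OF _ \<rho>(1)] divide_right_mono[OF _ less_imp_le[OF \<rho>(1)]] by blast+
    define j where "j = nat \<lfloor>q\<rfloor>"
    have jn: "j \<le> n" unfolding j_def n_def using q by (intro nat_mono floor_mono)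
    have j: "real j \<le> q" "q \<le> real j + 1" using q by (auto simp: j_def)
    have "r * z = - (q * \<rho>)" using \<rho> by (simp add: q_def)
    then have "\<bar>r * z + real j * \<rho>\<bar> = (q - real j) * \<rho>" using j \<rho> by (simp add: left_diff_distrib abs_if mult_right_mono)
    also have "\<dots> \<le> 1 * \<rho>" using j \<rho> by (intro mult_right_mono) auto
    finally have 2: "norm ((r * z) *\<^sub>R pole + (real j * \<rho>) *\<^sub>R pole) \<le> \<rho>"
      using pole by (simp flip: scaleR_add_left)
    have "y - (- (real j * \<rho>) *\<^sub>R pole) = (r *\<^sub>R x - (r * z) *\<^sub>R pole) + ((r * z) *\<^sub>R pole + (real j * \<rho>) *\<^sub>R pole)"
      by (simp add: r(3))
    then have "norm (y - (- (real j * \<rho>) *\<^sub>R pole)) \<le> \<rho> + \<rho>"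
      using 1 2 by (metis add_mono norm_triangle_le)
    then have "y \<in> ?B j" by (simp add: dist_norm norm_minus_commute)
    then show "y \<in> (\<Union>j\<in>{..n}. ?B j)" using jn by blast
  qed
  have A: "?A \<in> sets borel" by measurable
  have "emeasure lborel {y \<in> cball 0 1. y /\<^sub>R norm y \<in> ?A} \<le> emeasure lborel (\<Union>j\<in>{..n}. ?B j)"
    by (rule emeasure_mono[OF cover]) simp
  also have "\<dots> \<le> (\<Sum>j\<in>{..n}. emeasure lborel (?B j))"
    by (rule emeasure_subadditive_finite) auto
  also have "\<dots> = ennreal (real (Suc n) * (unit_ball_vol ?d * (2 * \<rho>) ^ ?d))"
    using \<rho> by (simp add: emeasure_cball sum_ennreal[symmetric] ennreal_mult[symmetric] flip: ennreal_of_nat_eq_real_of_nat)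
       (simp add: ennreal_of_nat_eq_real_of_nat ennreal_mult)
  also have "\<dots> \<le> ennreal (2 * unit_ball_vol ?d * 2 ^ ?d * (2 * exp (- t)) ^ (?d - 1))"
  proof (rule ennreal_leI)
    have "real (Suc n) \<le> 2 / \<rho>"
    proof -
      have "1 \<le> 1 / \<rho>" using \<rho> by simp
      then have "real (Suc n) \<le> 1 / \<rho> + 1 / \<rho>" using n by simp
      then show ?thesis by simp
    qed
    then have "real (Suc n) * (unit_ball_vol ?d * (2 * \<rho>) ^ ?d) \<le> 2 / \<rho> * (unit_ball_vol ?d * (2 * \<rho>) ^ ?d)"
      using \<rho> by (intro mult_right_mono) auto
    also have "\<dots> = 2 * unit_ball_vol ?d * 2 ^ ?d * \<rho> ^ (?d - 1)"
      using \<rho> power_eq_if[of \<rho> ?d] by (simp add: power_mult_distrib)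
    also have "\<dots> \<le> 2 * unit_ball_vol ?d * 2 ^ ?d * (2 * exp (- t)) ^ (?d - 1)"
      using \<rho> \<rho>exp by (intro mult_left_mono power_mono) auto
    finally show "real (Suc n) * (unit_ball_vol ?d * (2 * \<rho>) ^ ?d)
       \<le> 2 * unit_ball_vol ?d * 2 ^ ?d * (2 * exp (- t)) ^ (?d - 1)" .
  qed
  finally have "of_nat ?d * emeasure lborel {y \<in> cball 0 1. y /\<^sub>R norm y \<in> ?A}
     \<le> of_nat ?d * ennreal (2 * unit_ball_vol ?d * 2 ^ ?d * (2 * exp (- t)) ^ (?d - 1))"
    by (rule mult_left_mono) simp
  then show ?thesis
    unfolding emeasure_sphere_measure[OF A]
    by (simp add: ennreal_of_nat_eq_real_of_nat ennreal_mult)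
qed

text \<open>The cone over a parallel lies in the frontier of a convex cone.\<close>

lemma sphere_measure_parallel_null:
  fixes pole :: "'a::euclidean_space"
  assumes pole: "norm pole = 1" and c: "-1 < c" "c < 0"
  shows "emeasure sphere_measure {x. norm x = 1 \<and> x \<bullet> pole = c} = 0"
proof -
  let ?A = "{x. norm x = 1 \<and> x \<bullet> pole = c}"
  define K where "K = {y::'a. y \<bullet> pole \<le> c * norm y}"
  have pp: "pole \<bullet> pole = 1" using pole by (simp add: dot_square_norm)
  \<comment> \<open>For negative c the function \<open>c * norm y\<close> is concave, so its
    hypograph condition defines a convex cone.\<close>
  have "convex K"
  proof (rule convexI)
    fix x y :: 'a and u v :: real
    assume xy: "x \<in> K" "y \<in> K" and uv: "0 \<le> u" "0 \<le> v" "u + v = 1"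
    have "(u *\<^sub>R x + v *\<^sub>R y) \<bullet> pole \<le> u * (c * norm x) + v * (c * norm y)"
      using xy uv unfolding K_def by (auto simp: inner_add_left intro!: add_mono mult_left_mono)
    also have "\<dots> = c * (norm (u *\<^sub>R x) + norm (v *\<^sub>R y))" using uv by (simp add: algebra_simps)
    also have "\<dots> \<le> c * norm (u *\<^sub>R x + v *\<^sub>R y)"
      using norm_triangle_ineq[of "u *\<^sub>R x" "v *\<^sub>R y"] c by (intro mult_left_mono_neg) auto
    finally show "u *\<^sub>R x + v *\<^sub>R y \<in> K" by (simp add: K_def)
  qed
  then have neg: "negligible (frontier K)" by (rule negligible_convex_frontier)
  have "{y \<in> cball 0 1. y /\<^sub>R norm y \<in> ?A} \<subseteq> frontier K"
  proof
    fix y assume "y \<in> {y \<in> cball 0 1. y /\<^sub>R norm y \<in> ?A}"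
    then have y: "y \<bullet> pole / norm y = c" by (simp add: divide_inverse mult.commute)
    then have ny: "y \<noteq> 0" using c(2) by auto
    then have eq: "y \<bullet> pole = c * norm y" using y by (simp add: field_simps)
    have "y \<notin> interior K"
    proof
      assume "y \<in> interior K"
      then obtain e where e: "e > 0" "ball y e \<subseteq> K" by (auto simp: mem_interior)
      \<comment> \<open>Moving towards the pole raises the left side of the condition by e/2 and the
        right side by less, because |c| < 1; so points of equality are not interior.\<close>
      define y' where "y' = y + (e / 2) *\<^sub>R pole"
      have "y' \<in> ball y e" using e pole by (simp add: y'_def dist_norm)
      then have "y' \<bullet> pole \<le> c * norm y'" using e(2) by (auto simp: K_def)
      moreover have "y' \<bullet> pole = c * norm y + e / 2" by (simp add: y'_def inner_add_left eq pp)
      moreover have "c * norm y' < c * norm y + e / 2"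
      proof -
        have "\<bar>norm y' - norm y\<bar> \<le> norm (y' - y)" by (rule norm_triangle_ineq3)
        also have "\<dots> = e / 2" using pole e by (simp add: y'_def)
        finally have "\<bar>c\<bar> * \<bar>norm y' - norm y\<bar> \<le> \<bar>c\<bar> * (e / 2)" by (rule mult_left_mono) simp
        also have "\<dots> < 1 * (e / 2)" using c e by (intro mult_strict_right_mono) auto
        finally have "\<bar>c * (norm y' - norm y)\<bar> < e / 2" by (simp add: abs_mult)
        then have "c * (norm y' - norm y) < e / 2" by (rule le_less_trans[OF abs_ge_self])
        then show ?thesis by (simp add: right_diff_distrib)
      qed
      ultimately show False by simp
    qed
    moreover have "y \<in> closure K" using eq closure_subset[of K] by (auto simp: K_def)
    ultimately show "y \<in> frontier K" by (simp add: frontier_def)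
  qed
  then have "negligible {y \<in> cball 0 1. y /\<^sub>R norm y \<in> ?A}" using neg negligible_subset by blast
  moreover have "{y \<in> cball 0 1. y /\<^sub>R norm y \<in> ?A} \<in> sets borel" by measurable
  ultimately have "emeasure lborel {y \<in> cball 0 1. y /\<^sub>R norm y \<in> ?A} = 0"
    by (simp add: negligible_iff_null_sets null_sets_def emeasure_completion)
  moreover have "?A \<in> sets borel" by measurable
  ultimately show ?thesis by (simp add: emeasure_sphere_measure)
qed

lemma borel_measurable_lat [measurable]: "lat pole \<in> borel_measurable borel"
  unfolding lat_def artanh_def by measurable

text \<open>The layer j <= \<tau> <= j + 1 has measure of order at most e^(-Nj), which cancels the
  integrand up to a factor e^N; at most 3R such layers are needed to cover the slab.\<close>

lemma slab_integral_le:
  fixes pole :: "'a::euclidean_space"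
  assumes pole: "norm pole = 1" and N: "DIM('a) = N + 1"
  obtains C where "C > 0" and
    "\<And>R. 1 \<le> R \<Longrightarrow> (\<integral>\<^sup>+x. ennreal (exp (real N * lat pole x))
        * indicator {x. norm x = 1 \<and> \<bar>x \<bullet> pole\<bar> < 1 \<and> R \<le> lat pole x \<and> lat pole x \<le> 2 * R} x \<partial>sphere_measure)
      \<le> ennreal (C * R)"
proof -
  define c where "c = real (N + 1) * (2 * unit_ball_vol (N + 1) * 2 ^ (N + 1) * 2 ^ N)"
  have c: "c > 0" by (simp add: c_def)
  define A where "A j = {x::'a. norm x = 1 \<and> x \<bullet> pole \<le> - tanh (real j)}" for j
  have Am: "A j \<in> sets borel" for j unfolding A_def by measurable
  have cap: "emeasure sphere_measure (A j) \<le> ennreal (c * exp (- real N * real j))" for j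
    using sphere_measure_cap_le[OF pole, of "real j"] unfolding A_def N c_def
    by (simp add: power_mult_distrib exp_of_nat_mult[symmetric] mult.assoc)
  show ?thesis
  proof (rule that[of "3 * c * exp (real N)"])
    show "3 * c * exp (real N) > 0" using c by simp
    fix R :: real assume R: "1 \<le> R"
    define J where "J = {nat \<lfloor>R\<rfloor>..nat \<lfloor>2 * R\<rfloor>}"
    have cardJ: "real (card J) \<le> 3 * R"
    proof -
      have "real (nat \<lfloor>2 * R\<rfloor>) \<le> 2 * R" using R by linarith
      moreover have "1 \<le> nat \<lfloor>R\<rfloor>" using R by (simp add: le_nat_iff)
      moreover have "card J \<le> Suc (nat \<lfloor>2 * R\<rfloor>) - nat \<lfloor>R\<rfloor>" by (simp add: J_def)
      ultimately show ?thesis using R by linarith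
    qed
    have "(\<integral>\<^sup>+x. ennreal (exp (real N * lat pole x))
        * indicator {x. norm x = 1 \<and> \<bar>x \<bullet> pole\<bar> < 1 \<and> R \<le> lat pole x \<and> lat pole x \<le> 2 * R} x \<partial>sphere_measure)
      \<le> (\<integral>\<^sup>+x. (\<Sum>j\<in>J. ennreal (exp (real N * (real j + 1))) * indicator (A j) x) \<partial>sphere_measure)"
    proof (rule nn_integral_mono)
      fix x :: 'a
      show "ennreal (exp (real N * lat pole x))
        * indicator {x. norm x = 1 \<and> \<bar>x \<bullet> pole\<bar> < 1 \<and> R \<le> lat pole x \<and> lat pole x \<le> 2 * R} x
        \<le> (\<Sum>j\<in>J. ennreal (exp (real N * (real j + 1))) * indicator (A j) x)"
      proof (cases "norm x = 1 \<and> \<bar>x \<bullet> pole\<bar> < 1 \<and> R \<le> lat pole x \<and> lat pole x \<le> 2 * R")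
        case True
        define j where "j = nat \<lfloor>lat pole x\<rfloor>"
        have jJ: "j \<in> J" using True unfolding j_def J_def by (auto intro!: nat_mono floor_mono)
        have j: "real j \<le> lat pole x" "lat pole x \<le> real j + 1"
          using True R unfolding j_def by linarith+
        have "tanh (real j) \<le> tanh (lat pole x)" using j(1) by simp
        moreover have "tanh (lat pole x) = - (x \<bullet> pole)" using True by (intro tanh_lat) auto
        ultimately have "x \<bullet> pole \<le> - tanh (real j)" by linarith
        then have "x \<in> A j" using True by (simp add: A_def)
        then have "ennreal (exp (real N * lat pole x)) \<le> ennreal (exp (real N * (real j + 1))) * indicator (A j) x"
          using j(2) by (simp add: mult_left_mono)
        also have "\<dots> \<le> (\<Sum>j\<in>J. ennreal (exp (real N * (real j + 1))) * indicator (A j) x)"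
          by (rule sum_nonneg_leq_bound[OF _ _ refl jJ]) (auto simp: J_def)
        finally show ?thesis using True by simp
      qed simp
    qed
    also have "\<dots> = (\<Sum>j\<in>J. ennreal (exp (real N * (real j + 1))) * emeasure sphere_measure (A j))"
      using Am by (subst nn_integral_sum) (auto simp: nn_integral_cmult_indicator)
    also have "\<dots> \<le> (\<Sum>j\<in>J. ennreal (c * exp (real N)))"
    proof (rule sum_mono)
      fix j
      have "ennreal (exp (real N * (real j + 1))) * emeasure sphere_measure (A j)
         \<le> ennreal (exp (real N * (real j + 1))) * ennreal (c * exp (- real N * real j))"
        by (rule mult_left_mono[OF cap]) simp
      also have "\<dots> = ennreal (c * exp (real N))"
        using c by (simp add: ennreal_mult[symmetric] mult.left_commute[of _ c] exp_add[symmetric] algebra_simps)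
      finally show "ennreal (exp (real N * (real j + 1))) * emeasure sphere_measure (A j) \<le> ennreal (c * exp (real N))" .
    qed
    also have "\<dots> = ennreal (real (card J) * (c * exp (real N)))"
      using c by (simp add: ennreal_of_nat_eq_real_of_nat ennreal_mult)
    also have "\<dots> \<le> ennreal (3 * c * exp (real N) * R)"
      using mult_right_mono[OF cardJ, of "c * exp (real N)"] c by (intro ennreal_leI) (simp add: mult_ac)
    finally show "(\<integral>\<^sup>+x. ennreal (exp (real N * lat pole x))
        * indicator {x. norm x = 1 \<and> \<bar>x \<bullet> pole\<bar> < 1 \<and> R \<le> lat pole x \<and> lat pole x \<le> 2 * R} x \<partial>sphere_measure)
      \<le> ennreal (3 * c * exp (real N) * R)" .
  qed
qed


section \<open>A stationary supersolution\<close>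

lemma Ck_on_cong:
  assumes "open U" and "\<And>x. x \<in> U \<Longrightarrow> g x = h x"
  shows "Ck_on k U g \<longleftrightarrow> Ck_on k U h"
  using assms
proof (induction k arbitrary: g h)
  case 0
  then show ?case by (simp cong: continuous_on_cong)
next
  case (Suc k)
  have der: "(g has_derivative D) (at x) \<longleftrightarrow> (h has_derivative D) (at x)" if "x \<in> U" for D x
    using has_derivative_transform_within_open[OF _ Suc.prems(1) that, of g D UNIV h]
      has_derivative_transform_within_open[OF _ Suc.prems(1) that, of h D UNIV g] Suc.prems(2) by auto
  then have "frechet_derivative g (at x) = frechet_derivative h (at x)" if "x \<in> U" for x
    using that unfolding frechet_derivative_def by simp
  then have "Ck_on k U (\<lambda>x. frechet_derivative g (at x) b) \<longleftrightarrow> Ck_on k U (\<lambda>x. frechet_derivative h (at x) b)" for b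
    by (intro Suc.IH Suc.prems) auto
  moreover have "g differentiable at x \<longleftrightarrow> h differentiable at x" if "x \<in> U" for x
    using der[OF that] unfolding differentiable_def by blast
  ultimately show ?case by simp
qed

text \<open>The ambient extension is the same function of the height, on the open set of points
  whose height lies in \<open>I\<close>.\<close>

lemma smooth_on_subset_zonal:
  fixes pole :: "'a::euclidean_space"
  assumes D: "\<And>k z. z \<in> I \<Longrightarrow> (D k has_real_derivative D (Suc k) z) (at z)" and I: "open I"
    and S: "\<And>x. x \<in> S \<Longrightarrow> x \<bullet> pole \<in> I"
  shows "smooth_on_subset (A \<times> S) (\<lambda>(t :: real, x). D 0 (x \<bullet> pole))"
proof -
  let ?U = "{p :: real \<times> 'a. snd p \<bullet> pole \<in> I}"
  have U: "open ?U"
    using open_vimage[OF I, of "\<lambda>p :: real \<times> 'a. snd p \<bullet> pole"] by (simp add: vimage_def continuous_intros)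
  \<comment> \<open>The constant \<open>c\<close> and the index \<open>j\<close> are general because
    a partial derivative in direction \<open>b\<close> multiplies by
    \<open>snd b \<bullet> pole\<close> and raises the index.\<close>
  have Ck: "Ck_on k ?U (\<lambda>p. c * D j (snd p \<bullet> pole))" for k j c
  proof (induction k arbitrary: j c)
    case 0
    have "continuous_on I (D j)"
      using D by (meson DERIV_isCont continuous_at_imp_continuous_on)
    then show ?case
      by (auto intro!: continuous_intros intro: continuous_on_compose2)
  next
    case (Suc k)
    have der: "((\<lambda>p. c * D j (snd p \<bullet> pole)) has_derivative
        (\<lambda>h. c * ((snd h \<bullet> pole) * D (Suc j) (snd p \<bullet> pole)))) (at p)" if "p \<in> ?U" for p :: "real \<times> 'a"
    proof -
      have "((\<lambda>p :: real \<times> 'a. snd p \<bullet> pole) has_derivative (\<lambda>h. snd h \<bullet> pole)) (at p)"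
        by (auto intro!: derivative_eq_intros)
      from DERIV_compose_FDERIV[OF D this] that
      have "((\<lambda>p. D j (snd p \<bullet> pole)) has_derivative
        (\<lambda>h. (snd h \<bullet> pole) * D (Suc j) (snd p \<bullet> pole))) (at p)" by simp
      then show ?thesis by (rule has_derivative_mult_right)
    qed
    have "Ck_on k ?U (\<lambda>p. frechet_derivative (\<lambda>p. c * D j (snd p \<bullet> pole)) (at p) b)" for b
    proof -
      have "frechet_derivative (\<lambda>p. c * D j (snd p \<bullet> pole)) (at p) b
          = (c * (snd b \<bullet> pole)) * D (Suc j) (snd p \<bullet> pole)" if "p \<in> ?U" for p
        unfolding frechet_derivative_at[OF der[OF that], symmetric] by simp
      then show ?thesis
        using Ck_on_cong[OF U] Suc.IH[of "c * (snd b \<bullet> pole)" "Suc j"] by (metis (no_types, lifting))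
    qed
    moreover have "(\<lambda>p. c * D j (snd p \<bullet> pole)) differentiable (at p)" if "p \<in> ?U" for p
      using der[OF that] unfolding differentiable_def by blast
    ultimately show ?case by simp
  qed
  show ?thesis
    unfolding smooth_on_subset_def
  proof (intro ballI exI conjI allI)
    fix z assume "z \<in> A \<times> S"
    then show "z \<in> ?U" using S by auto
    show "Ck_on k ?U (\<lambda>p. 1 * D 0 (snd p \<bullet> pole))" for k by (rule Ck)
  qed (use U in auto)
qed

text \<open>This is \<open>e\<^bsup>st\<^esup> \<surd>t\<close>; the root makes it a strict supersolution also for \<open>\<lambda> = \<lambda>\<^sup>*\<close>.\<close>

definition super_profile :: "real \<Rightarrow> real \<Rightarrow> real" where
  "super_profile s t = exp (s * t + ln t / 2)"

lemma super_profile_derivs: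
  assumes "t > 0"
  shows "(super_profile s has_real_derivative super_profile s t * (s + 1 / (2 * t))) (at t)"
    and "((\<lambda>t. super_profile s t * (s + 1 / (2 * t))) has_real_derivative
            super_profile s t * (s\<^sup>2 + s / t - 1 / (4 * t\<^sup>2))) (at t)"
proof -
  show 1: "(super_profile s has_real_derivative super_profile s t * (s + 1 / (2 * t))) (at t)"
    unfolding super_profile_def using assms by (auto intro!: derivative_eq_intros simp: field_simps)
  have "((\<lambda>t. s + 1 / (2 * t)) has_real_derivative - (1 / (2 * t\<^sup>2))) (at t)"
    using assms by (auto intro!: derivative_eq_intros simp: power2_eq_square field_simps)
  from DERIV_mult[OF 1 this]
  show "((\<lambda>t. super_profile s t * (s + 1 / (2 * t))) has_real_derivative
            super_profile s t * (s\<^sup>2 + s / t - 1 / (4 * t\<^sup>2))) (at t)"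
    by (rule DERIV_cong) (use assms in \<open>simp add: power2_eq_square field_simps\<close>)
qed

text \<open>Smoothness is inherited from a holomorphic extension to the strip \<open>-1 < Re w < 0\<close>.\<close>

lemma super_profile_smooth:
  obtains D :: "nat \<Rightarrow> real \<Rightarrow> real" where
    "\<And>k z. z \<in> {-1<..<0} \<Longrightarrow> (D k has_real_derivative D (Suc k) z) (at z)"
    and "\<And>z. z \<in> {-1<..<0} \<Longrightarrow> D 0 z = super_profile s (artanh (- z))"
proof -
  define V where "V = {w. -1 < Re w \<and> Re w < 0}"
  define L where "L w = (Ln (1 - w) - Ln (1 + w)) / 2" for w
  define f where "f w = exp (of_real s * L w + Ln (L w) / 2)" for w
  have V: "open V"
    unfolding V_def by (intro open_Collect_conj open_Collect_less continuous_intros)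
  have n1: "1 - w \<notin> \<real>\<^sub>\<le>\<^sub>0" "1 + w \<notin> \<real>\<^sub>\<le>\<^sub>0" if "w \<in> V" for w
    using that by (auto simp: V_def complex_nonpos_Reals_iff)
  \<comment> \<open>\<open>L\<close> continues artanh (- z) analytically. Re w < 0 gives |1 + w| <
    |1 - w|, so Re (L w) > 0 and the logarithm of \<open>L w\<close> stays off its branch
    cut.\<close>
  have n2: "L w \<notin> \<real>\<^sub>\<le>\<^sub>0" if w: "w \<in> V" for w
  proof -
    have nz: "1 - w \<noteq> 0" "1 + w \<noteq> 0" using n1[OF w] by auto
    have "(norm (1 + w))\<^sup>2 < (norm (1 - w))\<^sup>2"
      using w unfolding cmod_power2 by (simp add: V_def power2_eq_square algebra_simps)
    then have "norm (1 + w) < norm (1 - w)" by (rule power_less_imp_less_base) simp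
    then have "ln (norm (1 + w)) < ln (norm (1 - w))" using nz by (subst ln_less_cancel_iff) auto
    then have "0 < Re (L w)" using nz by (simp add: L_def)
    then show ?thesis by (auto simp: complex_nonpos_Reals_iff)
  qed
  have "f holomorphic_on V"
  proof -
    have "L holomorphic_on V"
      unfolding L_def using n1 by (intro holomorphic_intros) auto
    then show ?thesis
      unfolding f_def using n2 by (intro holomorphic_intros) auto
  qed
  then have hol: "(deriv ^^ k) f holomorphic_on V" for k
    by (rule holomorphic_higher_deriv[OF _ V])
  define D where "D k z = Re ((deriv ^^ k) f (of_real z))" for k z
  show ?thesis
  proof (rule that)
    fix k z assume z: "z \<in> {-1<..<(0::real)}"
    then have zV: "of_real z \<in> V" by (simp add: V_def)
    have "((deriv ^^ k) f has_field_derivative (deriv ^^ Suc k) f (of_real z)) (at (of_real z))"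
      using holomorphic_derivI[OF hol V zV] by simp
    then have "((\<lambda>x. (deriv ^^ k) f (of_real x)) has_vector_derivative (deriv ^^ Suc k) f (of_real z)) (at z)"
      by (rule has_vector_derivative_real_field)
    from bounded_linear.has_vector_derivative[OF bounded_linear_Re this]
    show "(D k has_real_derivative D (Suc k) z) (at z)"
      unfolding D_def by (simp add: has_real_derivative_iff_has_vector_derivative)
  next
    fix z assume z: "z \<in> {-1<..<(0::real)}"
    have "Ln (1 - of_real z) = of_real (ln (1 - z))" "Ln (1 + of_real z) = of_real (ln (1 + z))"
      using z Ln_of_real[of "1 - z"] Ln_of_real[of "1 + z"] by auto
    then have Lz: "L (of_real z) = of_real (artanh (- z))"
      using z by (simp add: L_def artanh_def ln_div)
    have "artanh (- z) > 0"
      using z by (simp add: artanh_def ln_div)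
    then have "f (of_real z) = of_real (super_profile s (artanh (- z)))"
      by (simp add: f_def Lz super_profile_def Ln_of_real exp_of_real[symmetric])
    then show "D 0 z = super_profile s (artanh (- z))" by (simp add: D_def)
  qed
qed

text \<open>Divided by cosh^2 and the profile, the linear part is m (1 - tanh t) (s + 1/(2t)) + (s -
  m/2)/t - 1/(4t^2). Its first summand is O(e^(-2t)), and the nonlinear term decays exponentially,
  up to a power of t, because p is below the critical exponent. The summand -1/(4t^2), contributed
  by the root, beats both; for a double root it is the only negative one.\<close>

lemma super_profile_inequality:
  fixes s m lam p \<alpha> :: real
  assumes root: "s\<^sup>2 - m * s + lam = 0" and s: "0 < s" "2 * s \<le> m"
    and p: "1 < p" "s * (p - 1) < \<alpha> + 2"
  shows "\<forall>\<^sub>F t in at_top. (cosh t)\<^sup>2 * (super_profile s t * (s\<^sup>2 + s / t - 1 / (4 * t\<^sup>2))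
           - m * tanh t * (super_profile s t * (s + 1 / (2 * t))) + lam * super_profile s t)
      + cosh t powr (- \<alpha>) * super_profile s t powr p < 0"
proof -
  define \<epsilon> where "\<epsilon> = \<alpha> + 2 - s * (p - 1)"
  have \<epsilon>: "\<epsilon> > 0" using p by (simp add: \<epsilon>_def)
  have "\<forall>\<^sub>F t in at_top. m * (2 * exp (- 2 * t)) * (s + 1 / (2 * t))
     + 2 powr (\<alpha> + 2) * exp (- \<epsilon> * t) * t powr ((p - 1) / 2) < 1 / (4 * t\<^sup>2)"
  proof -
    have "((\<lambda>t. t\<^sup>2 * (m * (2 * exp (- 2 * t)) * (s + 1 / (2 * t)))) \<longlongrightarrow> 0) at_top"
      by real_asymp
    moreover have "((\<lambda>t. t\<^sup>2 * (2 powr (\<alpha> + 2) * exp (- \<epsilon> * t) * t powr ((p - 1) / 2))) \<longlongrightarrow> 0) at_top"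
      using \<epsilon> by real_asymp
    ultimately have ev: "\<forall>\<^sub>F t in at_top. t\<^sup>2 * (m * (2 * exp (- 2 * t)) * (s + 1 / (2 * t))) < 1/8"
      "\<forall>\<^sub>F t in at_top. t\<^sup>2 * (2 powr (\<alpha> + 2) * exp (- \<epsilon> * t) * t powr ((p - 1) / 2)) < 1/8"
      by (auto dest: order_tendstoD(2)[where a = "1/8"])
    have key: "a + b < 1 / (4 * t\<^sup>2)" if "t\<^sup>2 * a < 1/8" "t\<^sup>2 * b < 1/8" "0 < t" for a b t :: real
    proof -
      have "t\<^sup>2 * (a + b) < 1 / 4" using that by (simp add: distrib_left)
      then show ?thesis using that(3) by (simp add: field_simps)
    qed
    show ?thesis
      using ev eventually_gt_at_top[of "0::real"] by eventually_elim (rule key)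
  qed
  then show ?thesis
    using eventually_gt_at_top[of "0::real"]
  proof eventually_elim
    case (elim t)
    define U where "U = super_profile s t"
    have U: "U > 0" by (simp add: U_def super_profile_def)
    define q where "q = s + 1 / (2 * t)"
    have q: "q > 0" using s elim by (simp add: q_def add_pos_pos)
    have c: "cosh t > 0" "exp t / 2 \<le> cosh t" using cosh_real_pos[of t] by (auto simp: cosh_def)
    have "1 - tanh t \<le> 2 * exp (- 2 * t)"
    proof -
      define E where "E = exp (- 2 * t)"
      have E: "E > 0" by (simp add: E_def)
      have "1 - tanh t = 2 * E / (1 + E)"
        unfolding tanh_real_altdef E_def[symmetric] using E by (simp add: field_simps)
      also have "\<dots> \<le> 2 * E / 1" using E by (intro divide_left_mono) auto
      finally show ?thesis by (simp add: E_def)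
    qed
    then have T: "m * (1 - tanh t) * q \<le> m * (2 * exp (- 2 * t)) * q"
      using s q by (intro mult_right_mono mult_left_mono) auto
    have lam: "lam = m * s - s\<^sup>2" using root by simp
    have "(s\<^sup>2 + s / t - 1 / (4 * t\<^sup>2)) - m * tanh t * q + lam
       = m * (1 - tanh t) * q + (s - m / 2) / t - 1 / (4 * t\<^sup>2)"
      by (simp add: lam q_def algebra_simps diff_divide_distrib)
    also have "\<dots> \<le> m * (2 * exp (- 2 * t)) * q - 1 / (4 * t\<^sup>2)"
    proof -
      have "(s - m / 2) / t \<le> 0" using s elim by (intro divide_nonpos_pos) auto
      then show ?thesis using T by linarith
    qed
    finally have 1: "(s\<^sup>2 + s / t - 1 / (4 * t\<^sup>2)) - m * tanh t * q + lam
       \<le> m * (2 * exp (- 2 * t)) * q - 1 / (4 * t\<^sup>2)" .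
    \<comment> \<open>The exponent is negative because \<alpha> + 2 > s (p - 1) > 0, so it is the
      lower bound for cosh that applies.\<close>
    have "cosh t powr (- \<alpha> - 2) \<le> (exp t / 2) powr (- \<alpha> - 2)"
      using c mult_pos_pos[OF s(1), of "p - 1"] p by (intro powr_mono2') auto
    also have "\<dots> = 2 powr (\<alpha> + 2) * exp (- (\<alpha> + 2) * t)"
      by (simp add: powr_def exp_add[symmetric] algebra_simps ln_div)
    finally have "cosh t powr (- \<alpha> - 2) * U powr (p - 1)
      \<le> 2 powr (\<alpha> + 2) * exp (- (\<alpha> + 2) * t) * U powr (p - 1)" by (rule mult_right_mono) simp
    also have Up: "U powr (p - 1) = exp ((p - 1) * s * t) * t powr ((p - 1) / 2)"
      using elim by (simp add: U_def super_profile_def powr_def exp_add[symmetric] algebra_simps)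
    also have "2 powr (\<alpha> + 2) * exp (- (\<alpha> + 2) * t) * (exp ((p - 1) * s * t) * t powr ((p - 1) / 2))
      = 2 powr (\<alpha> + 2) * exp (- \<epsilon> * t) * t powr ((p - 1) / 2)"
      by (simp add: \<epsilon>_def exp_add[symmetric] algebra_simps)
    finally have 2: "cosh t powr (- \<alpha> - 2) * U powr (p - 1) \<le> 2 powr (\<alpha> + 2) * exp (- \<epsilon> * t) * t powr ((p - 1) / 2)"
      unfolding Up .
    have "(s\<^sup>2 + s / t - 1 / (4 * t\<^sup>2)) - m * tanh t * q + lam + cosh t powr (- \<alpha> - 2) * U powr (p - 1) < 0"
      using 1 2 elim unfolding q_def by linarith
    then have neg: "(cosh t)\<^sup>2 * U * ((s\<^sup>2 + s / t - 1 / (4 * t\<^sup>2)) - m * tanh t * q + lam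
        + cosh t powr (- \<alpha> - 2) * U powr (p - 1)) < 0"
      using U c by (simp add: mult_less_0_iff zero_less_mult_iff)
    have 3: "(cosh t)\<^sup>2 * cosh t powr (- \<alpha> - 2) = cosh t powr (- \<alpha>)"
      using c by (simp add: powr_diff)
    have 4: "U * U powr (p - 1) = U powr p"
      using U by (simp add: powr_diff)
    have alg: "c * (U * A - m * T * (U * q) + lam * U) + (c * k) * (U * W)
        = c * U * (A - m * T * q + lam + k * W)" for A T k W c :: real
      by (simp add: algebra_simps)
    show ?case
      unfolding U_def[symmetric] q_def[symmetric] 3[symmetric] 4[symmetric] alg by (rule neg)
  qed
qed


section \<open>The indicial exponent, and existence below the critical power\<close>

lemma lambda_exp_props:
  assumes N: "N \<ge> 3" and lam: "0 < lam" "lam \<le> lambda_star N"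
  defines "s \<equiv> lambda_exp N lam" and "m \<equiv> real N - 2"
  shows "s\<^sup>2 - m * s + lam = 0" and "0 < s" and "2 * s \<le> m" and "m = 2 * s \<longleftrightarrow> lam = lambda_star N"
proof -
  define D where "D = (m / 2)\<^sup>2 - lam"
  have D: "D \<ge> 0" using lam by (simp add: D_def m_def lambda_star_def)
  have s: "s = m / 2 - sqrt D" by (simp add: s_def lambda_exp_def D_def m_def)
  have "s\<^sup>2 - m * s = (sqrt D)\<^sup>2 - (m / 2)\<^sup>2"
    by (simp add: s power2_eq_square algebra_simps)
  then show "s\<^sup>2 - m * s + lam = 0" using D by (simp add: D_def)
  have m: "m > 0" using N by (simp add: m_def)
  have "sqrt D < sqrt ((m / 2)\<^sup>2)" using lam(1) by (intro real_sqrt_less_mono) (simp add: D_def)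
  moreover have "sqrt ((m / 2)\<^sup>2) = m / 2" using m by simp
  ultimately show "0 < s" by (simp add: s)
  show "2 * s \<le> m" using D by (simp add: s)
  have "m = 2 * s \<longleftrightarrow> D = 0" by (simp add: s)
  then show "m = 2 * s \<longleftrightarrow> lam = lambda_star N" by (auto simp: D_def m_def lambda_star_def)
qed

lemma smooth_on_subset_cong:
  assumes "\<And>z. z \<in> M \<Longrightarrow> g z = h z" and "smooth_on_subset M g"
  shows "smooth_on_subset M h"
  unfolding smooth_on_subset_def
proof
  fix z assume "z \<in> M"
  then obtain U k where "open U" "z \<in> U" "\<forall>j. Ck_on j U k" "\<forall>y\<in>U \<inter> M. k y = g y"
    using assms(2) unfolding smooth_on_subset_def by blast
  then show "\<exists>U k. open U \<and> z \<in> U \<and> (\<forall>j. Ck_on j U k) \<and> (\<forall>y\<in>U \<inter> M. k y = h y)"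
    using assms(1) by (intro exI[of _ U] exI[of _ k]) auto
qed

text \<open>\<open>arccos (- tanh T)\<close> is the distance from the pole at which \<tau> equals T,
  so a threshold for \<tau> translates into one for \<delta>.\<close>

lemma lat_gt_on_Omega_bar:
  assumes x: "x \<in> Omega_bar pole \<delta>" and pole: "norm pole = 1"
    and \<delta>: "arccos (- tanh T) < \<delta>" "\<delta> < pi"
  shows "T < lat pole x"
proof -
  have T: "-1 < tanh T" "tanh T < 1" using tanh_real_bounds[of T] by auto
  then have "0 \<le> arccos (- tanh T)" by (intro arccos_lbound) auto
  then interpret cap_domain pole "Omega_bar pole \<delta>"
    using \<delta> by (intro cap_domain_Omega_bar[OF pole]) auto
  note z = S_inner[OF x]
  have "arccos (- tanh T) < arccos (x \<bullet> pole)"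
    using x \<delta> by (auto simp: Omega_bar_def geo_dist_def inner_commute)
  then have "x \<bullet> pole < - tanh T"
    using arccos_less_mono[of "- tanh T" "x \<bullet> pole"] abs_leI[of "- tanh T" 1] abs_leI[of "x \<bullet> pole" 1] T z
    by simp
  then have "tanh T < tanh (lat pole x)" using tanh_lat[OF z] by simp
  then show ?thesis by simp
qed

text \<open>A stationary solution suffices. \<open>u\<close> is the supersolution profile in \<tau>,
  and \<open>f\<close> is defined as the gap in its inequality, so the problem is solved with
  equality and the content lies in f > 0 and in the regularity.\<close>

lemma classical_solution_exists:
  fixes pole :: "'a::euclidean_space"
  assumes N: "N \<ge> 3" "DIM('a) = N + 1" and pole: "norm pole = 1"
    and lam: "0 < lam" "lam \<le> lambda_star N"
    and \<alpha>: "\<alpha> > -2" and p: "1 < p" "p < 1 + (\<alpha> + 2) / lambda_exp N lam"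
  shows "\<exists>b\<in>{0..<pi}. \<forall>\<delta>\<in>{b<..<pi}.
           \<exists>f. continuous_on (Omega_bar pole \<delta>) f \<and> (\<forall>x\<in>Omega_bar pole \<delta>. f x > 0) \<and>
               (\<exists>u. classical_solution pole \<delta> lam \<alpha> p f u)"
proof -
  define s where "s = lambda_exp N lam"
  define m where "m = real N - 2"
  note s = lambda_exp_props[OF N(1) lam, folded s_def m_def]
  have "s * (p - 1) < \<alpha> + 2" using p(2) s(2) by (simp add: s_def[symmetric] field_simps)
  from super_profile_inequality[OF s(1,2,3) p(1) this]
  obtain T0 where T0: "\<And>t. T0 \<le> t \<Longrightarrow> (cosh t)\<^sup>2 * (super_profile s t * (s\<^sup>2 + s / t - 1 / (4 * t\<^sup>2))
           - m * tanh t * (super_profile s t * (s + 1 / (2 * t))) + lam * super_profile s t)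
      + cosh t powr (- \<alpha>) * super_profile s t powr p < 0"
    unfolding eventually_at_top_linorder by blast
  \<comment> \<open>The maximum with 1 keeps \<tau> away from 0, where the logarithm and 1/t are
    singular, and puts the domain into the open hemisphere on which the profile is smooth.\<close>
  define T where "T = max T0 1"
  define U where "U = super_profile s"
  define U1 where "U1 t = super_profile s t * (s + 1 / (2 * t))" for t
  define U2 where "U2 t = super_profile s t * (s\<^sup>2 + s / t - 1 / (4 * t\<^sup>2))" for t
  define F where "F t = - ((cosh t)\<^sup>2 * (U2 t - m * tanh t * U1 t + lam * U t))
      - cosh t powr (- \<alpha>) * U t powr p" for t
  have Upos: "U t > 0" for t by (simp add: U_def super_profile_def)
  have dU: "(U has_real_derivative U1 t) (at t)" "(U1 has_real_derivative U2 t) (at t)" if "t > T" for t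
    using super_profile_derivs[of t s] that unfolding U_def U1_def[abs_def] U2_def T_def by auto
  have cosh0: "cosh t \<noteq> 0" for t :: real using cosh_real_pos[of t] by simp
  have Tb: "-1 < tanh T" "tanh T < 1" using tanh_real_bounds[of T] by auto
  show ?thesis
  proof (intro bexI ballI)
    show "arccos (- tanh T) \<in> {0..<pi}"
      using Tb arccos_lt_bounded[of "- tanh T"] by simp
    fix \<delta> assume \<delta>: "\<delta> \<in> {arccos (- tanh T)<..<pi}"
    then have \<delta>': "0 < \<delta>" "\<delta> < pi" using Tb arccos_lt_bounded[of "- tanh T"] by auto
    interpret B: cap_domain pole "Omega_bar pole \<delta>" by (rule cap_domain_Omega_bar[OF pole \<delta>'])
    interpret O: cap_domain pole "Omega pole \<delta>" by (rule cap_domain_Omega[OF pole \<delta>'])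
    have OB: "x \<in> Omega_bar pole \<delta>" if "x \<in> Omega pole \<delta>" for x
      using that by (auto simp: Omega_def Omega_bar_def)
    have lat: "T < lat pole x" if "x \<in> Omega_bar pole \<delta>" for x
      using lat_gt_on_Omega_bar[OF that pole] \<delta> by auto
    have latc: "continuous_on (Omega_bar pole \<delta>) (lat pole)"
      by (rule B.continuous_on_lat)
    have Uc: "continuous_on (Omega_bar pole \<delta>) (\<lambda>x. U (lat pole x))"
      using lat DERIV_isCont[OF dU(1)]
      by (intro continuous_on_compose2[OF _ latc, of "{T<..}"] continuous_at_imp_continuous_on) auto
    have Fc: "continuous_on (Omega_bar pole \<delta>) (\<lambda>x. F (lat pole x))"
    proof (rule continuous_on_compose2[OF _ latc, of "{T<..}"])
      have "continuous_on {T<..} U" "continuous_on {T<..} U1"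
        using DERIV_isCont[OF dU(1)] DERIV_isCont[OF dU(2)] by (auto intro: continuous_at_imp_continuous_on)
      moreover have "continuous_on {T<..} U2"
        unfolding U2_def U_def[symmetric] using \<open>continuous_on {T<..} U\<close>
        by (intro continuous_intros) (auto simp: T_def)
      ultimately show "continuous_on {T<..} F"
        unfolding F_def using cosh0 Upos by (intro continuous_intros) (auto simp: less_imp_neq[symmetric])
    qed (use lat in auto)
    show "\<exists>f. continuous_on (Omega_bar pole \<delta>) f \<and> (\<forall>x\<in>Omega_bar pole \<delta>. f x > 0) \<and>
               (\<exists>u. classical_solution pole \<delta> lam \<alpha> p f u)"
    proof (intro exI conjI ballI)
      show "continuous_on (Omega_bar pole \<delta>) (\<lambda>x. F (lat pole x))" by (rule Fc)
      fix x assume "x \<in> Omega_bar pole \<delta>"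
      then show "F (lat pole x) > 0"
        using T0[of "lat pole x"] lat[of x] unfolding F_def U_def U1_def U2_def T_def by simp
    next
      obtain D where D: "\<And>k z. z \<in> {-1<..<0} \<Longrightarrow> (D k has_real_derivative D (Suc k) z) (at z)"
        and D0: "\<And>z. z \<in> {-1<..<0} \<Longrightarrow> D 0 z = super_profile s (artanh (- z))"
        by (rule super_profile_smooth) (rule that)
      have zneg: "x \<bullet> pole \<in> {-1<..<0}" if "x \<in> Omega pole \<delta>" for x
      proof -
        have "0 < tanh (lat pole x)" using lat[OF OB[OF that]] by (simp add: T_def)
        then show ?thesis using tanh_lat[OF O.S_inner[OF that]] O.S_inner[OF that] by simp
      qed
      have "smooth_on_subset ({0<..} \<times> Omega pole \<delta>) (\<lambda>(t :: real, x). D 0 (x \<bullet> pole))"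
        by (rule smooth_on_subset_zonal[where I = "{-1<..<0}"]) (use D zneg in auto)
      then have smooth: "smooth_on_subset ({0<..} \<times> Omega pole \<delta>) (\<lambda>(t :: real, x). U (lat pole x))"
        by (rule smooth_on_subset_cong[rotated]) (use D0[OF zneg] in \<open>auto simp: U_def lat_def simp del: artanh_minus_real\<close>)
      show "classical_solution pole \<delta> lam \<alpha> p (\<lambda>x. F (lat pole x)) (\<lambda>t x. U (lat pole x))"
        unfolding classical_solution_def
      proof (intro conjI ballI allI impI)
        show "continuous_on (Q_dom pole \<delta>) (\<lambda>(t, x). U (lat pole x))"
          unfolding Q_dom_def split_beta
          by (rule continuous_on_compose2[OF Uc continuous_on_snd]) (auto intro: continuous_intros)
        fix t :: real and x assume x: "x \<in> Omega pole \<delta>"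
        note z = O.S_inner[OF x]
        have dg: "(U has_real_derivative U1 (lat pole y)) (at (lat pole y))"
          "(U1 has_real_derivative U2 (lat pole y)) (at (lat pole y))" if "y \<in> Omega pole \<delta>" for y
          using dU[OF lat[OF OB[OF that]]] by auto
        have L: "laplace_beltrami (Omega pole \<delta>) (\<lambda>x. U (lat pole x)) x =
           (cosh (lat pole x))\<^sup>2 * (U2 (lat pole x) - m * tanh (lat pole x) * U1 (lat pole x))"
          using O.laplace_beltrami_lat[OF dg(1) dg(2) x] N by (simp add: m_def)
        have sc: "sin (geo_dist pole x) powr \<alpha> = cosh (lat pole x) powr (- \<alpha>)"
          unfolding sin_geo_dist[OF z] by (rule inverse_cosh_powr)
        have sc2: "lam / (sin (geo_dist pole x))\<^sup>2 = lam * (cosh (lat pole x))\<^sup>2"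
          unfolding sin_geo_dist[OF z] by (simp add: power_divide)
        show "deriv (\<lambda>s. U (lat pole x)) t - laplace_beltrami (Omega pole \<delta>) (\<lambda>x. U (lat pole x)) x
          - lam / (sin (geo_dist pole x))\<^sup>2 * U (lat pole x)
          \<ge> sin (geo_dist pole x) powr \<alpha> * \<bar>U (lat pole x)\<bar> powr p + F (lat pole x)"
          unfolding L sc sc2 F_def using Upos[of "lat pole x"] by (simp add: algebra_simps)
      next
        show "smooth_on_subset ({0<..} \<times> Omega pole \<delta>) (\<lambda>(t :: real, x). U (lat pole x))" by (rule smooth)
        show "case q of (t, x) \<Rightarrow> 0 \<le> U (lat pole x)" for q :: "real \<times> 'a"
          using Upos by (auto simp: less_imp_le split: prod.split)
      qed
    qed
  qed
qed


section \<open>Cutoff functions\<close>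

text \<open>At 0 the difference quotient is at most |h|^(n+1), so the formulas on the two sides
  join.\<close>

lemma DERIV_max_zero_power:
  "((\<lambda>x. max 0 x ^ (n + 2)) has_real_derivative real (n + 2) * max 0 x ^ (n + 1)) (at x)"
proof -
  consider "x > 0" | "x < 0" | "x = 0" by linarith
  then show ?thesis
  proof cases
    case 1
    have "((\<lambda>x. x ^ (n + 2)) has_real_derivative real (n + 2) * max 0 x ^ (n + 1)) (at x)"
      using 1 DERIV_pow[of "n + 2" x] by simp
    then show ?thesis
      by (rule has_field_derivative_transform_within_open[of _ _ _ "{0<..}"]) (use 1 in auto)
  next
    case 2
    have "((\<lambda>x. 0) has_real_derivative real (n + 2) * max 0 x ^ (n + 1)) (at x)"
      using 2 by (auto intro!: derivative_eq_intros)
    then show ?thesis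
      by (rule has_field_derivative_transform_within_open[of _ _ _ "{..<0}"]) (use 2 in auto)
  next
    case 3
    have "((\<lambda>h::real. max 0 h ^ (n + 2) / h) \<longlongrightarrow> 0) (at 0)"
    proof (rule Lim_null_comparison)
      show "\<forall>\<^sub>F h in at 0. norm (max 0 h ^ (n + 2) / h) \<le> \<bar>h\<bar> ^ (n + 1)"
      proof (rule always_eventually, rule allI)
        fix h :: real
        show "norm (max 0 h ^ (n + 2) / h) \<le> \<bar>h\<bar> ^ (n + 1)"
        proof (cases "h > 0")
          case False
          then have m: "max 0 h = 0" by simp
          show ?thesis unfolding m by simp
        qed (simp add: power_abs)
      qed
      show "((\<lambda>h::real. \<bar>h\<bar> ^ (n + 1)) \<longlongrightarrow> 0) (at 0)"
        by (auto intro!: tendsto_eq_intros)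
    qed
    then show ?thesis using 3 by (simp add: has_field_derivative_iff)
  qed
qed

text \<open>On [0,1] smaller exponents give larger powers. The base 0 is where \<open>0 < j\<close>
  enters: \<open>0 powr r\<close> is 0, whereas 0^0 would be 1.\<close>

lemma power_le_powr_of_le:
  fixes P :: real
  assumes P: "0 \<le> P" "P \<le> 1" and kj: "real k * r \<le> real j" "0 < j" "0 \<le> r"
  shows "P ^ j \<le> (P ^ k) powr r"
proof (cases "P = 0")
  case False
  then have "P > 0" using P by simp
  have "P ^ j = P powr real j" using \<open>P > 0\<close> by (simp add: powr_realpow)
  also have "\<dots> \<le> P powr (real k * r)"
    using P kj by (intro powr_mono') auto
  also have "\<dots> = (P ^ k) powr r"
    using \<open>P > 0\<close> by (simp add: powr_realpow[symmetric] powr_powr)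
  finally show ?thesis .
qed (use kj in \<open>simp add: zero_power\<close>)

text \<open>
  The cutoffs are high powers, so that their derivatives are dominated by their \<open>1/p\<close>-th powers,
  as the absorption by Young's inequality requires.
\<close>

lemma exists_cutoff_power:
  assumes p: "(p::real) > 1"
  obtains n :: nat where "real (n + 3) * (1 / p) \<le> real (n + 1)"
proof -
  \<comment> \<open>The cutoffs are powers P^(n+3), whose second derivative involves P^(n+1), so n +
    3 <= p (n + 1) is required. This amounts to n (p - 1) >= 3 - p, and 2p >= 3 - p.\<close>
  obtain n :: nat where n: "real n \<ge> 2 * p / (p - 1)" using real_arch_simple by blast
  then have "real n * (p - 1) \<ge> 2 * p" using p by (simp add: field_simps)
  then have "real n + 3 \<le> p * (real n + 1)" using p by (simp add: algebra_simps)
  then show ?thesis using p by (intro that[of n]) (simp add: field_simps)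
qed

text \<open>A high power of the positive part of (t - 1)(2 - t). The lower bound \<open>e0\<close>
  on the middle half of the support later keeps the contribution of f proportional to T.\<close>

lemma time_cutoff:
  assumes p: "(p::real) > 1"
  obtains E E1 :: "real \<Rightarrow> real" and c e0 :: real where "c > 0" "e0 > 0"
    and "\<And>t. (E has_real_derivative E1 t) (at t)" and "continuous_on UNIV E1"
    and "\<And>t. 0 \<le> E t" and "\<And>t. E t \<le> 1"
    and "\<And>t. t \<notin> {1..2} \<Longrightarrow> E t = 0" and "\<And>t. t \<notin> {1..2} \<Longrightarrow> E1 t = 0"
    and "\<And>t. \<bar>E1 t\<bar> \<le> c * E t powr (1 / p)"
    and "\<And>t. t \<in> {5/4..7/4} \<Longrightarrow> e0 \<le> E t"
proof -
  obtain n where n: "real (n + 3) * (1 / p) \<le> real (n + 1)" by (rule exists_cutoff_power[OF p])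
  define v :: "real \<Rightarrow> real" where "v t = (t - 1) * (2 - t)" for t
  define P where "P t = max 0 (v t)" for t
  define E where "E t = P t ^ (n + 3)" for t
  define E1 where "E1 t = real (n + 3) * P t ^ (n + 2) * (3 - 2 * t)" for t
  have v1: "v t \<le> 1" for t
  proof -
    have "0 \<le> (t - 3/2)\<^sup>2" by simp
    then show ?thesis by (simp add: v_def power2_eq_square algebra_simps)
  qed
  have P: "0 \<le> P t" "P t \<le> 1" for t using v1[of t] by (auto simp: P_def)
  have vneg: "v t \<le> 0" if "t \<notin> {1..2}" for t
    using that by (auto simp: v_def mult_le_0_iff)
  then have P0: "P t = 0" if "t \<notin> {1..2}" for t unfolding P_def using that by (intro max_absorb1)
  show ?thesis
  proof (rule that)
    show "(E has_real_derivative E1 t) (at t)" for t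
    proof -
      have "(v has_real_derivative 3 - 2 * t) (at t)"
        unfolding v_def by (auto intro!: derivative_eq_intros)
      from DERIV_chain2[OF DERIV_max_zero_power[of "n + 1"] this]
      moreover have "n + 1 + 2 = n + 3" "n + 1 + 1 = n + 2" by simp_all
      ultimately show ?thesis by (simp only: E_def[abs_def] E1_def P_def)
    qed
    show "continuous_on UNIV E1"
      unfolding E1_def P_def v_def by (intro continuous_intros)
    show "0 \<le> E t" "E t \<le> 1" for t
      using P by (auto simp: E_def power_le_one)
    show "E t = 0" "E1 t = 0" if "t \<notin> {1..2}" for t
      using P0[OF that] by (auto simp: E_def E1_def)
    show "real (n + 3) > 0" by simp
    show "\<bar>E1 t\<bar> \<le> real (n + 3) * E t powr (1 / p)" for t
    proof (cases "t \<in> {1..2}")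
      case True
      then have a: "\<bar>3 - 2 * t\<bar> \<le> 1" by auto
      have "P t ^ (n + 2) * \<bar>3 - 2 * t\<bar> \<le> P t ^ (n + 2) * 1"
        using a P by (intro mult_left_mono) auto
      also have "P t ^ (n + 2) \<le> (P t ^ (n + 3)) powr (1 / p)"
        using n P p by (intro power_le_powr_of_le) auto
      finally have "P t ^ (n + 2) * \<bar>3 - 2 * t\<bar> \<le> E t powr (1 / p)" by (simp add: E_def)
      then have "real (n + 3) * (P t ^ (n + 2) * \<bar>3 - 2 * t\<bar>) \<le> real (n + 3) * E t powr (1 / p)"
        by (rule mult_left_mono) simp
      then show ?thesis using P by (simp add: E1_def abs_mult mult.assoc)
    qed (simp add: E1_def P0)
    \<comment> \<open>3/16 is the value of (t - 1)(2 - t) at both endpoints 5/4 and 7/4.\<close>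
    show "(3 / 16) ^ (n + 3) > (0::real)" by simp
    show "(3 / 16) ^ (n + 3) \<le> E t" if t: "t \<in> {5/4..7/4}" for t
    proof -
      have "0 \<le> (t - 5/4) * (7/4 - t)" using t by auto
      then have "3 / 16 \<le> v t" by (simp add: v_def algebra_simps)
      then show ?thesis unfolding E_def P_def by (intro power_mono) auto
    qed
  qed
qed

text \<open>A high power of the positive part of 1 - q^3, where q is the positive part of y - 1. The
  cube gives two continuous derivatives at y = 1, the outer power gives them at y = 2.\<close>

lemma space_cutoff:
  assumes p: "(p::real) > 1"
  obtains \<eta> \<eta>1 \<eta>2 :: "real \<Rightarrow> real" and c :: real where "c > 0"
    and "\<And>y. (\<eta> has_real_derivative \<eta>1 y) (at y)" and "\<And>y. (\<eta>1 has_real_derivative \<eta>2 y) (at y)"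
    and "continuous_on UNIV \<eta>2"
    and "\<And>y. 0 \<le> \<eta> y" and "\<And>y. \<eta> y \<le> 1"
    and "\<And>y. y \<le> 1 \<Longrightarrow> \<eta> y = 1" and "\<And>y. y \<ge> 2 \<Longrightarrow> \<eta> y = 0"
    and "\<And>y. y \<le> 1 \<or> 2 \<le> y \<Longrightarrow> \<eta>1 y = 0" and "\<And>y. y \<le> 1 \<or> 2 \<le> y \<Longrightarrow> \<eta>2 y = 0"
    and "\<And>y. \<bar>\<eta>1 y\<bar> \<le> c * \<eta> y powr (1 / p)" and "\<And>y. \<bar>\<eta>2 y\<bar> \<le> c * \<eta> y powr (1 / p)"
proof -
  obtain n where n: "real (n + 3) * (1 / p) \<le> real (n + 1)" by (rule exists_cutoff_power[OF p])
  define q :: "real \<Rightarrow> real" where "q y = max 0 (y - 1)" for y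
  define P where "P y = max 0 (1 - q y ^ 3)" for y
  define k where "k = real (n + 3)"
  define \<eta> where "\<eta> y = P y ^ (n + 3)" for y
  define \<eta>1 where "\<eta>1 y = k * P y ^ (n + 2) * (- 3 * q y ^ 2)" for y
  define \<eta>2 where "\<eta>2 y = k * (real (n + 2) * P y ^ (n + 1) * (- 3 * q y ^ 2) * (- 3 * q y ^ 2)
       + P y ^ (n + 2) * (- 6 * q y))" for y
  have k: "k > 0" by (simp add: k_def)
  have q0: "0 \<le> q y" for y by (simp add: q_def)
  have P: "0 \<le> P y" "P y \<le> 1" for y using q0[of y] by (auto simp: P_def)
  have far: "P y = 0" if "y \<ge> 2" for y
  proof -
    have "1 \<le> q y ^ 3" using that by (intro one_le_power) (simp add: q_def)
    then show ?thesis by (simp add: P_def)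
  qed
  have near: "q y = 0" "P y = 1" if "y \<le> 1" for y using that by (auto simp: P_def q_def)
  have dq: "((\<lambda>y. q y ^ (j + 2)) has_real_derivative real (j + 2) * q y ^ (j + 1)) (at y)" for j y
  proof -
    have "((\<lambda>y. y - 1) has_real_derivative 1) (at y)" by (auto intro!: derivative_eq_intros)
    from DERIV_chain2[OF DERIV_max_zero_power[of j] this] show ?thesis by (simp add: q_def)
  qed
  have d3: "((\<lambda>y. 1 - q y ^ 3) has_real_derivative - 3 * q y ^ 2) (at y)" for y
    using DERIV_diff[OF DERIV_const dq[of 1], of 1 y] by (simp add: numeral_eq_Suc)
  have d2: "((\<lambda>y. - 3 * q y ^ 2) has_real_derivative - 6 * q y) (at y)" for y
    using DERIV_cmult[OF dq[of 0], of "-3" y] by (simp add: numeral_eq_Suc)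
  have dP: "((\<lambda>y. P y ^ (j + 2)) has_real_derivative real (j + 2) * P y ^ (j + 1) * (- 3 * q y ^ 2)) (at y)" for j y
    using DERIV_chain2[OF DERIV_max_zero_power[of j] d3] by (simp add: P_def)
  have key: "P y ^ j \<le> \<eta> y powr (1 / p)" if "n + 1 \<le> j" for y j
    unfolding \<eta>_def using n P p that by (intro power_le_powr_of_le) auto
  have q1: "q y \<le> 1" if "y < 2" for y using that by (simp add: q_def)
  show ?thesis
  proof (rule that)
    show "(\<eta> has_real_derivative \<eta>1 y) (at y)" for y
    proof -
      have "n + 1 + 2 = n + 3" "n + 1 + 1 = n + 2" by simp_all
      then show ?thesis using dP[of "n + 1" y] by (simp only: \<eta>_def[abs_def] \<eta>1_def k_def)
    qed
    show "(\<eta>1 has_real_derivative \<eta>2 y) (at y)" for y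
      using DERIV_cmult[OF DERIV_mult'[OF dP[of n y] d2[of y]], of k]
      by (simp add: \<eta>1_def[abs_def] \<eta>2_def algebra_simps)
    show "continuous_on UNIV \<eta>2"
      unfolding \<eta>2_def P_def q_def by (intro continuous_intros)
    show "0 \<le> \<eta> y" "\<eta> y \<le> 1" for y using P by (auto simp: \<eta>_def power_le_one)
    show "\<eta> y = 1" if "y \<le> 1" for y using near[OF that] by (simp add: \<eta>_def)
    show "\<eta> y = 0" if "y \<ge> 2" for y using far[OF that] by (simp add: \<eta>_def)
    show "\<eta>1 y = 0" if "y \<le> 1 \<or> 2 \<le> y" for y using that near far by (auto simp: \<eta>1_def)
    show "\<eta>2 y = 0" if "y \<le> 1 \<or> 2 \<le> y" for y using that near far by (auto simp: \<eta>2_def)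
    \<comment> \<open>Where \<open>P\<close> and \<open>q\<close> are at most 1, the second
      derivative is at most this constant times P^(n+1): 9 (n + 2) comes from the squared inner
      derivative 3 q^2, and 6 from its own derivative 6 q.\<close>
    show "k * (9 * real (n + 2) + 6) > 0" using k by simp
    show "\<bar>\<eta>1 y\<bar> \<le> k * (9 * real (n + 2) + 6) * \<eta> y powr (1 / p)" for y
    proof (cases "y < 2")
      case True
      have "P y ^ (n + 2) * (3 * q y ^ 2) \<le> \<eta> y powr (1 / p) * (3 * 1)"
        using key[of "n + 2" y] P[of y] q0[of y] q1[OF True] by (intro mult_mono power_le_one) auto
      also have "\<dots> \<le> \<eta> y powr (1 / p) * (9 * real (n + 2) + 6)" by (intro mult_left_mono) auto
      finally have "k * (P y ^ (n + 2) * (3 * q y ^ 2)) \<le> k * (\<eta> y powr (1 / p) * (9 * real (n + 2) + 6))"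
        using k by (intro mult_left_mono) auto
      then show ?thesis using P[of y] k by (simp add: \<eta>1_def abs_mult mult_ac)
    qed (use far k in \<open>simp add: \<eta>1_def\<close>)
    show "\<bar>\<eta>2 y\<bar> \<le> k * (9 * real (n + 2) + 6) * \<eta> y powr (1 / p)" for y
    proof (cases "y < 2")
      case True
      have 1: "P y ^ (n + 1) * (q y ^ 2 * q y ^ 2) \<le> \<eta> y powr (1 / p) * (1 * 1)"
        using key[of "n + 1" y] P[of y] q0[of y] q1[OF True] by (intro mult_mono power_le_one) auto
      have 2: "P y ^ (n + 2) * q y \<le> \<eta> y powr (1 / p) * 1"
        using key[of "n + 2" y] P[of y] q0[of y] q1[OF True] by (intro mult_mono) auto
      have "\<eta>2 y = k * (9 * real (n + 2) * (P y ^ (n + 1) * (q y ^ 2 * q y ^ 2)) - 6 * (P y ^ (n + 2) * q y))"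
        by (simp add: \<eta>2_def algebra_simps)
      then have "\<bar>\<eta>2 y\<bar> = k * \<bar>9 * real (n + 2) * (P y ^ (n + 1) * (q y ^ 2 * q y ^ 2)) - 6 * (P y ^ (n + 2) * q y)\<bar>"
        by (simp only: abs_mult abs_of_pos[OF k])
      also have "\<dots> \<le> k * (9 * real (n + 2) * (P y ^ (n + 1) * (q y ^ 2 * q y ^ 2)) + 6 * (P y ^ (n + 2) * q y))"
        using k P[of y] q0[of y] by (intro mult_left_mono abs_triangle_ineq4[THEN order_trans]) (auto simp: abs_mult)
      also have "\<dots> \<le> k * (9 * real (n + 2) * \<eta> y powr (1 / p) + 6 * \<eta> y powr (1 / p))"
        using 1 2 k by (intro mult_left_mono add_mono) auto
      finally show ?thesis by (simp add: algebra_simps)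
    qed (use far k in \<open>simp add: \<eta>2_def\<close>)
  qed
qed


section \<open>Zonal test functions\<close>

lemma Omega_bar_iff:
  assumes pole: "norm pole = 1" and \<delta>: "0 < \<delta>" "\<delta> < pi"
  shows "x \<in> Omega_bar pole \<delta> \<longleftrightarrow> norm x = 1 \<and> -1 < x \<bullet> pole \<and> x \<bullet> pole \<le> cos \<delta>"
    and "x \<in> Gamma_bd pole \<delta> \<longleftrightarrow> norm x = 1 \<and> x \<bullet> pole = cos \<delta>"
proof -
  have le1: "\<bar>x \<bullet> pole\<bar> \<le> 1" if "norm x = 1"
    using Cauchy_Schwarz_ineq2[of x pole] that pole by simp
  have c: "arccos (cos \<delta>) = \<delta>" using \<delta> by (simp add: arccos_cos)
  have "\<delta> \<le> geo_dist pole x \<longleftrightarrow> x \<bullet> pole \<le> cos \<delta>" "geo_dist pole x < pi \<longleftrightarrow> -1 < x \<bullet> pole"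
    "geo_dist pole x = \<delta> \<longleftrightarrow> x \<bullet> pole = cos \<delta>" if "norm x = 1"
  proof -
    show "\<delta> \<le> geo_dist pole x \<longleftrightarrow> x \<bullet> pole \<le> cos \<delta>"
      using arccos_le_mono[of "cos \<delta>" "x \<bullet> pole"] le1[OF that] c by (simp add: geo_dist_def inner_commute)
    show "geo_dist pole x < pi \<longleftrightarrow> -1 < x \<bullet> pole"
      using arccos_less_mono[of "x \<bullet> pole" "-1"] le1[OF that] by (simp add: geo_dist_def inner_commute)
    show "geo_dist pole x = \<delta> \<longleftrightarrow> x \<bullet> pole = cos \<delta>"
      using le1[OF that] c cos_arccos_abs[of "x \<bullet> pole"] by (auto simp: geo_dist_def inner_commute)
  qed
  then show "x \<in> Omega_bar pole \<delta> \<longleftrightarrow> norm x = 1 \<and> -1 < x \<bullet> pole \<and> x \<bullet> pole \<le> cos \<delta>"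
    "x \<in> Gamma_bd pole \<delta> \<longleftrightarrow> norm x = 1 \<and> x \<bullet> pole = cos \<delta>"
    by (auto simp: Omega_bar_def Gamma_bd_def)
qed

text \<open>The gradient of arccos z is - cosh \<tau> times the tangential part of the pole, and the
  two minus signs cancel: the outward normal points towards the pole. The gradient is taken on the
  whole sphere, to which uniqueness of the differential applies as well.\<close>

lemma outer_normal_eq:
  fixes pole x :: "'a::euclidean_space"
  assumes pole: "norm pole = 1" and x: "norm x = 1" and z: "-1 < x \<bullet> pole" "x \<bullet> pole < 1"
  shows "outer_normal pole x = cosh (lat pole x) *\<^sub>R (pole - (x \<bullet> pole) *\<^sub>R x)"
proof -
  have sq: "sqrt (1 - (x \<bullet> pole)\<^sup>2) = 1 / cosh (lat pole x)"
    unfolding cosh_lat[OF z] by (simp add: real_sqrt_divide)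
  have "(arccos has_real_derivative - cosh (lat pole x)) (at (x \<bullet> pole))"
    using DERIV_arccos[OF z] by (simp add: sq)
  moreover have "((\<lambda>y. y \<bullet> pole) has_derivative (\<lambda>h. h \<bullet> pole)) (at x within sphere 0 1)"
    by (auto intro!: derivative_eq_intros)
  ultimately have "((\<lambda>y. arccos (y \<bullet> pole)) has_derivative (\<lambda>h. (h \<bullet> pole) * - cosh (lat pole x))) (at x within sphere 0 1)"
    by (rule DERIV_compose_FDERIV)
  then have "(geo_dist pole has_derivative (\<lambda>h. (h \<bullet> pole) * - cosh (lat pole x))) (at x within sphere 0 1)"
    by (simp add: geo_dist_def[abs_def] inner_commute)
  from has_derivative_tangential[OF this order.refl] x
  have D: "has_sph_derivative (geo_dist pole)
     (\<lambda>h. ((h - (x \<bullet> h) *\<^sub>R x) \<bullet> pole) * - cosh (lat pole x)) (sphere 0 1) x" by simp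
  have "has_sph_derivative (geo_dist pole) (sph_derivative (geo_dist pole) (sphere 0 1) x) (sphere 0 1) x"
    unfolding sph_derivative_def by (rule someI[of "\<lambda>D. has_sph_derivative (geo_dist pole) D (sphere 0 1) x"]) (rule D)
  then have "sph_derivative (geo_dist pole) (sphere 0 1) x =
     (\<lambda>h. ((h - (x \<bullet> h) *\<^sub>R x) \<bullet> pole) * - cosh (lat pole x))"
    using has_sph_derivative_unique[OF x pole z _ _ D] by blast
  then have "outer_normal pole x = - (\<Sum>b\<in>Basis. (((b - (x \<bullet> b) *\<^sub>R x) \<bullet> pole) * - cosh (lat pole x)) *\<^sub>R b)"
    unfolding outer_normal_def sph_grad_def by (simp only:)
  also have "\<dots> = (\<Sum>b\<in>Basis. ((cosh (lat pole x) *\<^sub>R (pole - (x \<bullet> pole) *\<^sub>R x)) \<bullet> b) *\<^sub>R b)"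
    unfolding sum_negf[symmetric]
    by (rule sum.cong) (simp_all add: inner_diff_left inner_commute algebra_simps flip: scaleR_minus_left)
  finally show ?thesis by (simp only: euclidean_representation)
qed

text \<open>Derivatives of \<open>g\<close> are two-sided even at the boundary value artanh (- cos
  \<delta>), so no one-sided calculus in \<tau> arises. \<open>T\<close> is the time scale, and
  \<open>b\<close> is the end of the spatial support.\<close>

locale zonal_test =
  fixes pole :: "'a::euclidean_space" and \<delta> T b :: real and E E1 g g1 g2 :: "real \<Rightarrow> real"
  assumes pole: "norm pole = 1" and \<delta>: "0 < \<delta>" "\<delta> < pi" and T: "0 < T"
    and E: "\<And>t. (E has_real_derivative E1 t) (at t)" "continuous_on UNIV E1" "\<And>t. 0 \<le> E t"
      "\<And>t. t \<notin> {1..2} \<Longrightarrow> E t = 0"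
    and g: "\<And>t. artanh (- cos \<delta>) \<le> t \<Longrightarrow> (g has_real_derivative g1 t) (at t)"
      "\<And>t. artanh (- cos \<delta>) \<le> t \<Longrightarrow> (g1 has_real_derivative g2 t) (at t)"
      "continuous_on {artanh (- cos \<delta>)..} g2"
    and g_nonneg: "\<And>t. artanh (- cos \<delta>) \<le> t \<Longrightarrow> 0 \<le> g t"
    and g_bd: "g (artanh (- cos \<delta>)) = 0" "0 \<le> g1 (artanh (- cos \<delta>))"
    and g_far: "\<And>t. b \<le> t \<Longrightarrow> g t = 0"
begin

definition \<xi> :: "real \<Rightarrow> 'a \<Rightarrow> real" where
  "\<xi> t x = E (t / T) * g (lat pole x)"

abbreviation "S \<equiv> Omega_bar pole \<delta>"
abbreviation "\<tau>0 \<equiv> artanh (- cos \<delta>)"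

sublocale cap_domain pole S
  using pole \<delta> by (rule cap_domain_Omega_bar)

lemma cos_delta: "-1 < cos \<delta>" "cos \<delta> < 1"
  using \<delta> cos_monotone_0_pi[of \<delta> pi] cos_monotone_0_pi[of 0 \<delta>] by auto

lemma lat_ge: "x \<in> S \<Longrightarrow> \<tau>0 \<le> lat pole x"
proof -
  assume x: "x \<in> S"
  have "tanh \<tau>0 = - cos \<delta>" using cos_delta by (intro tanh_artanh) auto
  then have "tanh \<tau>0 \<le> tanh (lat pole x)"
    using x tanh_lat[OF S_inner[OF x]] by (simp add: Omega_bar_iff[OF pole \<delta>])
  then show ?thesis by simp
qed

lemma lat_Gamma: "x \<in> Gamma_bd pole \<delta> \<Longrightarrow> x \<in> S \<and> lat pole x = \<tau>0"
  using cos_delta by (simp add: Omega_bar_iff[OF pole \<delta>] lat_def)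

lemma gE: "x \<in> S \<Longrightarrow> ((\<lambda>s. E (t / T) * g s) has_real_derivative E (t / T) * g1 (lat pole x)) (at (lat pole x))"
  "x \<in> S \<Longrightarrow> ((\<lambda>s. E (t / T) * g1 s) has_real_derivative E (t / T) * g2 (lat pole x)) (at (lat pole x))"
  using g(1,2)[OF lat_ge] by (auto intro!: DERIV_cmult)

lemma deriv_\<xi>: "((\<lambda>s. \<xi> s x) has_real_derivative E1 (t / T) / T * g (lat pole x)) (at t)"
proof -
  have "((\<lambda>s. s / T) has_real_derivative 1 / T) (at t)"
    using T by (auto intro!: derivative_eq_intros)
  from DERIV_cmult_right[OF DERIV_chain2[OF E(1) this], of "g (lat pole x)"]
  show ?thesis by (simp add: \<xi>_def)
qed

lemma sph_grad_\<xi>: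
  assumes x: "x \<in> S"
  shows "sph_grad S (\<xi> t) x
     = - (E (t / T) * g1 (lat pole x) * (cosh (lat pole x))\<^sup>2) *\<^sub>R (pole - (x \<bullet> pole) *\<^sub>R x)"
  using sph_grad_lat[OF x gE(1)[OF x]] by (simp add: \<xi>_def[abs_def])

lemma laplace_\<xi>:
  assumes x: "x \<in> S"
  shows "laplace_beltrami S (\<xi> t) x = E (t / T) *
     ((cosh (lat pole x))\<^sup>2 * (g2 (lat pole x) - (real DIM('a) - 3) * tanh (lat pole x) * g1 (lat pole x)))"
  using laplace_beltrami_lat[OF gE(1) gE(2) x, of t] by (simp add: \<xi>_def[abs_def] algebra_simps)

lemma continuous_lat_comp:
  assumes "continuous_on {\<tau>0..} k"
  shows "continuous_on (A \<times> S) (\<lambda>p. k (lat pole (snd p)))"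
proof -
  have "continuous_on S (\<lambda>x. k (lat pole x))"
    using lat_ge by (intro continuous_on_compose2[OF assms continuous_on_lat]) auto
  then show ?thesis by (rule continuous_on_compose2[OF _ continuous_on_snd]) (auto intro: continuous_intros)
qed

lemma continuous_g: "continuous_on {\<tau>0..} g" "continuous_on {\<tau>0..} g1"
  using DERIV_isCont[OF g(1)] DERIV_isCont[OF g(2)] by (auto intro!: continuous_at_imp_continuous_on)

lemma continuous_E: "continuous_on A (\<lambda>p. E (fst p / T))" "continuous_on A (\<lambda>p. E1 (fst p / T))"
proof -
  have "continuous_on UNIV E" using DERIV_isCont[OF E(1)] by (auto intro!: continuous_at_imp_continuous_on)
  then show "continuous_on A (\<lambda>p. E (fst p / T))"
    by (rule continuous_on_compose2) (auto intro!: continuous_intros simp: T less_imp_neq[symmetric])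
  show "continuous_on A (\<lambda>p. E1 (fst p / T))"
    by (rule continuous_on_compose2[OF E(2)]) (auto intro!: continuous_intros simp: T less_imp_neq[symmetric])
qed

lemmas cosh_cont = continuous_lat_comp[OF continuous_on_cosh[OF continuous_on_id]]

lemma tanh_cont: "continuous_on (A \<times> S) (\<lambda>p. tanh (lat pole (snd p)))"
  by (rule continuous_lat_comp) (auto intro!: continuous_intros)

lemma C12_\<xi>: "C12_on S \<xi>"
proof -
  let ?A = "{0<..} \<times> S :: (real \<times> 'a) set"
  have 0: "continuous_on ?A (\<lambda>(t, x). \<xi> t x)"
    unfolding \<xi>_def split_beta by (intro continuous_intros continuous_E continuous_lat_comp continuous_g)
  have d: "deriv (\<lambda>s. \<xi> s x) t = E1 (t / T) / T * g (lat pole x)" for t x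
    by (rule DERIV_imp_deriv[OF deriv_\<xi>])
  have 1: "continuous_on ?A (\<lambda>(t, x). deriv (\<lambda>s. \<xi> s x) t)"
    unfolding d split_beta using T by (intro continuous_intros continuous_E continuous_lat_comp continuous_g) auto
  have "continuous_on ?A (\<lambda>p. - (E (fst p / T) * g1 (lat pole (snd p)) * (cosh (lat pole (snd p)))\<^sup>2) *\<^sub>R (pole - (snd p \<bullet> pole) *\<^sub>R snd p))"
    by (intro continuous_intros continuous_E continuous_lat_comp continuous_g cosh_cont)
  then have 2: "continuous_on ?A (\<lambda>(t, x). sph_grad S (\<xi> t) x)"
    by (rule continuous_on_eq) (auto simp: sph_grad_\<xi>)
  have 3: "sph_differentiable (\<xi> t) S x" if "x \<in> S" for t x
    using sph_differentiable_lat[OF that gE(1)[OF that, of t]] by (simp add: \<xi>_def[abs_def])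
  have 4: "sph_differentiable (sph_grad S (\<xi> t)) S x" if "x \<in> S" for t x
    using sph_differentiable_grad_lat[OF gE(1) gE(2) that, of t] by (simp add: \<xi>_def[abs_def])
  have 5: "continuous_on ?A (\<lambda>(t, x). sph_derivative (sph_grad S (\<xi> t)) S x h)" for h
  proof -
    let ?w = "\<lambda>p. pole - (snd p \<bullet> pole) *\<^sub>R snd p"
    have "continuous_on ?A (\<lambda>p :: real \<times> 'a. ((cosh (lat pole (snd p)))^4 *
        (E (fst p / T) * g2 (lat pole (snd p)) + 2 * tanh (lat pole (snd p)) * (E (fst p / T) * g1 (lat pole (snd p)))) * (h \<bullet> ?w p)) *\<^sub>R ?w p
       - (- (E (fst p / T) * g1 (lat pole (snd p)) * (cosh (lat pole (snd p)))\<^sup>2)) *\<^sub>R ((h \<bullet> ?w p) *\<^sub>R snd p + (snd p \<bullet> pole) *\<^sub>R (h - (snd p \<bullet> h) *\<^sub>R snd p)))"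
      by (intro continuous_intros continuous_E continuous_lat_comp continuous_g g(3) cosh_cont tanh_cont)
    then show ?thesis
    proof (rule continuous_on_eq)
      fix p assume "p \<in> ?A"
      then obtain t x where p: "p = (t, x)" "x \<in> S" by auto
      show "((cosh (lat pole (snd p)))^4 *
        (E (fst p / T) * g2 (lat pole (snd p)) + 2 * tanh (lat pole (snd p)) * (E (fst p / T) * g1 (lat pole (snd p)))) * (h \<bullet> ?w p)) *\<^sub>R ?w p
       - (- (E (fst p / T) * g1 (lat pole (snd p)) * (cosh (lat pole (snd p)))\<^sup>2)) *\<^sub>R ((h \<bullet> ?w p) *\<^sub>R snd p + (snd p \<bullet> pole) *\<^sub>R (h - (snd p \<bullet> h) *\<^sub>R snd p))
       = (case p of (t, x) \<Rightarrow> sph_derivative (sph_grad S (\<xi> t)) S x h)"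
        using sph_derivative_grad_lat[OF gE(1) gE(2) p(2), of t] unfolding p(1) by (simp add: \<xi>_def[abs_def])
    qed
  qed
  have 6: "(\<lambda>s. \<xi> s x) differentiable (at t)" for t x
    using deriv_\<xi> unfolding real_differentiable_def by blast
  show ?thesis
    unfolding C12_on_def using 0 1 2 3 4 5 6 by auto
qed

text \<open>\<open>- tanh b \<le> x \<bullet> pole\<close> is \<tau> <= b written in the height; in
  this form the set is visibly closed in the ambient space and stays away from the antipode.\<close>

definition "K = {T..2 * T} \<times> {x. norm x = 1 \<and> - tanh b \<le> x \<bullet> pole \<and> x \<bullet> pole \<le> cos \<delta>}"

lemma compact_K: "compact K"
proof -
  have "{x. norm x = 1 \<and> - tanh b \<le> x \<bullet> pole \<and> x \<bullet> pole \<le> cos \<delta>}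
    = sphere 0 1 \<inter> {x. - tanh b \<le> x \<bullet> pole \<and> x \<bullet> pole \<le> cos \<delta>}" by auto
  moreover have "closed {x. - tanh b \<le> x \<bullet> pole \<and> x \<bullet> pole \<le> cos \<delta>}"
    by (intro closed_Collect_conj closed_Collect_le continuous_intros)
  ultimately have "compact {x. norm x = 1 \<and> - tanh b \<le> x \<bullet> pole \<and> x \<bullet> pole \<le> cos \<delta>}"
    using compact_Int_closed[OF compact_sphere] by metis
  then show ?thesis unfolding K_def by (intro compact_Times) auto
qed

lemma K_subset: "K \<subseteq> Q_dom pole \<delta>"
  using tanh_real_bounds[of b] T unfolding K_def Q_dom_def by (auto simp: Omega_bar_iff[OF pole \<delta>])

lemma outside_K:
  assumes "x \<in> S" "(t, x) \<notin> K"
  shows "t / T \<notin> {1..2} \<or> b < lat pole x"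
proof (rule ccontr)
  assume n: "\<not> ?thesis"
  then have "t \<in> {T..2 * T}" using T by (auto simp: field_simps)
  moreover have "tanh (lat pole x) \<le> tanh b" using n by simp
  then have "- tanh b \<le> x \<bullet> pole" using tanh_lat[OF S_inner[OF assms(1)]] by linarith
  ultimately show False using assms by (auto simp: K_def Omega_bar_iff[OF pole \<delta>])
qed

lemma test_function_\<xi>: "test_function pole \<delta> \<xi>"
  unfolding test_function_def
proof (intro conjI)
  show "C12_on S \<xi>" by (rule C12_\<xi>)
  have "\<xi> t x = 0" if "x \<in> S" "(t, x) \<notin> K" for t x
    using outside_K[OF that] E(4) g_far by (auto simp: \<xi>_def)
  then show "\<exists>K. compact K \<and> K \<subseteq> Q_dom pole \<delta> \<and> (\<forall>(t, x)\<in>Q_dom pole \<delta> - K. \<xi> t x = 0)"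
    using compact_K K_subset by (intro exI[of _ K]) (auto simp: Q_dom_def)
  show "\<forall>(t, x)\<in>Q_dom pole \<delta>. 0 \<le> \<xi> t x"
    using E(3) g_nonneg lat_ge by (auto simp: \<xi>_def Q_dom_def)
  show "\<forall>(t, x)\<in>Sigma_bd pole \<delta>. \<xi> t x = 0"
    using lat_Gamma g_bd by (auto simp: \<xi>_def Sigma_bd_def)
  have "normal_derivative pole \<delta> (\<xi> t) x \<le> 0" if "x \<in> Gamma_bd pole \<delta>" for t x
  proof -
    have x: "x \<in> S" and l: "lat pole x = \<tau>0" using lat_Gamma[OF that] by auto
    have n: "outer_normal pole x = cosh (lat pole x) *\<^sub>R (pole - (x \<bullet> pole) *\<^sub>R x)"
      using x S_sphere S_inner[OF x] pole by (intro outer_normal_eq) auto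
    \<comment> \<open>With w the tangential part of the pole, the product is - E g1 cosh^3 |w|^2, so
      the boundary sign condition reduces to that of \<open>g1\<close>.\<close>
    show ?thesis
      unfolding normal_derivative_def n sph_grad_\<xi>[OF x] l
      using E(3)[of "t / T"] g_bd(2) by (simp add: mult_nonneg_nonneg)
  qed
  then show "\<forall>(t, x)\<in>Sigma_bd pole \<delta>. normal_derivative pole \<delta> (\<xi> t) x \<le> 0"
    by (auto simp: Sigma_bd_def)
qed

end


section \<open>The test function inequality\<close>

text \<open>Young's inequality with the weight 1/2, so that two applications consume the nonlinear
  term exactly once. No sharp constant is sought: either y is small against x^(p-1), or x is bounded
  by a power of y.\<close>

lemma young_split:
  assumes "0 \<le> (x::real)" "0 \<le> y" "1 < p"
  shows "x * y \<le> x powr p / 2 + (2 * y) powr (p / (p - 1))"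
proof (cases "2 * y \<le> x powr (p - 1)")
  case True
  have "x * (2 * y) \<le> x * x powr (p - 1)" using True assms by (intro mult_left_mono) auto
  also have "\<dots> = x powr p" using assms by (cases "x = 0") (auto simp: powr_diff)
  finally have "x * y \<le> x powr p / 2" by simp
  then show ?thesis using powr_ge_zero[of "2 * y" "p / (p - 1)"] by linarith
next
  case False
  then have "x powr (p - 1) \<le> 2 * y" by simp
  then have "(x powr (p - 1)) powr (1 / (p - 1)) \<le> (2 * y) powr (1 / (p - 1))"
    using assms by (intro powr_mono2) auto
  then have x: "x \<le> (2 * y) powr (1 / (p - 1))" using assms by (simp add: powr_powr)
  have "x * y \<le> x * (2 * y)" using assms by (intro mult_left_mono) auto
  also have "\<dots> \<le> (2 * y) powr (1 / (p - 1)) * (2 * y)" using x assms by (intro mult_right_mono) auto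
  also have "\<dots> = (2 * y) powr (1 / (p - 1) + 1)"
    using assms by (cases "y = 0") (auto simp: powr_add)
  also have "1 / (p - 1) + 1 = p / (p - 1)" using assms by (simp add: field_simps)
  finally show ?thesis using powr_ge_zero[of x p] by linarith
qed

text \<open>Supplies genuine integrability of the integrands in \<open>weak_solution\<close>,
  without which their Lebesgue integrals could not be combined linearly. Continuity bounds
  \<open>h\<close> on the compact set that carries it.\<close>

lemma set_integrable_mult_compact_support:
  fixes w h :: "'b::t2_space \<Rightarrow> real"
  assumes M: "sets M = sets borel" and Q: "Q \<in> sets borel" and K: "compact K" "K \<subseteq> Q"
    and w: "set_borel_measurable M Q w" "set_integrable M K w"
    and h: "continuous_on Q h" "\<And>z. z \<in> Q - K \<Longrightarrow> h z = 0"
  shows "set_integrable M Q (\<lambda>z. w z * h z)"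
proof -
  have "bounded (h ` K)"
    using K h(1) by (intro compact_imp_bounded compact_continuous_image) (auto intro: continuous_on_subset)
  then obtain B where B: "\<And>z. z \<in> K \<Longrightarrow> \<bar>h z\<bar> \<le> B" by (auto simp: bounded_iff)
  have "(\<lambda>z. indicator Q z *\<^sub>R h z) \<in> borel_measurable borel"
    using borel_measurable_continuous_on_indicator[OF Q h(1)] .
  then have hm: "(\<lambda>z. indicator Q z *\<^sub>R h z) \<in> borel_measurable M"
    using measurable_cong_sets[OF M refl] by blast
  have "(\<lambda>z. (indicator Q z *\<^sub>R w z) * (indicator Q z *\<^sub>R h z)) \<in> borel_measurable M"
    using w(1) hm unfolding set_borel_measurable_def by (rule borel_measurable_times)
  moreover have "(\<lambda>z. (indicator Q z *\<^sub>R w z) * (indicator Q z *\<^sub>R h z)) = (\<lambda>z. indicator Q z *\<^sub>R (w z * h z))"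
    by (auto simp: indicator_def)
  ultimately have m: "(\<lambda>z. indicator Q z *\<^sub>R (w z * h z)) \<in> borel_measurable M" by simp
  have "integrable M (\<lambda>z. B * (indicator K z *\<^sub>R w z))"
    using w(2) unfolding set_integrable_def by simp
  then show ?thesis
    unfolding set_integrable_def
  proof (rule Bochner_Integration.integrable_bound[OF _ m], intro AE_I2)
    fix z
    show "norm (indicator Q z *\<^sub>R (w z * h z)) \<le> norm (B * (indicator K z *\<^sub>R w z))"
    proof (cases "z \<in> K")
      case True
      then have "\<bar>h z\<bar> \<le> \<bar>B\<bar>" using B[OF True] by simp
      then have "\<bar>h z\<bar> * \<bar>w z\<bar> \<le> \<bar>B\<bar> * \<bar>w z\<bar>" by (rule mult_right_mono) simp
      then show ?thesis using True K(2) by (auto simp: abs_mult mult.commute)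
    qed (use h(2) in \<open>auto simp: indicator_def\<close>)
  qed
qed

text \<open>\<open>ennreal\<close> sends negative values to 0, so passing to the right side merely
  drops the negative part of f.\<close>

lemma ennreal_integral_le_nn_integral:
  assumes "integrable M (f :: _ \<Rightarrow> real)"
  shows "ennreal (integral\<^sup>L M f) \<le> (\<integral>\<^sup>+x. ennreal (f x) \<partial>M)"
proof -
  have i: "integrable M (\<lambda>x. max 0 (f x))" using assms by simp
  have "integral\<^sup>L M f \<le> (\<integral>x. max 0 (f x) \<partial>M)" by (rule integral_mono[OF assms i]) simp
  then have "ennreal (integral\<^sup>L M f) \<le> ennreal (\<integral>x. max 0 (f x) \<partial>M)" by (rule ennreal_leI)
  also have "\<dots> = (\<integral>\<^sup>+x. ennreal (max 0 (f x)) \<partial>M)" by (rule nn_integral_eq_integral[symmetric, OF i]) simp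
  also have "\<dots> = (\<integral>\<^sup>+x. ennreal (f x) \<partial>M)"
    by (intro nn_integral_cong) (metis max.cobounded1 ennreal_max_0)
  finally show ?thesis .
qed

lemma pair_sigma_finite_sphere: "pair_sigma_finite lborel (sphere_measure :: 'a::euclidean_space measure)"
proof -
  interpret finite_measure "sphere_measure :: 'a measure" by (rule finite_measure_sphere_measure)
  show ?thesis ..
qed

lemma nn_integral_Q_measure_times:
  fixes h :: "'a::euclidean_space \<Rightarrow> ennreal"
  assumes [measurable]: "k \<in> borel_measurable borel" "h \<in> borel_measurable borel"
  shows "(\<integral>\<^sup>+z. k (fst z) * h (snd z) \<partial>Q_measure) = (\<integral>\<^sup>+t. k t \<partial>lborel) * (\<integral>\<^sup>+x. h x \<partial>sphere_measure)"
proof -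
  interpret finite_measure "sphere_measure :: 'a measure" by (rule finite_measure_sphere_measure)
  have "(\<integral>\<^sup>+z. k (fst z) * h (snd z) \<partial>(Q_measure :: (real \<times> 'a) measure))
     = (\<integral>\<^sup>+t. \<integral>\<^sup>+x. k t * h x \<partial>sphere_measure \<partial>lborel)"
    by (subst nn_integral_fst[symmetric]) auto
  also have "\<dots> = (\<integral>\<^sup>+t. k t * (\<integral>\<^sup>+x. h x \<partial>sphere_measure) \<partial>lborel)"
    by (intro nn_integral_cong nn_integral_cmult) simp
  also have "\<dots> = (\<integral>\<^sup>+t. k t \<partial>lborel) * (\<integral>\<^sup>+x. h x \<partial>sphere_measure)"
    by (rule nn_integral_multc) simp
  finally show ?thesis .
qed

lemma sets_Q_measure: "sets (Q_measure :: (real \<times> 'a::euclidean_space) measure) = sets borel"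
proof -
  have "sets (Q_measure :: (real \<times> 'a) measure) = sets (borel \<Otimes>\<^sub>M borel)"
    by (intro sets_pair_measure_cong) auto
  then show ?thesis unfolding borel_prod .
qed

lemma Omega_bar_measurable:
  assumes "norm pole = 1" "0 < \<delta>" "\<delta> < pi"
  shows "Omega_bar pole \<delta> \<in> sets borel"
proof -
  have "Omega_bar pole \<delta> = {x. norm x = 1 \<and> -1 < x \<bullet> pole \<and> x \<bullet> pole \<le> cos \<delta>}"
    using Omega_bar_iff(1)[OF assms] by blast
  then show ?thesis by simp
qed

context zonal_test
begin

lemma Q_measurable: "Q_dom pole \<delta> \<in> sets borel"
proof -
  have "{0<..} \<times> S \<in> sets (borel \<Otimes>\<^sub>M borel :: (real \<times> 'a) measure)"
    using Omega_bar_measurable[OF pole \<delta>] by (intro pair_measureI) auto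
  then show ?thesis unfolding Q_dom_def borel_prod .
qed

lemma K_measurable: "K \<in> sets Q_measure"
  unfolding sets_Q_measure using compact_K by (simp add: borel_closed compact_imp_closed)

lemma emeasure_K: "emeasure Q_measure K < \<infinity>"
proof -
  interpret finite_measure "sphere_measure :: 'a measure" by (rule finite_measure_sphere_measure)
  have "emeasure Q_measure K \<le> emeasure Q_measure ({T..2 * T} \<times> (UNIV :: 'a set))"
    by (rule emeasure_mono) (auto simp: K_def)
  also have "\<dots> = emeasure lborel {T..2 * T} * emeasure sphere_measure (UNIV :: 'a set)"
    by (rule emeasure_pair_measure_Times) auto
  also have "\<dots> < \<infinity>"
  proof -
    have "emeasure sphere_measure (UNIV :: 'a set) < top"
      by (simp add: emeasure_sphere_measure_UNIV ennreal_mult_less_top ennreal_of_nat_eq_real_of_nat)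
    then show ?thesis using T by (simp add: ennreal_mult_less_top)
  qed
  finally show ?thesis .
qed

text \<open>The absorption step. \<open>D\<close> and \<open>A\<close> provide the factor g^(1/p)
  which, with |u|, forms the p-th root of the nonlinear integrand; Young's inequality then leaves
  only \<open>V\<close>, which is free of u. Integration over time gives a factor T on both sides,
  which cancels, and e0/2 bounds the integral of \<open>E\<close> from below.\<close>

lemma weak_inequality:
  fixes D A :: "real \<Rightarrow> real" and f :: "'a \<Rightarrow> real" and c e0 p \<alpha> lam :: real
  assumes weak: "weak_solution pole \<delta> lam \<alpha> p f u" and p: "1 < p"
    and f: "admissible_source pole \<delta> f"
    and E': "\<And>t. E t \<le> 1" "\<And>t. t \<notin> {1..2} \<Longrightarrow> E1 t = 0" "\<And>t. \<bar>E1 t\<bar> \<le> c * E t powr (1 / p)"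
      "\<And>t. t \<in> {5/4..7/4} \<Longrightarrow> e0 \<le> E t" "0 < e0" "0 < c"
    and far: "\<And>t. b < t \<Longrightarrow> g1 t = 0" "\<And>t. b < t \<Longrightarrow> g2 t = 0"
    and D: "\<And>t. \<tau>0 \<le> t \<Longrightarrow> g t \<le> D t * g t powr (1 / p)" "\<And>t. 0 \<le> D t" "D \<in> borel_measurable borel"
    and A: "\<And>t. \<tau>0 \<le> t \<Longrightarrow> \<bar>(cosh t)\<^sup>2 * (g2 t - (real DIM('a) - 3) * tanh t * g1 t + lam * g t)\<bar> \<le> A t * g t powr (1 / p)"
      "\<And>t. 0 \<le> A t" "A \<in> borel_measurable borel"
  defines "V \<equiv> \<lambda>t. (2 * (cosh t powr (\<alpha> / p) * (c / T * D t))) powr (p / (p - 1))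
      + (2 * (cosh t powr (\<alpha> / p) * A t)) powr (p / (p - 1))"
  shows "ennreal (e0 / 2) * (\<integral>\<^sup>+x. ennreal (indicator S x *\<^sub>R f x * g (lat pole x)) \<partial>sphere_measure)
      \<le> (\<integral>\<^sup>+x. indicator S x * ennreal (V (lat pole x)) \<partial>sphere_measure)"
proof -
  let ?Q = "Q_dom pole \<delta>"
  interpret P: pair_sigma_finite lborel "sphere_measure :: 'a measure" by (rule pair_sigma_finite_sphere)
  have Q: "?Q = {0<..} \<times> S" by (simp add: Q_dom_def)
  have S_meas [measurable]: "S \<in> sets borel" by (rule Omega_bar_measurable[OF pole \<delta>])
  note [measurable] = D(3) A(3)
  have [measurable]: "(cosh :: real \<Rightarrow> real) \<in> borel_measurable borel"
    by (intro borel_measurable_continuous_onI continuous_intros)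
  have V_meas [measurable]: "V \<in> borel_measurable borel"
    unfolding V_def by measurable
  define \<Psi> where "\<Psi> t = (cosh t)\<^sup>2 * (g2 t - (real DIM('a) - 3) * tanh t * g1 t + lam * g t)" for t
  define h1 where "h1 z = E1 (fst z / T) / T * g (lat pole (snd z))" for z :: "real \<times> 'a"
  define h2 where "h2 z = E (fst z / T) * \<Psi> (lat pole (snd z))" for z :: "real \<times> 'a"
  define ha where "ha z = cosh (lat pole (snd z)) powr (- \<alpha>) * \<xi> (fst z) (snd z)" for z :: "real \<times> 'a"
  define hf where "hf z = \<xi> (fst z) (snd z)" for z :: "real \<times> 'a"
  have ch: "cosh t \<noteq> 0" "cosh t > 0" for t :: real using cosh_real_pos[of t] by auto
  have hf_cont: "continuous_on ?Q hf"
    unfolding hf_def \<xi>_def Q by (intro continuous_intros continuous_E continuous_lat_comp continuous_g)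
  have ha_cont: "continuous_on ?Q ha"
    unfolding ha_def hf_def[symmetric] using ch hf_cont unfolding Q
    by (intro continuous_intros cosh_cont) auto
  have h1_cont: "continuous_on ?Q h1"
    unfolding h1_def Q using T by (intro continuous_intros continuous_E continuous_lat_comp continuous_g) auto
  have h2_cont: "continuous_on ?Q h2"
    unfolding h2_def \<Psi>_def Q
    by (intro continuous_intros continuous_E continuous_lat_comp continuous_g g(3) cosh_cont tanh_cont)
  have zero: "h1 z = 0" "h2 z = 0" "ha z = 0" "hf z = 0" if "z \<in> ?Q - K" for z
    using outside_K[of "snd z" "fst z"] that E(4) E'(2) g_far far
    by (auto simp: Q h1_def h2_def ha_def hf_def \<xi>_def \<Psi>_def)
  let ?u = "\<lambda>z. u (fst z) (snd z)"
  have um: "set_borel_measurable Q_measure ?Q ?u" and up: "set_integrable Q_measure K (\<lambda>z. \<bar>?u z\<bar> powr p)"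
  proof -
    have "(\<lambda>(t, x). u t x) = ?u" by (simp add: fun_eq_iff)
    then have "Lp_loc Q_measure p ?Q ?u" using weak unfolding weak_solution_def by simp
    then show "set_borel_measurable Q_measure ?Q ?u" "set_integrable Q_measure K (\<lambda>z. \<bar>?u z\<bar> powr p)"
      using compact_K K_subset unfolding Lp_loc_def by blast+
  qed
  have upm: "set_borel_measurable Q_measure ?Q (\<lambda>z. \<bar>?u z\<bar> powr p)"
  proof -
    have "(\<lambda>z. \<bar>indicator ?Q z *\<^sub>R ?u z\<bar> powr p) \<in> borel_measurable Q_measure"
      using um unfolding set_borel_measurable_def by measurable
    moreover have "(\<lambda>z. \<bar>indicator ?Q z *\<^sub>R ?u z\<bar> powr p) = (\<lambda>z. indicator ?Q z *\<^sub>R (\<bar>?u z\<bar> powr p))"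
      by (auto simp: indicator_def)
    ultimately show ?thesis unfolding set_borel_measurable_def by simp
  qed
  have KQ: "indicator K z * indicator ?Q z = (indicator K z :: real)" for z
    using K_subset by (auto simp: indicator_def)
  \<comment> \<open>Local p-integrability implies local integrability, since |y| <= 1 + |y|^p and
    \<open>K\<close> has finite measure.\<close>
  have ui: "set_integrable Q_measure K ?u"
  proof -
    have "(\<lambda>z. indicator K z * (indicator ?Q z *\<^sub>R ?u z)) \<in> borel_measurable Q_measure"
      using um K_measurable unfolding set_borel_measurable_def by measurable
    then have m: "(\<lambda>z. indicator K z *\<^sub>R ?u z) \<in> borel_measurable Q_measure"
      using KQ by (simp add: mult.assoc[symmetric])
    have "integrable Q_measure (\<lambda>z. indicator K z + indicator K z *\<^sub>R (\<bar>?u z\<bar> powr p))"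
      using up emeasure_K K_measurable unfolding set_integrable_def
      by (intro Bochner_Integration.integrable_add integrable_real_indicator) auto
    then show ?thesis unfolding set_integrable_def
    proof (rule Bochner_Integration.integrable_bound[OF _ m], intro AE_I2)
      fix z :: "real \<times> 'a"
      have "\<bar>y\<bar> \<le> 1 + \<bar>y\<bar> powr p" for y :: real
      proof (cases "\<bar>y\<bar> \<le> 1")
        case False
        then show ?thesis using powr_mono[of 1 p "\<bar>y\<bar>"] p by simp
      qed (use powr_ge_zero[of "\<bar>y\<bar>" p] in linarith)
      then show "norm (indicator K z *\<^sub>R ?u z) \<le> norm (indicator K z + indicator K z *\<^sub>R (\<bar>?u z\<bar> powr p))"
        by (auto simp: indicator_def add_nonneg_nonneg)
    qed
  qed
  have fm: "(\<lambda>x. indicator S x *\<^sub>R f x) \<in> borel_measurable borel"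
    using f unfolding admissible_source_def Lp_loc_def set_borel_measurable_def
    by (simp cong: measurable_cong_sets)
  have fQm: "set_borel_measurable Q_measure ?Q (\<lambda>z. f (snd z))"
  proof -
    have "(\<lambda>z :: real \<times> 'a. indicator S (snd z) *\<^sub>R f (snd z)) \<in> borel_measurable (borel \<Otimes>\<^sub>M borel)"
      by (rule measurable_compose[OF measurable_snd fm])
    then have "(\<lambda>z :: real \<times> 'a. indicator {0<..} (fst z) * (indicator S (snd z) *\<^sub>R f (snd z))) \<in> borel_measurable (borel \<Otimes>\<^sub>M borel)"
      by (intro borel_measurable_times measurable_compose[OF measurable_fst, of _ borel]) auto
    moreover have "(\<lambda>z. indicator {0<..} (fst z) * (indicator S (snd z) *\<^sub>R f (snd z))) = (\<lambda>z. indicator ?Q z *\<^sub>R f (snd z))"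
      by (auto simp: indicator_def Q)
    ultimately have "(\<lambda>z. indicator ?Q z *\<^sub>R f (snd z)) \<in> borel_measurable borel"
      unfolding borel_prod by (simp only:)
    then show ?thesis unfolding set_borel_measurable_def using measurable_cong_sets[OF sets_Q_measure refl] by blast
  qed
  have fi: "set_integrable Q_measure K (\<lambda>z. f (snd z))"
  proof -
    define Kx where "Kx = {x. norm x = 1 \<and> - tanh b \<le> x \<bullet> pole \<and> x \<bullet> pole \<le> cos \<delta>}"
    have "compact Kx" "Kx \<subseteq> S"
    proof -
      have "Kx = snd ` K" using T unfolding K_def Kx_def by force
      then show "compact Kx" using compact_continuous_image[OF continuous_on_snd[OF continuous_on_id] compact_K] by simp
      show "Kx \<subseteq> S" using K_subset T unfolding K_def Kx_def Q by fastforce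
    qed
    then have fK: "set_integrable sphere_measure Kx (\<lambda>x. \<bar>f x\<bar> powr 1)"
      using f unfolding admissible_source_def Lp_loc_def by blast
    have [measurable]: "Kx \<in> sets borel" using \<open>compact Kx\<close> by (simp add: borel_closed compact_imp_closed)
    have m: "(\<lambda>z. indicator K z *\<^sub>R f (snd z)) \<in> borel_measurable Q_measure"
    proof -
      have "(\<lambda>z. indicator K z * (indicator ?Q z *\<^sub>R f (snd z))) \<in> borel_measurable Q_measure"
        using fQm K_measurable unfolding set_borel_measurable_def by measurable
      then show ?thesis using KQ by (simp add: mult.assoc[symmetric])
    qed
    have fKm: "(\<lambda>x. ennreal (indicator Kx x *\<^sub>R (\<bar>f x\<bar> powr 1))) \<in> borel_measurable borel"
      using borel_measurable_integrable[OF fK[unfolded set_integrable_def]] by (simp cong: measurable_cong_sets)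
    have "(\<integral>\<^sup>+z. ennreal (norm (indicator K z *\<^sub>R f (snd z))) \<partial>Q_measure)
        = (\<integral>\<^sup>+z. indicator {T..2 * T} (fst z) * ennreal (indicator Kx (snd z) *\<^sub>R (\<bar>f (snd z)\<bar> powr 1)) \<partial>Q_measure)"
      by (intro nn_integral_cong) (auto simp: K_def Kx_def indicator_def)
    also have "\<dots> = (\<integral>\<^sup>+t. indicator {T..2 * T} t \<partial>lborel) * (\<integral>\<^sup>+x. ennreal (indicator Kx x *\<^sub>R (\<bar>f x\<bar> powr 1)) \<partial>sphere_measure)"
      by (rule nn_integral_Q_measure_times[OF _ fKm]) simp
    also have "\<dots> < \<infinity>"
      using fK[unfolded set_integrable_def] T
      by (subst nn_integral_eq_integral) (auto simp: ennreal_mult_less_top)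
    finally have "(\<integral>\<^sup>+z. ennreal (norm (indicator K z *\<^sub>R f (snd z))) \<partial>Q_measure) < \<infinity>" .
    then show ?thesis unfolding set_integrable_def using m by (intro integrableI_bounded)
  qed
  note int = set_integrable_mult_compact_support[OF sets_Q_measure Q_measurable compact_K K_subset]
  have Ia: "set_integrable Q_measure ?Q (\<lambda>z. \<bar>?u z\<bar> powr p * ha z)"
    using zero by (intro int[OF upm up ha_cont])
  have If: "set_integrable Q_measure ?Q (\<lambda>z. f (snd z) * hf z)"
    using zero by (intro int[OF fQm fi hf_cont])
  have I1: "set_integrable Q_measure ?Q (\<lambda>z. ?u z * h1 z)"
    using zero by (intro int[OF um ui h1_cont])
  have I2: "set_integrable Q_measure ?Q (\<lambda>z. ?u z * h2 z)"
    using zero by (intro int[OF um ui h2_cont])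
  have Qs: "?Q \<in> sets Q_measure" unfolding sets_Q_measure by (rule Q_measurable)
  have sc: "sin (geo_dist pole x) = 1 / cosh (lat pole x)" if "x \<in> S" for x
    by (rule sin_geo_dist[OF S_inner[OF that]])
  have "set_lebesgue_integral Q_measure ?Q (\<lambda>z. \<bar>?u z\<bar> powr p * ha z)
      + set_lebesgue_integral Q_measure ?Q (\<lambda>z. f (snd z) * hf z)
      \<le> - set_lebesgue_integral Q_measure ?Q (\<lambda>z. ?u z * h1 z)
         - set_lebesgue_integral Q_measure ?Q (\<lambda>z. ?u z * h2 z)"
  proof -
    have 1: "set_lebesgue_integral Q_measure ?Q (\<lambda>z. \<bar>?u z\<bar> powr p * ha z) = set_lebesgue_integral Q_measure ?Q
          (\<lambda>(t, x). sin (geo_dist pole x) powr \<alpha> * \<bar>u t x\<bar> powr p * \<xi> t x)"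
    proof (rule set_lebesgue_integral_cong[OF Qs], safe)
      fix t :: real and x :: 'a assume "(t, x) \<in> ?Q"
      then have x: "x \<in> S" by (simp add: Q)
      show "\<bar>?u (t, x)\<bar> powr p * ha (t, x) = sin (geo_dist pole x) powr \<alpha> * \<bar>u t x\<bar> powr p * \<xi> t x"
        by (simp add: ha_def sc[OF x] inverse_cosh_powr)
    qed
    have 2: "set_lebesgue_integral Q_measure ?Q (\<lambda>z. f (snd z) * hf z) =
        set_lebesgue_integral Q_measure ?Q (\<lambda>(t, x). f x * \<xi> t x)"
      by (rule set_lebesgue_integral_cong[OF Qs]) (auto simp: hf_def)
    have 3: "set_lebesgue_integral Q_measure ?Q (\<lambda>z. ?u z * h1 z) =
        set_lebesgue_integral Q_measure ?Q (\<lambda>(t, x). u t x * deriv (\<lambda>s. \<xi> s x) t)"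
      by (rule set_lebesgue_integral_cong[OF Qs]) (auto simp: h1_def DERIV_imp_deriv[OF deriv_\<xi>])
    have 4: "set_lebesgue_integral Q_measure ?Q (\<lambda>z. ?u z * h2 z) =
        set_lebesgue_integral Q_measure ?Q (\<lambda>(t, x). u t x * (laplace_beltrami S (\<xi> t) x
                                 + lam / (sin (geo_dist pole x))\<^sup>2 * \<xi> t x))"
    proof (rule set_lebesgue_integral_cong[OF Qs], safe)
      fix t :: real and x :: 'a assume "(t, x) \<in> ?Q"
      then have x: "x \<in> S" by (simp add: Q)
      show "?u (t, x) * h2 (t, x) = u t x * (laplace_beltrami S (\<xi> t) x + lam / (sin (geo_dist pole x))\<^sup>2 * \<xi> t x)"
        by (simp add: h2_def \<Psi>_def laplace_\<xi>[OF x] sc[OF x] \<xi>_def power_divide algebra_simps)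
    qed
    show ?thesis
      unfolding 1 2 3 4 using weak test_function_\<xi> unfolding weak_solution_def by blast
  qed
  note main = this
  \<comment> \<open>What remains on the right once the nonlinear term is moved there. Its integral
    dominates that of f \<xi>, and it can be bounded pointwise.\<close>
  define r where "r z = - (?u z * h1 z) - ?u z * h2 z - \<bar>?u z\<bar> powr p * ha z" for z
  have Ir: "set_integrable Q_measure ?Q r"
    unfolding r_def by (intro set_integral_diff(1) Ia I1 I2) (use I1 in \<open>simp add: set_integrable_def\<close>)
  have "set_lebesgue_integral Q_measure ?Q r = - set_lebesgue_integral Q_measure ?Q (\<lambda>z. ?u z * h1 z)
         - set_lebesgue_integral Q_measure ?Q (\<lambda>z. ?u z * h2 z) - set_lebesgue_integral Q_measure ?Q (\<lambda>z. \<bar>?u z\<bar> powr p * ha z)"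
  proof -
    have I1': "set_integrable Q_measure ?Q (\<lambda>z. - (?u z * h1 z))"
      using I1 by (simp add: set_integrable_def)
    show ?thesis
      unfolding r_def using set_integral_diff(2)[OF set_integral_diff(1)[OF I1' I2] Ia] set_integral_diff(2)[OF I1' I2]
      by (simp add: set_lebesgue_integral_def)
  qed
  then have fr: "set_lebesgue_integral Q_measure ?Q (\<lambda>z. f (snd z) * hf z) \<le> set_lebesgue_integral Q_measure ?Q r"
    using main by simp
  have pointwise: "r z \<le> indicator {T..2 * T} (fst z) * V (lat pole (snd z))" if zQ: "z \<in> ?Q" for z
  proof -
    obtain t x where z: "z = (t, x)" "x \<in> S" using zQ by (cases z) (auto simp: Q)
    define \<tau> where "\<tau> = lat pole x"
    have \<tau>: "\<tau>0 \<le> \<tau>" using lat_ge[OF z(2)] by (simp add: \<tau>_def)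
    show ?thesis
    proof (cases "t \<in> {T..2 * T}")
      case False
      then have "t / T \<notin> {1..2}" using T by (auto simp: field_simps)
      then have "h1 z = 0" "h2 z = 0" "ha z = 0"
        using E(4) E'(2) by (auto simp: z h1_def h2_def ha_def \<xi>_def)
      then show ?thesis using False z by (simp add: r_def)
    next
      case True
      define e where "e = E (t / T)"
      have e: "0 \<le> e" "e \<le> 1" using E(3) E'(1) by (auto simp: e_def)
      have gn: "0 \<le> g \<tau>" using g_nonneg[OF \<tau>] .
      \<comment> \<open>The p-th root of the nonlinear integrand. The compensating power of cosh
        goes into the second factor of Young's inequality.\<close>
      define X where "X = cosh \<tau> powr (- \<alpha> / p) * \<bar>u t x\<bar> * (e powr (1 / p) * g \<tau> powr (1 / p))"
      have X: "0 \<le> X" by (simp add: X_def)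
      have Xp: "X powr p = \<bar>u t x\<bar> powr p * ha z"
        using p e gn by (simp add: X_def z ha_def \<xi>_def e_def \<tau>_def powr_mult powr_powr)
      have can: "cosh \<tau> powr (- \<alpha> / p) * cosh \<tau> powr (\<alpha> / p) = 1"
        using ch(2)[of \<tau>] by (simp add: powr_add[symmetric])
      have "\<bar>h1 z\<bar> \<le> e powr (1 / p) * g \<tau> powr (1 / p) * (c / T * D \<tau>)"
      proof -
        have "\<bar>h1 z\<bar> = \<bar>E1 (t / T)\<bar> / T * g \<tau>" using T gn by (simp add: h1_def z \<tau>_def abs_mult)
        also have "\<dots> \<le> (c * e powr (1 / p)) / T * (D \<tau> * g \<tau> powr (1 / p))"
          using E'(3)[of "t / T"] D(1)[OF \<tau>] T gn E'(6) by (intro mult_mono divide_right_mono) (auto simp: e_def)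
        finally show ?thesis by (simp add: mult_ac)
      qed
      then have "\<bar>u t x\<bar> * \<bar>h1 z\<bar> \<le> \<bar>u t x\<bar> * (e powr (1 / p) * g \<tau> powr (1 / p) * (c / T * D \<tau>))"
        by (rule mult_left_mono) simp
      also have "\<dots> = (cosh \<tau> powr (- \<alpha> / p) * cosh \<tau> powr (\<alpha> / p)) * \<bar>u t x\<bar> * (e powr (1 / p) * g \<tau> powr (1 / p) * (c / T * D \<tau>))"
        unfolding can by simp
      also have "\<dots> = X * (cosh \<tau> powr (\<alpha> / p) * (c / T * D \<tau>))"
        by (simp add: X_def mult_ac)
      also have "\<dots> \<le> X powr p / 2 + (2 * (cosh \<tau> powr (\<alpha> / p) * (c / T * D \<tau>))) powr (p / (p - 1))"
        using X D(2)[of \<tau>] E'(6) T p by (intro young_split) auto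
      finally have 1: "\<bar>u t x\<bar> * \<bar>h1 z\<bar> \<le> X powr p / 2 + (2 * (cosh \<tau> powr (\<alpha> / p) * (c / T * D \<tau>))) powr (p / (p - 1))" .
      have "\<bar>h2 z\<bar> \<le> e powr (1 / p) * g \<tau> powr (1 / p) * A \<tau>"
      proof -
        have "e \<le> e powr (1 / p)"
          using e p powr_mono'[of "1 / p" 1 e] by simp
        then have "e * \<bar>\<Psi> \<tau>\<bar> \<le> e powr (1 / p) * (A \<tau> * g \<tau> powr (1 / p))"
          using A(1)[OF \<tau>] by (intro mult_mono) (auto simp: \<Psi>_def)
        then show ?thesis using e by (simp add: h2_def z \<tau>_def e_def abs_mult mult_ac)
      qed
      then have "\<bar>u t x\<bar> * \<bar>h2 z\<bar> \<le> \<bar>u t x\<bar> * (e powr (1 / p) * g \<tau> powr (1 / p) * A \<tau>)"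
        by (rule mult_left_mono) simp
      also have "\<dots> = (cosh \<tau> powr (- \<alpha> / p) * cosh \<tau> powr (\<alpha> / p)) * \<bar>u t x\<bar> * (e powr (1 / p) * g \<tau> powr (1 / p) * A \<tau>)"
        unfolding can by simp
      also have "\<dots> = X * (cosh \<tau> powr (\<alpha> / p) * A \<tau>)"
        by (simp add: X_def mult_ac)
      also have "\<dots> \<le> X powr p / 2 + (2 * (cosh \<tau> powr (\<alpha> / p) * A \<tau>)) powr (p / (p - 1))"
        using X A(2)[of \<tau>] p by (intro young_split) auto
      finally have 2: "\<bar>u t x\<bar> * \<bar>h2 z\<bar> \<le> X powr p / 2 + (2 * (cosh \<tau> powr (\<alpha> / p) * A \<tau>)) powr (p / (p - 1))" .
      have "- (u t x * h1 z) \<le> \<bar>u t x\<bar> * \<bar>h1 z\<bar>" "- (u t x * h2 z) \<le> \<bar>u t x\<bar> * \<bar>h2 z\<bar>"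
        by (simp_all add: abs_mult[symmetric])
      then have "r z \<le> V \<tau>"
        using 1 2 Xp unfolding r_def V_def z by simp
      then show ?thesis using True by (simp add: z \<tau>_def)
    qed
  qed
  have Vn: "0 \<le> V t" for t by (simp add: V_def)
  \<comment> \<open>f is nonnegative only almost everywhere on the sphere, so its sign has to be
    carried over to the product measure.\<close>
  have fn: "AE z in Q_measure. 0 \<le> indicator ?Q z *\<^sub>R (f (snd z) * hf z)"
  proof -
    have fS: "AE x in sphere_measure. 0 \<le> indicator S x *\<^sub>R f x"
      using f unfolding admissible_source_def by (auto simp: indicator_def elim!: AE_mp)
    have "AE z in Q_measure. 0 \<le> indicator S (snd z) *\<^sub>R f (snd z)"
    proof (rule P.AE_pair_measure)
      have "(\<lambda>z :: real \<times> 'a. indicator S (snd z) *\<^sub>R f (snd z)) \<in> borel_measurable (borel \<Otimes>\<^sub>M borel)"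
        by (rule measurable_compose[OF measurable_snd fm])
      then have "{z \<in> space (borel \<Otimes>\<^sub>M borel). 0 \<le> indicator S (snd z) *\<^sub>R f (snd z)} \<in> sets (borel \<Otimes>\<^sub>M borel :: (real \<times> 'a) measure)"
        by measurable
      then show "{z \<in> space Q_measure. 0 \<le> indicator S (snd z) *\<^sub>R f (snd z)} \<in> sets (Q_measure :: (real \<times> 'a) measure)"
        unfolding sets_Q_measure borel_prod by (simp add: space_pair_measure)
    qed (use fS in simp)
    then show ?thesis
    proof eventually_elim
      case (elim z)
      then show ?case
        using E(3) g_nonneg lat_ge by (auto simp: indicator_def Q hf_def \<xi>_def split: if_splits)
    qed
  qed
  have "(\<integral>\<^sup>+z. ennreal (indicator ?Q z *\<^sub>R (f (snd z) * hf z)) \<partial>Q_measure)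
      = ennreal (set_lebesgue_integral Q_measure ?Q (\<lambda>z. f (snd z) * hf z))"
    unfolding set_lebesgue_integral_def by (rule nn_integral_eq_integral[OF If[unfolded set_integrable_def] fn])
  also have "\<dots> \<le> ennreal (set_lebesgue_integral Q_measure ?Q r)" using fr by (rule ennreal_leI)
  also have "\<dots> \<le> (\<integral>\<^sup>+z. ennreal (indicator ?Q z *\<^sub>R r z) \<partial>Q_measure)"
    unfolding set_lebesgue_integral_def by (rule ennreal_integral_le_nn_integral[OF Ir[unfolded set_integrable_def]])
  also have "\<dots> \<le> (\<integral>\<^sup>+z. indicator {T..2 * T} (fst z) * (indicator S (snd z) * ennreal (V (lat pole (snd z)))) \<partial>Q_measure)"
  proof (rule nn_integral_mono)
    fix z :: "real \<times> 'a"
    show "ennreal (indicator ?Q z *\<^sub>R r z) \<le> indicator {T..2 * T} (fst z) * (indicator S (snd z) * ennreal (V (lat pole (snd z))))"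
    proof (cases "z \<in> ?Q")
      case True
      have "ennreal (r z) \<le> ennreal (indicator {T..2 * T} (fst z) * V (lat pole (snd z)))"
        using pointwise[OF True] by (rule ennreal_leI)
      then show ?thesis using True by (auto simp: Q indicator_def split: if_splits)
    qed simp
  qed
  also have "\<dots> = ennreal T * (\<integral>\<^sup>+x. indicator S x * ennreal (V (lat pole x)) \<partial>sphere_measure)"
    using T by (subst nn_integral_Q_measure_times) (auto intro!: borel_measurable_times_ennreal)
  finally have up: "(\<integral>\<^sup>+z. ennreal (indicator ?Q z *\<^sub>R (f (snd z) * hf z)) \<partial>Q_measure)
     \<le> ennreal T * (\<integral>\<^sup>+x. indicator S x * ennreal (V (lat pole x)) \<partial>sphere_measure)" .
  let ?F = "\<lambda>x. ennreal (indicator S x *\<^sub>R f x * g (lat pole x))"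
  have gm: "(\<lambda>x. indicator S x * g (lat pole x)) \<in> borel_measurable borel"
  proof -
    have "continuous_on S (\<lambda>x. g (lat pole x))"
    proof -
      have "continuous_on S (\<lambda>x. g (lat pole (snd (1 :: real, x))))"
        by (rule continuous_on_compose2[OF continuous_lat_comp[OF continuous_g(1), of "{1 :: real}"]])
          (auto intro!: continuous_intros)
      then show ?thesis by simp
    qed
    from borel_measurable_continuous_on_indicator[OF S_meas this] show ?thesis by simp
  qed
  have Fm: "?F \<in> borel_measurable borel"
  proof -
    have "(\<lambda>x. ennreal ((indicator S x *\<^sub>R f x) * (indicator S x * g (lat pole x)))) \<in> borel_measurable borel"
      using fm gm by measurable
    moreover have "(\<lambda>x. ennreal ((indicator S x *\<^sub>R f x) * (indicator S x * g (lat pole x)))) = ?F"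
      by (auto simp: indicator_def)
    ultimately show ?thesis by simp
  qed
  have "ennreal T * (ennreal (e0 / 2) * (\<integral>\<^sup>+x. ?F x \<partial>sphere_measure))
     = (\<integral>\<^sup>+t. ennreal e0 * indicator {5 * T / 4..7 * T / 4} t \<partial>lborel) * (\<integral>\<^sup>+x. ?F x \<partial>sphere_measure)"
  proof -
    have "(\<integral>\<^sup>+t. ennreal e0 * indicator {5 * T / 4..7 * T / 4} t \<partial>lborel) = ennreal e0 * ennreal (7 * T / 4 - 5 * T / 4)"
      using T by (simp add: nn_integral_cmult_indicator)
    also have "\<dots> = ennreal T * ennreal (e0 / 2)"
      using T E'(5) by (simp add: ennreal_mult[symmetric] field_simps)
    finally show ?thesis by (simp add: mult.assoc)
  qed
  also have "\<dots> = (\<integral>\<^sup>+z. (ennreal e0 * indicator {5 * T / 4..7 * T / 4} (fst z)) * ?F (snd z) \<partial>Q_measure)"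
    by (rule nn_integral_Q_measure_times[symmetric, OF _ Fm]) simp
  also have "\<dots> \<le> (\<integral>\<^sup>+z. ennreal (indicator ?Q z *\<^sub>R (f (snd z) * hf z)) \<partial>Q_measure)"
  proof (rule nn_integral_mono)
    fix z :: "real \<times> 'a"
    show "(ennreal e0 * indicator {5 * T / 4..7 * T / 4} (fst z)) * ?F (snd z) \<le> ennreal (indicator ?Q z *\<^sub>R (f (snd z) * hf z))"
    proof (cases "fst z \<in> {5 * T / 4..7 * T / 4} \<and> snd z \<in> S \<and> 0 \<le> f (snd z)")
      case True
      then have "fst z / T \<in> {5/4..7/4}" using T by (auto simp: field_simps)
      then have "e0 * (f (snd z) * g (lat pole (snd z))) \<le> E (fst z / T) * (f (snd z) * g (lat pole (snd z)))"
        using E'(4) True g_nonneg lat_ge by (intro mult_right_mono) auto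
      moreover have "z \<in> ?Q" using True T by (cases z) (auto simp: Q)
      ultimately show ?thesis
        using True E'(5) by (simp add: hf_def \<xi>_def ennreal_mult'[symmetric] mult_ac ennreal_leI)
    next
      case False
      \<comment> \<open>Outside the time interval or \<open>S\<close> the indicators vanish; where f
        < 0, \<open>ennreal\<close> yields 0.\<close>
      then have z0: "indicator {5 * T / 4..7 * T / 4} (fst z) * ?F (snd z) = 0"
        using g_nonneg[OF lat_ge] by (auto simp: indicator_def ennreal_neg mult_nonpos_nonneg)
      show ?thesis unfolding mult.assoc z0 by simp
    qed
  qed
  also have "\<dots> \<le> ennreal T * (\<integral>\<^sup>+x. indicator S x * ennreal (V (lat pole x)) \<partial>sphere_measure)"
    by (rule up)
  finally show ?thesis
    using T by (subst (asm) ennreal_mult_le_mult_iff) auto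
qed

end


section \<open>Nonexistence\<close>

text \<open>\<open>\<tau>0_pos\<close> places the boundary parallel beyond the equator, so \<tau> is
  positive on the whole domain and cosh is comparable to an exponential. \<open>H\<close> depends on
  \<delta> through its zero.\<close>

locale dominant_profile =
  fixes pole :: "'a::euclidean_space" and N :: nat and \<delta> lam s C :: real and H H1 H2 :: "real \<Rightarrow> real"
  assumes dim: "DIM('a) = N + 1" "N \<ge> 3" and pole: "norm pole = 1"
    and \<delta>: "0 < \<delta>" "\<delta> < pi" and \<tau>0_pos: "0 < artanh (- cos \<delta>)"
    and s: "0 < s" "2 * s \<le> real N - 2" and C: "0 < C"
    and dH: "\<And>t. artanh (- cos \<delta>) \<le> t \<Longrightarrow> (H has_real_derivative H1 t) (at t)"
      "\<And>t. artanh (- cos \<delta>) \<le> t \<Longrightarrow> (H1 has_real_derivative H2 t) (at t)"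
    and H2: "\<And>t. artanh (- cos \<delta>) \<le> t \<Longrightarrow> H2 t = (real N - 2) * tanh t * H1 t - lam * H t"
      "\<And>t. artanh (- cos \<delta>) \<le> t \<Longrightarrow> isCont H2 t"
    and H0: "H (artanh (- cos \<delta>)) = 0"
    and Hpos: "\<And>t. artanh (- cos \<delta>) < t \<Longrightarrow> 0 < H t"
    and Hup: "\<And>t. artanh (- cos \<delta>) < t \<Longrightarrow>
      H t \<le> C * exp ((real N - 2 - s) * t) * (if real N - 2 = 2 * s then t else 1)"
    and H1up: "\<And>t. artanh (- cos \<delta>) + 1 \<le> t \<Longrightarrow> \<bar>H1 t\<bar> \<le> C * H t"
begin

abbreviation "\<tau>0 \<equiv> artanh (- cos \<delta>)"
abbreviation "S \<equiv> Omega_bar pole \<delta>"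

lemma H_nonneg: "\<tau>0 \<le> t \<Longrightarrow> 0 \<le> H t"
  using Hpos[of t] H0 by (cases "t = \<tau>0") auto

text \<open>Provides the normal derivative condition for test functions: a negative slope at the
  zero would make \<open>H\<close> negative just beyond it.\<close>

lemma H1_bd: "0 \<le> H1 \<tau>0"
proof (rule ccontr)
  assume "\<not> ?thesis"
  then have "H1 \<tau>0 < 0" by simp
  from has_real_derivative_neg_dec_right[of _ _ \<tau>0 UNIV, OF dH(1)[OF order.refl] this]
  obtain d where "d > 0" "\<And>h. 0 < h \<Longrightarrow> h < d \<Longrightarrow> H (\<tau>0 + h) < H \<tau>0" by auto
  then have "H (\<tau>0 + d / 2) < 0" using H0 by force
  then show False using Hpos[of "\<tau>0 + d / 2"] \<open>d > 0\<close> by simp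
qed

lemma cos_delta: "-1 < cos \<delta>" "cos \<delta> < 0" "tanh \<tau>0 = - cos \<delta>"
proof -
  have c: "-1 < cos \<delta>" "cos \<delta> < 1"
    using \<delta> cos_monotone_0_pi[of \<delta> pi] cos_monotone_0_pi[of 0 \<delta>] by auto
  then show t: "tanh \<tau>0 = - cos \<delta>" by (intro tanh_artanh) auto
  have "0 < tanh \<tau>0" using \<tau>0_pos by simp
  then show "cos \<delta> < 0" unfolding t by simp
qed (use \<delta> cos_monotone_0_pi[of \<delta> pi] in auto)

lemma S_facts:
  assumes "x \<in> S"
  shows "norm x = 1" "\<bar>x \<bullet> pole\<bar> < 1" "\<tau>0 \<le> lat pole x"
    and "x \<bullet> pole \<noteq> cos \<delta> \<Longrightarrow> \<tau>0 < lat pole x"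
proof -
  show n: "norm x = 1" and a: "\<bar>x \<bullet> pole\<bar> < 1"
    using assms cos_delta by (auto simp: Omega_bar_iff[OF pole \<delta>])
  have t: "tanh (lat pole x) = - (x \<bullet> pole)" using a by (intro tanh_lat) auto
  have "x \<bullet> pole \<le> cos \<delta>" using assms by (simp add: Omega_bar_iff[OF pole \<delta>])
  then have "tanh \<tau>0 \<le> tanh (lat pole x)" unfolding t cos_delta(3) by simp
  then show "\<tau>0 \<le> lat pole x" by simp
  assume "x \<bullet> pole \<noteq> cos \<delta>"
  then have "tanh \<tau>0 < tanh (lat pole x)" unfolding t cos_delta(3) using \<open>x \<bullet> pole \<le> cos \<delta>\<close> by simp
  then show "\<tau>0 < lat pole x" by simp
qed

text \<open>What Young's inequality leaves when the Laplacian falls on the cutoff, whose derivatives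
  live on R <= \<tau> <= 2R. With q = p/(p-1), R^(-q) stems from one derivative of the cutoff,
  cosh^(\<alpha>/(p-1)) from the weight and cosh^(2q) from the factor cosh^2 of the
  Laplacian.\<close>

definition slab_integral :: "real \<Rightarrow> real \<Rightarrow> real \<Rightarrow> ennreal" where
  "slab_integral \<alpha> p R = (\<integral>\<^sup>+x. indicator S x * ennreal (indicator {R..2 * R} (lat pole x)
     * (R powr - (p / (p - 1)) * cosh (lat pole x) powr (\<alpha> / (p - 1) + 2 * (p / (p - 1))) * H (lat pole x)))
     \<partial>sphere_measure)"

lemma H_continuous: "continuous_on {\<tau>0..} H"
  using DERIV_isCont[OF dH(1)] by (auto intro!: continuous_at_imp_continuous_on)

text \<open>The limit \<open>T \<rightarrow> \<infinity>\<close> at fixed \<open>R\<close> removes the contribution of \<open>\<partial>\<^sub>t \<xi>\<close>.\<close>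

lemma spatial_estimate:
  assumes p: "1 < p" and f: "admissible_source pole \<delta> f" and weak: "weak_solution pole \<delta> lam \<alpha> p f u"
  obtains \<kappa> where "\<kappa> > 0"
    and "\<And>R. \<tau>0 + 1 \<le> R \<Longrightarrow>
      (\<integral>\<^sup>+x. ennreal (indicator {x \<in> S. lat pole x \<le> R} x *\<^sub>R f x * H (lat pole x)) \<partial>sphere_measure)
      \<le> ennreal \<kappa> * slab_integral \<alpha> p R"
proof -
  define q where "q = p / (p - 1)"
  define m where "m = real N - 2"
  have m: "0 < m" using dim by (simp add: m_def)
  have q: "1 < q" "(1 - 1 / p) * q = 1" "1 / p * q = 1 / (p - 1)"
    using p by (auto simp: q_def field_simps)
  obtain E E1 cE e0 where cE: "(cE :: real) > 0" and e0: "(e0 :: real) > 0"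
    and E: "\<And>t. (E has_real_derivative E1 t) (at t)" "continuous_on UNIV E1"
      "\<And>t. 0 \<le> E t" "\<And>t. E t \<le> 1" "\<And>t. t \<notin> {1..2} \<Longrightarrow> E t = 0" "\<And>t. t \<notin> {1..2} \<Longrightarrow> E1 t = 0"
      "\<And>t. \<bar>E1 t\<bar> \<le> cE * E t powr (1 / p)" "\<And>t. t \<in> {5/4..7/4} \<Longrightarrow> e0 \<le> E t"
    by (rule time_cutoff[OF p]) (rule that)
  obtain \<eta> \<eta>1 \<eta>2 c where c: "(c :: real) > 0"
    and d\<eta>: "\<And>y. (\<eta> has_real_derivative \<eta>1 y) (at y)" "\<And>y. (\<eta>1 has_real_derivative \<eta>2 y) (at y)"
    and \<eta>2_cont: "continuous_on UNIV \<eta>2"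
    and \<eta>: "\<And>y. 0 \<le> \<eta> y" "\<And>y. \<eta> y \<le> 1" "\<And>y. y \<le> 1 \<Longrightarrow> \<eta> y = 1" "\<And>y. y \<ge> 2 \<Longrightarrow> \<eta> y = 0"
      "\<And>y. y \<le> 1 \<or> 2 \<le> y \<Longrightarrow> \<eta>1 y = 0" "\<And>y. y \<le> 1 \<or> 2 \<le> y \<Longrightarrow> \<eta>2 y = 0"
      "\<And>y. \<bar>\<eta>1 y\<bar> \<le> c * \<eta> y powr (1 / p)" "\<And>y. \<bar>\<eta>2 y\<bar> \<le> c * \<eta> y powr (1 / p)"
    by (rule space_cutoff[OF p]) (rule that)
  \<comment> \<open>Collects the three error terms: 2C from 2 H' \<eta>', with |H'| <= C H, then 1
    from H \<eta>'', and m from m tanh t H \<eta>'.\<close>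
  define k where "k = c * (2 * C + 1 + m)"
  have k: "k > 0" using c C m by (simp add: k_def add_pos_pos)
  define \<kappa> where "\<kappa> = 2 / e0 * (2 * k) powr q"
  have fin: "finite_measure (sphere_measure :: 'a measure)" by (rule finite_measure_sphere_measure)
  show ?thesis
  proof (rule that[of \<kappa>])
    show "\<kappa> > 0" using e0 k by (simp add: \<kappa>_def)
    fix R assume R: "\<tau>0 + 1 \<le> R"
    have R1: "1 \<le> R" using R \<tau>0_pos by simp
    define g where "g t = H t * \<eta> (t / R)" for t
    define g1 where "g1 t = H1 t * \<eta> (t / R) + H t * (\<eta>1 (t / R) / R)" for t
    define g2 where "g2 t = H2 t * \<eta> (t / R) + 2 * (H1 t * (\<eta>1 (t / R) / R)) + H t * (\<eta>2 (t / R) / R\<^sup>2)" for t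
    have ds: "((\<lambda>t. t / R) has_real_derivative 1 / R) (at t)" for t
      using R1 by (auto intro!: derivative_eq_intros)
    have d1: "((\<lambda>t. \<eta> (t / R)) has_real_derivative \<eta>1 (t / R) / R) (at t)" for t
      using DERIV_chain2[OF d\<eta>(1) ds] by simp
    have d2: "((\<lambda>t. \<eta>1 (t / R) / R) has_real_derivative \<eta>2 (t / R) / R\<^sup>2) (at t)" for t
      using DERIV_cdivide[OF DERIV_chain2[OF d\<eta>(2) ds], of R] by (simp add: power2_eq_square)
    have dg: "(g has_real_derivative g1 t) (at t)" "(g1 has_real_derivative g2 t) (at t)" if "\<tau>0 \<le> t" for t
    proof -
      show "(g has_real_derivative g1 t) (at t)"
        using DERIV_mult'[OF dH(1)[OF that] d1] by (simp add: g_def[abs_def] g1_def add.commute)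
      show "(g1 has_real_derivative g2 t) (at t)"
        unfolding g1_def[abs_def]
        by (rule DERIV_cong[OF DERIV_add[OF DERIV_mult'[OF dH(2)[OF that] d1] DERIV_mult'[OF dH(1)[OF that] d2]]])
          (simp add: g2_def)
    qed
    have \<eta>c: "continuous_on {\<tau>0..} (\<lambda>t. \<eta> (t / R))" "continuous_on {\<tau>0..} (\<lambda>t. \<eta>1 (t / R) / R)"
      using DERIV_isCont[OF d1] DERIV_isCont[OF d2] by (auto intro!: continuous_at_imp_continuous_on)
    have \<eta>2c: "continuous_on {\<tau>0..} (\<lambda>t. \<eta>2 (t / R))"
      by (rule continuous_on_compose2[OF \<eta>2_cont]) (use R1 in \<open>auto intro!: continuous_intros\<close>)
    have Hc: "continuous_on {\<tau>0..} H1" "continuous_on {\<tau>0..} H2"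
      using DERIV_isCont[OF dH(2)] H2(2) by (auto intro!: continuous_at_imp_continuous_on)
    have g2c: "continuous_on {\<tau>0..} g2"
      unfolding g2_def using R1 by (intro continuous_intros \<eta>c \<eta>2c Hc H_continuous) auto
    have gpos: "0 \<le> g t" if "\<tau>0 \<le> t" for t using H_nonneg[OF that] \<eta>(1) by (simp add: g_def)
    \<comment> \<open>At the boundary value the cutoff is 1 with zero slope, so the boundary
      conditions are those of \<open>H\<close>.\<close>
    have \<tau>R: "\<tau>0 / R \<le> 1" using R R1 by simp
    have gbd: "g \<tau>0 = 0" "0 \<le> g1 \<tau>0"
      using H0 H1_bd \<tau>R \<eta>(3,5) by (auto simp: g_def g1_def)
    have far: "g t = 0" "g1 t = 0" "g2 t = 0" if "2 * R \<le> t" for t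
    proof -
      have "2 \<le> t / R" using that R1 by (simp add: field_simps)
      then show "g t = 0" "g1 t = 0" "g2 t = 0" using \<eta> by (auto simp: g_def g1_def g2_def)
    qed
    \<comment> \<open>\<open>H\<close> is controlled only on \<open>{\<tau>0..}\<close>, whereas
      \<open>weak_inequality\<close> asks for \<open>D\<close> and \<open>A\<close> that are
      nonnegative and measurable on the whole line; the truncation provides this.\<close>
    define Hm where "Hm t = indicator {\<tau>0..2 * R} t *\<^sub>R H t" for t
    have Hm_meas [measurable]: "Hm \<in> borel_measurable borel"
      unfolding Hm_def by (rule borel_measurable_continuous_on_indicator)
        (auto intro: continuous_on_subset[OF H_continuous])
    have Hm0: "0 \<le> Hm t" for t using H_nonneg[of t] by (auto simp: Hm_def indicator_def)
    \<comment> \<open>The exponents 1 - 1/p and 1/p distribute \<open>H\<close> so that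
      \<open>g\<close> receives its p-th root; the q-th power taken by Young's inequality later
      restores \<open>H\<close> to the first power.\<close>
    have split: "H t * \<eta> (t / R) powr (1 / p) = Hm t powr (1 - 1 / p) * g t powr (1 / p)"
      if "\<tau>0 \<le> t" "t \<le> 2 * R" for t
    proof (cases "H t = 0")
      case False
      then have h: "0 < H t" using H_nonneg[OF that(1)] by simp
      have "Hm t powr (1 - 1 / p) * g t powr (1 / p) = (H t powr (1 - 1 / p) * H t powr (1 / p)) * \<eta> (t / R) powr (1 / p)"
        using that h \<eta>(1) by (simp add: Hm_def g_def powr_mult)
      also have "H t powr (1 - 1 / p) * H t powr (1 / p) = H t" using h by (simp add: powr_add[symmetric])
      finally show ?thesis by simp
    qed (simp add: g_def)
    define D where "D t = Hm t powr (1 - 1 / p)" for t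
    define A where "A t = indicator {R..2 * R} t * ((cosh t)\<^sup>2 * (k / R * Hm t powr (1 - 1 / p)))" for t
    have D_ineq: "g t \<le> D t * g t powr (1 / p)" if "\<tau>0 \<le> t" for t
    proof (cases "t \<le> 2 * R")
      case True
      have "\<eta> (t / R) \<le> \<eta> (t / R) powr (1 / p)"
        using \<eta>(1,2)[of "t / R"] p powr_mono'[of "1 / p" 1 "\<eta> (t / R)"] by simp
      then have "H t * \<eta> (t / R) \<le> H t * \<eta> (t / R) powr (1 / p)"
        by (rule mult_left_mono) (rule H_nonneg[OF that])
      then show ?thesis using split[OF that True] by (simp add: D_def g_def)
    qed (use far(1) in simp)
    \<comment> \<open>Since \<open>H\<close> is an exact solution, every term with an
      undifferentiated cutoff cancels.\<close>
    have Lg: "g2 t - m * tanh t * g1 t + lam * g t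
       = 2 * (H1 t * (\<eta>1 (t / R) / R)) + H t * (\<eta>2 (t / R) / R\<^sup>2) - m * tanh t * (H t * (\<eta>1 (t / R) / R))"
      if "\<tau>0 \<le> t" for t
      unfolding g_def g1_def g2_def m_def H2(1)[OF that] by (simp add: algebra_simps)
    have A_ineq: "\<bar>(cosh t)\<^sup>2 * (g2 t - (real DIM('a) - 3) * tanh t * g1 t + lam * g t)\<bar> \<le> A t * g t powr (1 / p)"
      if t: "\<tau>0 \<le> t" for t
    proof (cases "R \<le> t \<and> t \<le> 2 * R")
      case False
      then have "t / R \<le> 1 \<or> 2 \<le> t / R" using R1 by (auto simp: field_simps)
      then have "g2 t - m * tanh t * g1 t + lam * g t = 0" unfolding Lg[OF t] using \<eta>(5,6) by simp
      then show ?thesis using dim k R1 by (simp add: m_def A_def)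
    next
      case True
      define w where "w = c * \<eta> (t / R) powr (1 / p)"
      have w: "0 \<le> w" using c by (simp add: w_def)
      have Ht: "0 \<le> H t" "\<bar>H1 t\<bar> \<le> C * H t" using H_nonneg[OF t] H1up[of t] True R by auto
      have tt: "\<bar>tanh t\<bar> \<le> 1" using tanh_real_bounds[of t] by (auto simp: abs_le_iff)
      have "\<bar>2 * (H1 t * (\<eta>1 (t / R) / R))\<bar> \<le> 2 * ((C * H t) * (w / R))"
        using Ht \<eta>(7)[of "t / R"] R1 C unfolding abs_mult w_def[symmetric]
        by (auto intro!: mult_mono divide_right_mono simp: abs_mult)
      moreover have "\<bar>H t * (\<eta>2 (t / R) / R\<^sup>2)\<bar> \<le> H t * (w / R)"
      proof -
        \<comment> \<open>R >= 1 allows 1/R^2 to be weakened to 1/R, the order of the other two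
          terms.\<close>
        have "\<bar>\<eta>2 (t / R)\<bar> / R\<^sup>2 \<le> w / R"
          using \<eta>(8)[of "t / R"] R1 w unfolding w_def[symmetric]
          by (intro frac_le) (auto simp: power2_eq_square mult_le_cancel_left1)
        from mult_left_mono[OF this Ht(1)] show ?thesis using Ht(1) by (simp add: abs_mult)
      qed
      moreover have "\<bar>m * tanh t * (H t * (\<eta>1 (t / R) / R))\<bar> \<le> m * 1 * (H t * (w / R))"
        using Ht \<eta>(7)[of "t / R"] R1 m tt unfolding abs_mult w_def[symmetric]
        by (intro mult_mono) (auto intro!: divide_right_mono)
      ultimately have "\<bar>g2 t - m * tanh t * g1 t + lam * g t\<bar>
         \<le> 2 * ((C * H t) * (w / R)) + H t * (w / R) + m * 1 * (H t * (w / R))"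
        unfolding Lg[OF t] by linarith
      also have "\<dots> = k / R * (H t * \<eta> (t / R) powr (1 / p))"
        by (simp add: k_def w_def algebra_simps add_divide_distrib)
      also have "\<dots> = (k / R * Hm t powr (1 - 1 / p)) * g t powr (1 / p)"
        using split[OF t] True by simp
      finally have "(cosh t)\<^sup>2 * \<bar>g2 t - m * tanh t * g1 t + lam * g t\<bar>
         \<le> (cosh t)\<^sup>2 * ((k / R * Hm t powr (1 - 1 / p)) * g t powr (1 / p))"
        by (rule mult_left_mono) simp
      then show ?thesis using True dim by (simp add: A_def m_def abs_mult mult.assoc)
    qed
    have [measurable]: "(cosh :: real \<Rightarrow> real) \<in> borel_measurable borel"
      by (intro borel_measurable_continuous_onI continuous_intros)
    have D_meas: "D \<in> borel_measurable borel" unfolding D_def by measurable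
    have A_meas: "A \<in> borel_measurable borel" unfolding A_def by measurable
    have A0: "0 \<le> A t" for t using k R1 by (simp add: A_def)
    define Y where "Y t = indicator {R..2 * R} t * (R powr (- q) * cosh t powr (\<alpha> / (p - 1) + 2 * q) * H t)" for t
    have ch: "cosh t > 0" for t :: real by (rule cosh_real_pos)
    have Dq: "(2 * (cosh t powr (\<alpha> / p) * (cE / T * D t))) powr q
        = T powr (- q) * ((2 * cE) powr q * cosh t powr (\<alpha> / (p - 1)) * Hm t)" if "T > 0" for T t
    proof -
      have "(2 * (cosh t powr (\<alpha> / p) * (cE / T * D t))) powr q
         = 2 powr q * ((cosh t powr (\<alpha> / p)) powr q * (cE powr q / T powr q * D t powr q))"
        using that cE by (simp add: powr_mult powr_divide D_def)
      moreover have "(cosh t powr (\<alpha> / p)) powr q = cosh t powr (\<alpha> / (p - 1))"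
        using p by (simp add: powr_powr q_def)
      moreover have "D t powr q = Hm t" using q Hm0[of t] by (simp add: D_def powr_powr)
      ultimately show ?thesis using cE by (simp add: powr_mult powr_minus divide_inverse mult_ac)
    qed
    have Aq: "(2 * (cosh t powr (\<alpha> / p) * A t)) powr q = (2 * k) powr q * Y t" if "\<tau>0 \<le> t" for t
    proof (cases "R \<le> t \<and> t \<le> 2 * R")
      case True
      have "(2 * (cosh t powr (\<alpha> / p) * A t)) powr q
         = 2 powr q * ((cosh t powr (\<alpha> / p)) powr q * (((cosh t)\<^sup>2) powr q * (k powr q / R powr q * (Hm t powr (1 - 1 / p)) powr q)))"
        using True k R1 by (simp add: A_def powr_mult powr_divide)
      moreover have "(cosh t powr (\<alpha> / p)) powr q * ((cosh t)\<^sup>2) powr q = cosh t powr (\<alpha> / (p - 1) + 2 * q)"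
        using p ch[of t] by (simp add: powr_powr powr_add q_def flip: powr_numeral)
      moreover have "(Hm t powr (1 - 1 / p)) powr q = H t" using q Hm0[of t] True that by (simp add: powr_powr Hm_def)
      ultimately show ?thesis using True k by (simp add: Y_def powr_mult powr_minus divide_inverse mult_ac)
    qed (use q in \<open>auto simp: A_def Y_def indicator_def\<close>)
    have "bounded ((\<lambda>t. (2 * cE) powr q * cosh t powr (\<alpha> / (p - 1)) * H t) ` {\<tau>0..2 * R})"
      using ch by (intro compact_imp_bounded compact_continuous_image continuous_intros
          continuous_on_subset[OF H_continuous]) (auto simp: less_imp_neq[symmetric])
    then obtain B0 where B0: "\<forall>t\<in>{\<tau>0..2 * R}. \<bar>(2 * cE) powr q * cosh t powr (\<alpha> / (p - 1)) * H t\<bar> \<le> B0"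
      unfolding bounded_iff by auto
    \<comment> \<open>\<open>B\<close> depends on R without any control as R grows, which forces T
      to infinity first. The maximum with 0 covers arguments outside the interval, where
      \<open>Hm\<close> vanishes.\<close>
    define B where "B = max 0 B0"
    have B: "(2 * cE) powr q * cosh t powr (\<alpha> / (p - 1)) * Hm t \<le> B" for t
      using abs_le_D1[OF B0[rule_format, of t]] by (cases "t \<in> {\<tau>0..2 * R}") (auto simp: B_def Hm_def)
    have B_nonneg: "0 \<le> B" by (simp add: B_def)
    define \<mu> where "\<mu> = measure (sphere_measure :: 'a measure) UNIV"
    have \<mu>: "emeasure (sphere_measure :: 'a measure) UNIV = ennreal \<mu>" "0 \<le> \<mu>"
      unfolding \<mu>_def by (auto simp: finite_measure.emeasure_eq_measure[OF fin])
    define X where "X = (\<integral>\<^sup>+x. ennreal (indicator S x *\<^sub>R f x * g (lat pole x)) \<partial>(sphere_measure :: 'a measure))"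
    define W where "W = (\<integral>\<^sup>+x. indicator S x * ennreal (Y (lat pole x)) \<partial>(sphere_measure :: 'a measure))"
    have S_meas [measurable]: "S \<in> sets borel" by (rule Omega_bar_measurable[OF pole \<delta>])
    have step: "ennreal (e0 / 2) * X \<le> ennreal (T powr (- q) * B * \<mu>) + ennreal ((2 * k) powr q) * W" if T: "T > 0" for T
    proof -
      interpret Z: zonal_test pole \<delta> T "2 * R" E E1 g g1 g2
        by unfold_locales (fact pole \<delta> T E dg g2c gpos gbd far)+
      have "ennreal (e0 / 2) * X \<le> (\<integral>\<^sup>+x. indicator S x * ennreal ((2 * (cosh (lat pole x) powr (\<alpha> / p) * (cE / T * D (lat pole x)))) powr q
          + (2 * (cosh (lat pole x) powr (\<alpha> / p) * A (lat pole x))) powr q) \<partial>sphere_measure)"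
        unfolding X_def q_def
        by (rule Z.weak_inequality[OF weak p f E(4,6,7,8) e0 cE far(2,3) D_ineq _ D_meas A_ineq A0 A_meas])
          (auto simp: D_def)
      also have "\<dots> \<le> (\<integral>\<^sup>+x. ennreal (T powr (- q) * B) + ennreal ((2 * k) powr q) * (indicator S x * ennreal (Y (lat pole x))) \<partial>sphere_measure)"
      proof (rule nn_integral_mono)
        fix x :: 'a
        show "indicator S x * ennreal ((2 * (cosh (lat pole x) powr (\<alpha> / p) * (cE / T * D (lat pole x)))) powr q
          + (2 * (cosh (lat pole x) powr (\<alpha> / p) * A (lat pole x))) powr q)
          \<le> ennreal (T powr (- q) * B) + ennreal ((2 * k) powr q) * (indicator S x * ennreal (Y (lat pole x)))"
        proof (cases "x \<in> S")
          case True
          note l = S_facts(3)[OF True]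
          have "T powr (- q) * ((2 * cE) powr q * cosh (lat pole x) powr (\<alpha> / (p - 1)) * Hm (lat pole x)) \<le> T powr (- q) * B"
            by (rule mult_left_mono[OF B]) simp
          then have "ennreal (T powr (- q) * ((2 * cE) powr q * cosh (lat pole x) powr (\<alpha> / (p - 1)) * Hm (lat pole x))
              + (2 * k) powr q * Y (lat pole x)) \<le> ennreal (T powr (- q) * B + (2 * k) powr q * Y (lat pole x))"
            by (intro ennreal_leI) simp
          also have "\<dots> = ennreal (T powr (- q) * B) + ennreal ((2 * k) powr q) * ennreal (Y (lat pole x))"
            using H_nonneg[OF l] B_nonneg by (subst ennreal_plus) (auto simp: Y_def ennreal_mult)
          finally show ?thesis using True unfolding Dq[OF T] Aq[OF l] by simp
        qed simp
      qed
      also have "\<dots> = ennreal (T powr (- q) * B) * emeasure (sphere_measure :: 'a measure) UNIV + ennreal ((2 * k) powr q) * W"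
      proof -
        have Ym: "(\<lambda>x. indicator S x * ennreal (Y (lat pole x))) \<in> borel_measurable (sphere_measure :: 'a measure)"
        proof -
          have "(\<lambda>t. indicator {R..2 * R} t * (R powr (- q) * cosh t powr (\<alpha> / (p - 1) + 2 * q) * Hm t)) \<in> borel_measurable borel"
            by measurable
          moreover have "Y = (\<lambda>t. indicator {R..2 * R} t * (R powr (- q) * cosh t powr (\<alpha> / (p - 1) + 2 * q) * Hm t))"
            using R by (auto simp: Y_def Hm_def indicator_def fun_eq_iff)
          ultimately have [measurable]: "Y \<in> borel_measurable borel" by simp
          show ?thesis by measurable
        qed
        show ?thesis
          unfolding W_def using Ym by (subst nn_integral_add) (auto simp: nn_integral_cmult)
      qed
      also have "ennreal (T powr (- q) * B) * emeasure (sphere_measure :: 'a measure) UNIV = ennreal (T powr (- q) * B * \<mu>)"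
        using \<mu> B_nonneg by (simp add: ennreal_mult[symmetric])
      finally show ?thesis .
    qed
    have "ennreal (e0 / 2) * X \<le> ennreal ((2 * k) powr q) * W"
    proof (rule ennreal_le_epsilon)
      fix e :: real assume e: "0 < e"
      \<comment> \<open>Replaces the limit T -> \<infinity>: for T >= 1 and q > 1, T^(-q) is at most
        1/T, so this T pushes the time term below e.\<close>
      define T where "T = max 1 (B * \<mu> / e)"
      have T: "1 \<le> T" "B * \<mu> / e \<le> T" by (auto simp: T_def)
      have "T powr (- q) \<le> T powr (- 1)" using T q by (intro powr_mono) auto
      also have "\<dots> = 1 / T" using T by (simp add: powr_minus_divide)
      finally have "T powr (- q) * (B * \<mu>) \<le> 1 / T * (B * \<mu>)"
        using B_nonneg \<mu> by (intro mult_right_mono) auto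
      also have "\<dots> \<le> e" using T e by (simp add: field_simps)
      finally have "ennreal (T powr (- q) * B * \<mu>) \<le> ennreal e" by (intro ennreal_leI) (simp add: mult.assoc)
      then have "ennreal (T powr (- q) * B * \<mu>) + ennreal ((2 * k) powr q) * W \<le> ennreal e + ennreal ((2 * k) powr q) * W"
        by (rule add_right_mono)
      moreover have "ennreal (e0 / 2) * X \<le> ennreal (T powr (- q) * B * \<mu>) + ennreal ((2 * k) powr q) * W"
        using T by (intro step) simp
      ultimately show "ennreal (e0 / 2) * X \<le> ennreal ((2 * k) powr q) * W + ennreal e"
        unfolding add.commute[of _ "ennreal e"] by (rule order_trans[rotated])
    qed
    then have "ennreal (2 / e0) * (ennreal (e0 / 2) * X) \<le> ennreal (2 / e0) * (ennreal ((2 * k) powr q) * W)"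
      by (rule mult_left_mono) simp
    then have XW: "X \<le> ennreal \<kappa> * W"
      using e0 unfolding mult.assoc[symmetric] \<kappa>_def by (simp add: ennreal_mult[symmetric])
    have "(\<integral>\<^sup>+x. ennreal (indicator {x \<in> S. lat pole x \<le> R} x *\<^sub>R f x * H (lat pole x)) \<partial>sphere_measure) \<le> X"
      unfolding X_def
    proof (rule nn_integral_mono)
      fix x :: 'a
      show "ennreal (indicator {x \<in> S. lat pole x \<le> R} x *\<^sub>R f x * H (lat pole x)) \<le> ennreal (indicator S x *\<^sub>R f x * g (lat pole x))"
      proof (cases "x \<in> S \<and> lat pole x \<le> R")
        case True
        then have "\<eta> (lat pole x / R) = 1" using R1 by (intro \<eta>(3)) simp
        then show ?thesis using True by (simp add: g_def)
      qed (auto simp: indicator_def)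
    qed
    also have "\<dots> \<le> ennreal \<kappa> * W" by (rule XW)
    finally show "(\<integral>\<^sup>+x. ennreal (indicator {x \<in> S. lat pole x \<le> R} x *\<^sub>R f x * H (lat pole x)) \<partial>sphere_measure)
      \<le> ennreal \<kappa> * slab_integral \<alpha> p R"
      unfolding W_def Y_def slab_integral_def q_def .
  qed
qed

end


section \<open>Growth of the slab integrals and the limit R -> \<infinity>\<close>

lemma cosh_powr_le:
  assumes "0 \<le> (t::real)"
  shows "cosh t powr a \<le> 2 powr \<bar>a\<bar> * exp (a * t)"
proof (cases "0 \<le> a")
  case True
  have "cosh t powr a \<le> exp t powr a" using True cosh_bounds(2)[OF assms] by (intro powr_mono2) auto
  also have "\<dots> = 1 * exp (a * t)" by (simp add: powr_def)
  also have "\<dots> \<le> 2 powr \<bar>a\<bar> * exp (a * t)" by (intro mult_right_mono) (auto simp: ge_one_powr_ge_zero)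
  finally show ?thesis .
next
  case False
  have "cosh t powr a \<le> (exp t / 2) powr a" using False cosh_bounds(1)[OF assms] by (intro powr_mono2') auto
  also have "\<dots> = 2 powr \<bar>a\<bar> * exp (a * t)"
    using False by (simp add: powr_def ln_div exp_add[symmetric] algebra_simps)
  finally show ?thesis .
qed

context dominant_profile
begin

text \<open>The powers of cosh and the growth of \<open>H\<close> combine to e^((N-e)\<tau>) with e
  = s - (\<alpha>+2)/(p-1) >= 0. \<open>slab_integral_le\<close> absorbs e^(N\<tau>) at the price of
  a factor R, and e^(-e\<tau>) <= e^(-eR) on the slab.\<close>

lemma slab_estimate:
  assumes p: "1 < p" and \<alpha>: "(\<alpha> + 2) / (p - 1) \<le> s"
  obtains K where "K > 0"
    and "\<And>R. \<tau>0 + 1 \<le> R \<Longrightarrow> slab_integral \<alpha> p R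
      \<le> ennreal (K * (R powr (1 - p / (p - 1)) * (if real N - 2 = 2 * s then R else 1) * exp (- (s - (\<alpha> + 2) / (p - 1)) * R)))"
proof -
  let ?slab = "\<lambda>R. {x. norm x = 1 \<and> \<bar>x \<bullet> pole\<bar> < 1 \<and> R \<le> lat pole x \<and> lat pole x \<le> 2 * R}"
  obtain c where c: "c > 0" and slab: "\<And>R. 1 \<le> R \<Longrightarrow> (\<integral>\<^sup>+x. ennreal (exp (real N * lat pole x))
        * indicator (?slab R) x \<partial>sphere_measure)
      \<le> ennreal (c * R)"
    by (rule slab_integral_le[OF pole dim(1)]) (rule that)
  define q where "q = p / (p - 1)"
  define a where "a = \<alpha> / (p - 1) + 2 * q"
  define e where "e = s - (\<alpha> + 2) / (p - 1)"
  have e: "0 \<le> e" using \<alpha> by (simp add: e_def)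
  \<comment> \<open>This identity turns the exponents \<alpha>/(p-1) + 2q into 2 +
    (\<alpha>+2)/(p-1), which is how the critical quotient appears.\<close>
  have "2 * q = 2 + 2 / (p - 1)" using p by (simp add: q_def field_simps)
  then have ae: "a + (real N - 2 - s) = real N - e"
    by (simp add: a_def e_def add_divide_distrib)
  define K1 where "K1 = 2 powr \<bar>a\<bar> * C * 2"
  have K1: "K1 > 0" using C by (simp add: K1_def)
  show ?thesis
  proof (rule that[of "K1 * c"])
    show "K1 * c > 0" using K1 c by simp
    fix R assume R: "\<tau>0 + 1 \<le> R"
    have R1: "1 \<le> R" using R \<tau>0_pos by simp
    define w where "w = (if real N - 2 = 2 * s then R else 1)"
    have w: "w > 0" using R1 by (simp add: w_def)
    define L where "L = K1 * (R powr (- q) * w * exp (- e * R))"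
    have L: "L \<ge> 0" using K1 w by (simp add: L_def)
    have bound: "R powr (- q) * cosh t powr a * H t \<le> L * exp (real N * t)" if t: "R \<le> t" "t \<le> 2 * R" for t
    proof -
      have t0: "\<tau>0 < t" "0 \<le> t" using t R R1 by auto
      have "H t \<le> C * exp ((real N - 2 - s) * t) * (if real N - 2 = 2 * s then t else 1)"
        by (rule Hup[OF t0(1)])
      also have "\<dots> \<le> C * exp ((real N - 2 - s) * t) * (2 * w)"
        using C t by (intro mult_left_mono) (auto simp: w_def)
      finally have H: "H t \<le> C * exp ((real N - 2 - s) * t) * (2 * w)" .
      have "cosh t powr a * H t \<le> (2 powr \<bar>a\<bar> * exp (a * t)) * (C * exp ((real N - 2 - s) * t) * (2 * w))"
        using H cosh_powr_le[OF t0(2)] Hpos[OF t0(1)] by (intro mult_mono) auto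
      also have "\<dots> = K1 * w * (exp (a * t) * exp ((real N - 2 - s) * t))" by (simp add: K1_def)
      also have "exp (a * t) * exp ((real N - 2 - s) * t) = exp (real N * t) * exp (- e * t)"
      proof -
        have "a * t + (real N - 2 - s) * t = (a + (real N - 2 - s)) * t" by (simp only: distrib_right)
        also have "\<dots> = real N * t + - e * t" unfolding ae by (simp add: left_diff_distrib)
        finally show ?thesis by (simp only: exp_add[symmetric])
      qed
      also have "K1 * w * (exp (real N * t) * exp (- e * t)) \<le> K1 * w * (exp (real N * t) * exp (- e * R))"
        using K1 w e t by (intro mult_left_mono) (auto intro: mult_left_mono)
      finally have "R powr (- q) * (cosh t powr a * H t) \<le> R powr (- q) * (K1 * w * (exp (real N * t) * exp (- e * R)))"
        by (rule mult_left_mono) simp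
      then show ?thesis by (simp add: L_def mult_ac)
    qed
    have "(\<integral>\<^sup>+x. indicator S x * ennreal (indicator {R..2 * R} (lat pole x)
            * (R powr (- q) * cosh (lat pole x) powr a * H (lat pole x))) \<partial>sphere_measure)
      \<le> (\<integral>\<^sup>+x. ennreal L * (ennreal (exp (real N * lat pole x))
        * indicator (?slab R) x) \<partial>sphere_measure)"
    proof (rule nn_integral_mono)
      fix x :: 'a
      show "indicator S x * ennreal (indicator {R..2 * R} (lat pole x)
            * (R powr (- q) * cosh (lat pole x) powr a * H (lat pole x)))
        \<le> ennreal L * (ennreal (exp (real N * lat pole x))
        * indicator (?slab R) x)"
      proof (cases "x \<in> S \<and> R \<le> lat pole x \<and> lat pole x \<le> 2 * R")
        case True
        then have "ennreal (R powr (- q) * cosh (lat pole x) powr a * H (lat pole x)) \<le> ennreal (L * exp (real N * lat pole x))"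
          by (intro ennreal_leI bound) auto
        then show ?thesis using True S_facts[of x] L by (simp add: ennreal_mult)
      qed (auto simp: indicator_def)
    qed
    also have "\<dots> = ennreal L * (\<integral>\<^sup>+x. ennreal (exp (real N * lat pole x))
        * indicator (?slab R) x \<partial>sphere_measure)"
      by (rule nn_integral_cmult) measurable
    also have "\<dots> \<le> ennreal L * ennreal (c * R)" by (rule mult_left_mono[OF slab[OF R1]]) simp
    also have "\<dots> = ennreal (L * (c * R))" using L c R1 by (simp add: ennreal_mult)
    also have "L * (c * R) = K1 * c * (R powr (1 - q) * w * exp (- e * R))"
    proof -
      have "R powr (1 - q) = R * R powr (- q)" using R1 by (simp add: powr_diff powr_minus_divide)
      then show ?thesis by (simp add: L_def)
    qed
    finally show "slab_integral \<alpha> p R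
      \<le> ennreal (K1 * c * (R powr (1 - p / (p - 1)) * (if real N - 2 = 2 * s then R else 1) * exp (- (s - (\<alpha> + 2) / (p - 1)) * R)))"
      unfolding slab_integral_def a_def w_def e_def q_def .
  qed
qed

lemma no_weak_solution:
  assumes p: "1 < p"
    and cond: "(\<alpha> + 2) / (p - 1) < s \<or> (\<alpha> + 2) / (p - 1) = s \<and> (real N - 2 = 2 * s \<longrightarrow> p < 2)"
    and f: "admissible_source pole \<delta> f"
  shows "\<not> weak_solution pole \<delta> lam \<alpha> p f u"
proof
  assume weak: "weak_solution pole \<delta> lam \<alpha> p f u"
  define q where "q = p / (p - 1)"
  define e where "e = s - (\<alpha> + 2) / (p - 1)"
  define G where "G R = R powr (1 - q) * (if real N - 2 = 2 * s then R else 1) * exp (- e * R)" for R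
  have q: "1 < q" using p by (simp add: q_def field_simps)
  have lim: "(G \<longlongrightarrow> 0) at_top"
  proof (cases "(\<alpha> + 2) / (p - 1) < s")
    case True
    then have e: "e > 0" by (simp add: e_def)
    have "((\<lambda>R. R powr (1 - q) * R * exp (- e * R)) \<longlongrightarrow> 0) at_top"
      "((\<lambda>R. R powr (1 - q) * 1 * exp (- e * R)) \<longlongrightarrow> 0) at_top"
      using e by real_asymp+
    then show ?thesis unfolding G_def by (cases "real N - 2 = 2 * s") simp_all
  next
    case False
    then have e: "e = 0" and crit: "real N - 2 = 2 * s \<longrightarrow> p < 2" using cond by (auto simp: e_def)
    show ?thesis
    proof (cases "real N - 2 = 2 * s")
      case True
      then have "2 < q" using crit p by (simp add: q_def field_simps)
      then have "((\<lambda>R. R powr (1 - q) * R) \<longlongrightarrow> 0) at_top" by real_asymp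
      then show ?thesis unfolding G_def using True e by simp
    next
      case False
      have "((\<lambda>R. R powr (1 - q)) \<longlongrightarrow> 0) at_top" using q by real_asymp
      then show ?thesis unfolding G_def using False e by simp
    qed
  qed
  obtain \<kappa> where \<kappa>: "\<kappa> > 0" and est1: "\<And>R. \<tau>0 + 1 \<le> R \<Longrightarrow> 
      (\<integral>\<^sup>+x. ennreal (indicator {x \<in> S. lat pole x \<le> R} x *\<^sub>R f x * H (lat pole x)) \<partial>sphere_measure)
      \<le> ennreal \<kappa> * slab_integral \<alpha> p R"
    by (rule spatial_estimate[OF p f weak]) (rule that)
  have le: "(\<alpha> + 2) / (p - 1) \<le> s" using cond by auto
  obtain K where K: "K > 0" and est2: "\<And>R. \<tau>0 + 1 \<le> R \<Longrightarrow> slab_integral \<alpha> p R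
      \<le> ennreal (K * G R)" by (rule slab_estimate[OF p le, folded q_def e_def, folded G_def]) (rule that)
  have S_meas [measurable]: "S \<in> sets borel" by (rule Omega_bar_measurable[OF pole \<delta>])
  have fm [measurable]: "(\<lambda>x. indicator S x *\<^sub>R f x) \<in> borel_measurable borel"
    using f unfolding admissible_source_def Lp_loc_def set_borel_measurable_def
    by (simp cong: measurable_cong_sets)
  have Hm [measurable]: "(\<lambda>x. indicator S x *\<^sub>R H (lat pole x)) \<in> borel_measurable borel"
  proof (rule borel_measurable_continuous_on_indicator[OF S_meas])
    interpret cap_domain pole S by (rule cap_domain_Omega_bar[OF pole \<delta>])
    show "continuous_on S (\<lambda>x. H (lat pole x))"
      using S_facts(3) by (intro continuous_on_compose2[OF H_continuous continuous_on_lat]) auto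
  qed
  define F where "F r x = ennreal (indicator {x \<in> S. lat pole x \<le> r} x *\<^sub>R f x * H (lat pole x))" for r x
  have F_meas: "F r \<in> borel_measurable borel" for r
  proof -
    have "(\<lambda>x. ennreal (indicator {x. lat pole x \<le> r} x * ((indicator S x *\<^sub>R f x) * (indicator S x *\<^sub>R H (lat pole x))))) \<in> borel_measurable borel"
      by measurable
    moreover have "F r = (\<lambda>x. ennreal (indicator {x. lat pole x \<le> r} x * ((indicator S x *\<^sub>R f x) * (indicator S x *\<^sub>R H (lat pole x)))))"
      by (auto simp: F_def indicator_def fun_eq_iff)
    ultimately show ?thesis by simp
  qed
  \<comment> \<open>The region \<tau> <= n stays fixed while R tends to infinity; it lies in the
    region \<tau> <= R once R >= n. The countably many n exhaust \<open>S\<close>.\<close>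
  have AE_n: "AE x in sphere_measure. F (real n) x = 0" for n
  proof -
    let ?J = "\<integral>\<^sup>+x. F (real n) x \<partial>sphere_measure"
    have ev: "\<forall>\<^sub>F R in at_top. ?J \<le> ennreal (\<kappa> * (K * G R))"
      using eventually_ge_at_top[of "max (\<tau>0 + 1) (real n)"]
    proof eventually_elim
      case (elim R)
      have "?J \<le> (\<integral>\<^sup>+x. F R x \<partial>sphere_measure)"
      proof (rule nn_integral_mono)
        fix x show "F (real n) x \<le> F R x"
          using elim by (auto simp: F_def indicator_def)
      qed
      also have "\<dots> \<le> ennreal \<kappa> * ennreal (K * G R)"
        using est1[of R] mult_left_mono[OF est2[of R], of "ennreal \<kappa>"] elim unfolding F_def
        by (meson max.boundedE order_trans zero_le)
      also have "\<dots> = ennreal (\<kappa> * (K * G R))" using \<kappa> by (simp add: ennreal_mult'[symmetric])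
      finally show ?case .
    qed
    have "((\<lambda>R. ennreal (\<kappa> * (K * G R))) \<longlongrightarrow> ennreal (\<kappa> * (K * 0))) at_top"
      by (intro tendsto_ennrealI tendsto_mult tendsto_const lim)
    then have "?J \<le> ennreal (\<kappa> * (K * 0))"
      using ev by (rule tendsto_lowerbound) simp
    then have "?J = 0" by simp
    then show ?thesis
      using nn_integral_0_iff_AE[of "F (real n)" sphere_measure] F_meas[of "real n"]
      by (simp cong: measurable_cong_sets)
  qed
  have "AE x in sphere_measure. \<forall>n. F (real n) x = 0"
    using AE_n by (simp add: AE_all_countable)
  \<comment> \<open>\<open>H\<close> vanishes on the boundary parallel, so nothing follows about f
    there; the parallel itself is a null set.\<close>
  moreover have "AE x in sphere_measure. x \<notin> {x. norm x = 1 \<and> x \<bullet> pole = cos \<delta>}"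
  proof (rule AE_not_in)
    have "{x :: 'a. norm x = 1 \<and> x \<bullet> pole = cos \<delta>} \<in> sets borel" by measurable
    then show "{x. norm x = 1 \<and> x \<bullet> pole = cos \<delta>} \<in> null_sets sphere_measure"
      using sphere_measure_parallel_null[OF pole cos_delta(1,2)] by (simp add: null_sets_def)
  qed
  moreover have "AE x in sphere_measure. x \<in> S \<longrightarrow> f x \<ge> 0"
    using f unfolding admissible_source_def by blast
  ultimately have "AE x in sphere_measure. x \<in> S \<longrightarrow> f x = 0"
  proof eventually_elim
    case (elim x)
    show ?case
    proof
      assume x: "x \<in> S"
      have l: "\<tau>0 < lat pole x" using S_facts[OF x] elim(2) by auto
      obtain n where n: "lat pole x \<le> real n" using real_arch_simple by blast
      have "F (real n) x = 0" using elim(1) by blast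
      then have "ennreal (f x * H (lat pole x)) = 0" using x n by (simp add: F_def)
      \<comment> \<open>A zero value of \<open>ennreal\<close> excludes only positive arguments; f
        >= 0 turns this into equality.\<close>
      then have "f x * H (lat pole x) \<le> 0" by (simp only: ennreal_eq_0_iff)
      then have "f x \<le> 0" using Hpos[OF l] by (simp add: mult_le_0_iff)
      then show "f x = 0" using elim(3) x by simp
    qed
  qed
  then show False using f unfolding admissible_source_def by blast
qed

end

text \<open>\<phi> and \<open>\<tau>1\<close> are built from N and \<lambda> alone, so a single
  threshold serves all \<alpha>, p and f; only the second solution \<open>H\<close> is constructed
  anew for each \<delta>.\<close>

lemma nonexistence:
  fixes pole :: "'a::euclidean_space"
  assumes N: "N \<ge> 3" "DIM('a) = N + 1" and pole: "norm pole = 1"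
    and lam: "0 < lam" "lam \<le> lambda_star N"
  defines "s \<equiv> lambda_exp N lam"
  obtains a where "a \<in> {0..<pi}"
    and "\<And>\<alpha> \<delta> p f u. \<lbrakk>\<delta> \<in> {a<..<pi}; 1 < p; (\<alpha> + 2) / (p - 1) < s \<or>
           (\<alpha> + 2) / (p - 1) = s \<and> (lam = lambda_star N \<longrightarrow> p < 2); admissible_source pole \<delta> f\<rbrakk>
         \<Longrightarrow> \<not> weak_solution pole \<delta> lam \<alpha> p f u"
proof -
  note s = lambda_exp_props[OF N(1) lam, folded s_def]
  \<comment> \<open>\<open>dominant_solution\<close> takes a natural number m because of the power
    \<open>cosh t ^ m\<close>; N >= 3 makes the subtraction exact.\<close>
  have m: "real (N - 2) = real N - 2" using N by simp
  obtain \<phi> \<phi>1 \<phi>2 \<tau>1 where \<tau>1: "\<tau>1 > 0"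
    and \<phi>: "\<And>t. t > \<tau>1 \<Longrightarrow> (\<phi> has_real_derivative \<phi>1 t) (at t)"
      "\<And>t. t > \<tau>1 \<Longrightarrow> (\<phi>1 has_real_derivative \<phi>2 t) (at t)"
      "\<And>t. t > \<tau>1 \<Longrightarrow> \<phi>2 t = (real N - 2) * tanh t * \<phi>1 t - lam * \<phi> t"
      "\<And>t. t > \<tau>1 \<Longrightarrow> exp (s * t) / 2 \<le> \<phi> t"
      "\<And>t. t > \<tau>1 \<Longrightarrow> \<phi> t \<le> 2 * exp (s * t)"
      "\<And>t. t > \<tau>1 \<Longrightarrow> \<bar>\<phi>1 t\<bar> \<le> (s + 1) * exp (s * t)"
    by (rule recessive_solution[OF s(1) less_imp_le[OF s(2)] s(3) less_imp_le[OF lam(1)]]) (rule that)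
  have Tb: "-1 < tanh \<tau>1" "tanh \<tau>1 < 1" using tanh_real_bounds[of \<tau>1] by auto
  have a: "0 < arccos (- tanh \<tau>1)" "arccos (- tanh \<tau>1) < pi"
    using Tb arccos_lt_bounded[of "- tanh \<tau>1"] by auto
  show ?thesis
  proof (rule that[of "arccos (- tanh \<tau>1)"])
    show "arccos (- tanh \<tau>1) \<in> {0..<pi}" using a by simp
    fix \<alpha> \<delta> p :: real and f u
    assume \<delta>: "\<delta> \<in> {arccos (- tanh \<tau>1)<..<pi}" and p: "1 < p"
      and cond: "(\<alpha> + 2) / (p - 1) < s \<or> (\<alpha> + 2) / (p - 1) = s \<and> (lam = lambda_star N \<longrightarrow> p < 2)"
      and f: "admissible_source pole \<delta> f"
    have \<delta>': "0 < \<delta>" "\<delta> < pi" using \<delta> a by auto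
    define \<tau>0 where "\<tau>0 = artanh (- cos \<delta>)"
    have "cos \<delta> < cos (arccos (- tanh \<tau>1))"
      using \<delta> a by (intro cos_monotone_0_pi) auto
    then have "cos \<delta> < - tanh \<tau>1" using Tb by simp
    moreover have "-1 < cos \<delta>" using \<delta>' cos_monotone_0_pi[of \<delta> pi] by simp
    ultimately have "tanh \<tau>1 < tanh \<tau>0" using Tb unfolding \<tau>0_def by (subst tanh_artanh) auto
    then have \<tau>: "\<tau>1 < \<tau>0" by simp
    obtain H H1 H2 C where C: "(C :: real) > 0"
      and H: "\<And>t. t > \<tau>1 \<Longrightarrow> (H has_real_derivative H1 t) (at t)"
        "\<And>t. t > \<tau>1 \<Longrightarrow> (H1 has_real_derivative H2 t) (at t)"
        "\<And>t. t > \<tau>1 \<Longrightarrow> H2 t = real (N - 2) * tanh t * H1 t - lam * H t"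
        "\<And>t. t > \<tau>1 \<Longrightarrow> isCont H2 t"
        "H \<tau>0 = 0"
        "\<And>t. t > \<tau>0 \<Longrightarrow> H t > 0"
        "\<And>t. t > \<tau>0 \<Longrightarrow> H t \<le> C * exp ((real (N - 2) - s) * t) * (if real (N - 2) = 2 * s then t else 1)"
        "\<And>t. t \<ge> \<tau>0 + 1 \<Longrightarrow> \<bar>H1 t\<bar> \<le> C * H t"
      by (rule dominant_solution[OF less_imp_le[OF s(2)] s(3)[folded m] \<tau>1 \<tau> \<phi>(1,2) \<phi>(3)[folded m] \<phi>(4,5,6)])
        (assumption | rule that)+
    have "dominant_profile pole N \<delta> lam s C H H1 H2"
      using N pole \<delta>' s(2,3) C H \<tau> \<tau>1 unfolding \<tau>0_def m by unfold_locales auto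
    then show "\<not> weak_solution pole \<delta> lam \<alpha> p f u"
      using dominant_profile.no_weak_solution[OF _ p _ f] cond s(4) by blast
  qed
qed

theorem theorem1p2:
  fixes N :: nat and lam :: real and pole :: "'a::euclidean_space"
  assumes "N \<ge> 3"
    and "DIM('a) = N + 1"
    and "pole \<in> sphere 0 1"
    and "0 < lam" and "lam \<le> lambda_star N"
  shows
    "(\<exists>a\<in>{0..<pi}. \<forall>\<alpha>::real. \<forall>\<delta>\<in>{a<..<pi}.
        (\<forall>p::real. p > max 1 (1 + (\<alpha> + 2) / lambda_exp N lam) \<longrightarrow>
           (\<forall>f. admissible_source pole \<delta> f \<longrightarrow>
              \<not> (\<exists>u. weak_solution pole \<delta> lam \<alpha> p f u)))
      \<and> (\<alpha> > -2 \<and> lam < lambda_star N \<or>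
          -2 < \<alpha> \<and> \<alpha> < (real N - 6) / 2 \<and> lam = lambda_star N \<longrightarrow>
           (\<forall>p::real. p = 1 + (\<alpha> + 2) / lambda_exp N lam \<longrightarrow>
             (\<forall>f. admissible_source pole \<delta> f \<longrightarrow>
                \<not> (\<exists>u. weak_solution pole \<delta> lam \<alpha> p f u)))))
   \<and> (\<forall>\<alpha> p::real. \<alpha> > -2 \<and> 1 < p \<and> p < 1 + (\<alpha> + 2) / lambda_exp N lam \<longrightarrow>
        (\<exists>b\<in>{0..<pi}. \<forall>\<delta>\<in>{b<..<pi}.
           \<exists>f. continuous_on (Omega_bar pole \<delta>) f \<and> (\<forall>x\<in>Omega_bar pole \<delta>. f x > 0) \<and>
               (\<exists>u. classical_solution pole \<delta> lam \<alpha> p f u)))"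
proof -
  have pole: "norm pole = 1" using assms(3) by simp
  define s where "s = lambda_exp N lam"
  note s = lambda_exp_props[OF assms(1,4,5), folded s_def]
  obtain a where a: "a \<in> {0..<pi}"
    and none: "\<And>\<alpha> \<delta> p f u. \<lbrakk>\<delta> \<in> {a<..<pi}; 1 < p; (\<alpha> + 2) / (p - 1) < s \<or>
           (\<alpha> + 2) / (p - 1) = s \<and> (lam = lambda_star N \<longrightarrow> p < 2); admissible_source pole \<delta> f\<rbrakk>
         \<Longrightarrow> \<not> weak_solution pole \<delta> lam \<alpha> p f u"
    by (rule nonexistence[OF assms(1,2) pole assms(4,5), folded s_def]) (rule that)
  show ?thesis
    unfolding s_def[symmetric]
  proof (intro conjI)
    show "\<exists>a\<in>{0..<pi}. \<forall>\<alpha>::real. \<forall>\<delta>\<in>{a<..<pi}.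
        (\<forall>p::real. p > max 1 (1 + (\<alpha> + 2) / s) \<longrightarrow>
           (\<forall>f. admissible_source pole \<delta> f \<longrightarrow>
              \<not> (\<exists>u. weak_solution pole \<delta> lam \<alpha> p f u)))
      \<and> (\<alpha> > -2 \<and> lam < lambda_star N \<or>
          -2 < \<alpha> \<and> \<alpha> < (real N - 6) / 2 \<and> lam = lambda_star N \<longrightarrow>
           (\<forall>p::real. p = 1 + (\<alpha> + 2) / s \<longrightarrow>
             (\<forall>f. admissible_source pole \<delta> f \<longrightarrow>
                \<not> (\<exists>u. weak_solution pole \<delta> lam \<alpha> p f u))))"
    proof (intro bexI[OF _ a] allI ballI conjI impI notI)
      fix \<alpha> \<delta> p f
      assume \<delta>: "\<delta> \<in> {a<..<pi}" and p: "p > max 1 (1 + (\<alpha> + 2) / s)"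
        and f: "admissible_source pole \<delta> f" and u: "\<exists>u. weak_solution pole \<delta> lam \<alpha> p f u"
      have "(\<alpha> + 2) / (p - 1) < s" using p s(2) by (simp add: field_simps)
      then show False using none[OF \<delta> _ _ f] p u by auto
    next
      fix \<alpha> \<delta> p f
      assume \<delta>: "\<delta> \<in> {a<..<pi}" and \<alpha>: "\<alpha> > -2 \<and> lam < lambda_star N \<or>
          -2 < \<alpha> \<and> \<alpha> < (real N - 6) / 2 \<and> lam = lambda_star N"
        and p: "p = 1 + (\<alpha> + 2) / s"
        and f: "admissible_source pole \<delta> f" and u: "\<exists>u. weak_solution pole \<delta> lam \<alpha> p f u"
      have p1: "1 < p" using p s(2) \<alpha> by (auto simp: divide_pos_pos)
      have "p - 1 = (\<alpha> + 2) / s" "\<alpha> + 2 \<noteq> 0" using p \<alpha> by auto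
      then have e: "(\<alpha> + 2) / (p - 1) = s" by simp
      \<comment> \<open>For the double root 2s = N - 2, so (N - 6)/2 = s - 2 and the hypothesis on
        \<alpha> reads \<alpha> + 2 < s.\<close>
      have "p < 2" if "lam = lambda_star N"
      proof -
        have "real N - 2 = 2 * s" using that s(4) by simp
        then have "\<alpha> + 2 < s" using \<alpha> that by auto
        then show ?thesis using p s(2) by simp
      qed
      then show False using none[OF \<delta> p1 _ f] e u by auto
    qed
    show "\<forall>\<alpha> p::real. \<alpha> > -2 \<and> 1 < p \<and> p < 1 + (\<alpha> + 2) / s \<longrightarrow>
        (\<exists>b\<in>{0..<pi}. \<forall>\<delta>\<in>{b<..<pi}.
           \<exists>f. continuous_on (Omega_bar pole \<delta>) f \<and> (\<forall>x\<in>Omega_bar pole \<delta>. f x > 0) \<and>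
               (\<exists>u. classical_solution pole \<delta> lam \<alpha> p f u))"
      using classical_solution_exists[OF assms(1,2) pole assms(4,5)] unfolding s_def by blast
  qed
qed

end
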